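(* Consider an exponential noise-to-state stable system with Lyapunov function $V$, constant $c>0$, $\gamma_{max}$ and constants $c^{-1}\gamma_{max}<V_0<V_1$ as in the context, and let $$t_{uc}=c^{-1}\,\frac{V_1-V_0}{V_1-c^{-1}\gamma_{max}}\,\ln\frac{V_1}{c^{-1}\gamma_{max}},\qquad t_{dc}=c^{-1}\Big(1+\ln\frac{V_1-c^{-1}\gamma_{max}}{V_0-c^{-1}\gamma_{max}}\Big).$$ Then, almost surely, $$\liminf_{T\to\infty}\frac1T\int_0^T\mathbb{1}_{\{V(x(s))<V_1\}}\,\mathrm{d}s\ \ge\ \frac{t_{uc}}{t_{dc}+t_{uc}}.$$
   Context: The system is $\mathrm{d}x = f(x)\,\mathrm{d}t + h(x)\Sigma(t)\,\mathrm{d}\omega$, $x\in\mathbb{R}^N$, $\omega$ a standard $m$-dimensional Wiener process, $\Sigma(t)\in\mathbb{R}^{m\times m}$ positive definite, bounded and Borel measurable in $t$, $f:\mathbb{R}^N\to\mathbb{R}^N$ and $h:\mathbb{R}^N\to\mathbb{R}^{N\times m}$ locally Lipschitz. $\mathcal{K}_\infty$ denotes continuous strictly increasing $\rho:[0,\infty)\to[0,\infty)$ with $\rho(0)=0$ and $\rho(r)\to\infty$. Exponential noise-to-state stability means: there are a $C^2$ function $V$, $\alpha_1,\alpha_2,\alpha_3,\gamma\in\mathcal{K}_\infty$ and $c>0$ with $\alpha_1(\|x\|_2)\le V(x)\le\alpha_2(\|x\|_2)$, $\alpha_3(\|x\|_2)\ge cV(x)$ and $\mathcal{L}V(x)\triangleq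 \frac{\partial V}{\partial x}f(x)+\tfrac12\mathrm{tr}\{\Sigma(t)^\top h(x)^\top \frac{\partial^2V}{\partial x^2}h(x)\Sigma(t)\}\le-\alpha_3(\|x\|_2)+\gamma(\|\Sigma(t)\Sigma(t)^\top\|_F)$. Let $\gamma_{max}=\gamma(\sup_s\|\Sigma(s)\Sigma(s)^\top\|_F)$. $\mathbb{1}_{\{\cdot\}}$ is the indicator function of an event. *)

theory Defs
  imports "HOL-Analysis.Analysis" "HOL-Probability.Probability"
begin

definition class_K_inf :: "(real \<Rightarrow> real) \<Rightarrow> bool" where
  "class_K_inf \<rho> \<longleftrightarrow> continuous_on {0..} \<rho> \<and> strict_mono_on {0..} \<rho> \<and> \<rho> 0 = 0
     \<and> filterlim \<rho> at_top at_top"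

definition locally_lipschitz :: "('x::metric_space \<Rightarrow> 'y::metric_space) \<Rightarrow> bool" where
  "locally_lipschitz g \<longleftrightarrow> (\<forall>x. \<exists>r>0. \<exists>L. L-lipschitz_on (cball x r) g)"

definition frob_norm :: "real^'m^'n \<Rightarrow> real" where
  "frob_norm A = sqrt (\<Sum>i\<in>UNIV. \<Sum>j\<in>UNIV. (A $ i $ j)\<^sup>2)"

definition C2_with :: "(real^'n \<Rightarrow> real) \<Rightarrow> (real^'n \<Rightarrow> real^'n) \<Rightarrow> (real^'n \<Rightarrow> real^'n^'n) \<Rightarrow> bool" where
  "C2_with V DV HV \<longleftrightarrow>
     (\<forall>x. (V has_derivative (\<lambda>v. DV x \<bullet> v)) (at x)) \<and>
     (\<forall>x. (DV has_derivative (\<lambda>v. HV x *v v)) (at x)) \<and>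
     continuous_on UNIV HV"

definition gen_L :: "(real^'n \<Rightarrow> real^'n) \<Rightarrow> (real^'n \<Rightarrow> real^'m^'n) \<Rightarrow> (real \<Rightarrow> real^'m^'m)
     \<Rightarrow> (real^'n \<Rightarrow> real^'n) \<Rightarrow> (real^'n \<Rightarrow> real^'n^'n) \<Rightarrow> real^'n \<Rightarrow> real \<Rightarrow> real" where
  "gen_L f h \<Sigma> DV HV x t =
     DV x \<bullet> f x + (1/2) * trace (transpose (\<Sigma> t) ** transpose (h x) ** HV x ** h x ** \<Sigma> t)"

definition filtration_of :: "'a measure \<Rightarrow> (real \<Rightarrow> 'a measure) \<Rightarrow> bool" where
  "filtration_of M F \<longleftrightarrow>
     (\<forall>t\<ge>0. space (F t) = space M \<and> sets (F t) \<subseteq> sets M) \<and>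
     (\<forall>s t. 0 \<le> s \<longrightarrow> s \<le> t \<longrightarrow> sets (F s) \<subseteq> sets (F t))"

definition wiener_process ::
  "'a measure \<Rightarrow> (real \<Rightarrow> 'a measure) \<Rightarrow> (real \<Rightarrow> 'a \<Rightarrow> real^'m) \<Rightarrow> bool" where
  "wiener_process M F w \<longleftrightarrow>
     (\<forall>\<omega>\<in>space M. w 0 \<omega> = 0 \<and> continuous_on {0..} (\<lambda>t. w t \<omega>)) \<and>
     (\<forall>t\<ge>0. w t \<in> borel_measurable (F t)) \<and>
     (\<forall>s t. 0 \<le> s \<longrightarrow> s < t \<longrightarrow>
        distributed M lborel (\<lambda>\<omega>. w t \<omega> - w s \<omega>)
          (\<lambda>y. ennreal (\<Prod>i\<in>UNIV. normal_density 0 (sqrt (t - s)) (y $ i))) \<and>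
        (\<forall>A\<in>sets (F s). \<forall>B\<in>sets borel.
           measure M (A \<inter> {\<omega>\<in>space M. w t \<omega> - w s \<omega> \<in> B})
             = measure M A * measure M {\<omega>\<in>space M. w t \<omega> - w s \<omega> \<in> B}))"

text \<open>Convergence in probability (in outer-measure form, robust w.r.t. measurability).\<close>
definition small_in_prob :: "'a measure \<Rightarrow> (nat \<Rightarrow> 'a \<Rightarrow> ennreal) \<Rightarrow> bool" where
  "small_in_prob M Z \<longleftrightarrow> (\<forall>\<epsilon>>0. \<forall>\<delta>>0. \<forall>\<^sub>F n in sequentially.
      \<exists>A\<in>sets M. measure M A \<le> \<delta> \<and> {\<omega>\<in>space M. ennreal \<epsilon> < Z n \<omega>} \<subseteq> A)"

definition step_proc :: "nat \<Rightarrow> (nat \<Rightarrow> real) \<Rightarrow> (nat \<Rightarrow> 'a \<Rightarrow> 'b::real_vector) \<Rightarrow> real \<Rightarrow> 'a \<Rightarrow> 'b" where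
  "step_proc k \<tau> \<xi> s \<omega> = (\<Sum>i<k. indicator {\<tau> i..<\<tau> (Suc i)} s *\<^sub>R \<xi> i \<omega>)"

definition elem_integral ::
  "(real \<Rightarrow> 'a \<Rightarrow> real^'m) \<Rightarrow> nat \<Rightarrow> (nat \<Rightarrow> real) \<Rightarrow> (nat \<Rightarrow> 'a \<Rightarrow> real^'m^'n) \<Rightarrow> 'a \<Rightarrow> real^'n" where
  "elem_integral w k \<tau> \<xi> \<omega> = (\<Sum>i<k. \<xi> i \<omega> *v (w (\<tau> (Suc i)) \<omega> - w (\<tau> i) \<omega>))"

definition adapted_partition ::
  "(real \<Rightarrow> 'a measure) \<Rightarrow> real \<Rightarrow> nat \<Rightarrow> (nat \<Rightarrow> real) \<Rightarrow> (nat \<Rightarrow> 'a \<Rightarrow> real^'m^'n) \<Rightarrow> bool" where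
  "adapted_partition F T k \<tau> \<xi> \<longleftrightarrow> \<tau> 0 = 0 \<and> \<tau> k = T \<and> (\<forall>i<k. \<tau> i < \<tau> (Suc i)) \<and>
     (\<forall>i<k. \<xi> i \<in> borel_measurable (F (\<tau> i)))"

definition ito_integral ::
  "'a measure \<Rightarrow> (real \<Rightarrow> 'a measure) \<Rightarrow> (real \<Rightarrow> 'a \<Rightarrow> real^'m) \<Rightarrow> (real \<Rightarrow> 'a \<Rightarrow> real^'m^'n)
     \<Rightarrow> (real \<Rightarrow> 'a \<Rightarrow> real^'n) \<Rightarrow> bool" where
  "ito_integral M F w H I \<longleftrightarrow>
     (\<forall>\<omega>\<in>space M. continuous_on {0..} (\<lambda>t. I t \<omega>)) \<and>
     (\<forall>t\<ge>0. I t \<in> borel_measurable (F t)) \<and>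
     (\<forall>T\<ge>0. \<forall>k :: nat \<Rightarrow> nat. \<forall>\<tau> :: nat \<Rightarrow> nat \<Rightarrow> real. \<forall>\<xi> :: nat \<Rightarrow> nat \<Rightarrow> 'a \<Rightarrow> real^'m^'n.
        (\<forall>n. adapted_partition F T (k n) (\<tau> n) (\<xi> n)) \<longrightarrow>
        small_in_prob M (\<lambda>n \<omega>. (\<integral>\<^sup>+ s\<in>{0..T}.
            ennreal ((norm (step_proc (k n) (\<tau> n) (\<xi> n) s \<omega> - H s \<omega>))\<^sup>2) \<partial>lborel)) \<longrightarrow>
        small_in_prob M (\<lambda>n \<omega>. ennreal (dist (elem_integral w (k n) (\<tau> n) (\<xi> n) \<omega>) (I T \<omega>))))"


definition sde_solution ::
  "'a measure \<Rightarrow> (real \<Rightarrow> 'a measure) \<Rightarrow> (real \<Rightarrow> 'a \<Rightarrow> real^'m) \<Rightarrow> (real^'n \<Rightarrow> real^'n)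
     \<Rightarrow> (real^'n \<Rightarrow> real^'m^'n) \<Rightarrow> (real \<Rightarrow> real^'m^'m) \<Rightarrow> (real \<Rightarrow> 'a \<Rightarrow> real^'n) \<Rightarrow> bool" where
  "sde_solution M F w f h \<Sigma> x \<longleftrightarrow>
     (\<forall>\<omega>\<in>space M. continuous_on {0..} (\<lambda>t. x t \<omega>)) \<and>
     (\<forall>t\<ge>0. x t \<in> borel_measurable (F t)) \<and>
     (\<exists>I. ito_integral M F w (\<lambda>s \<omega>. h (x s \<omega>) ** \<Sigma> s) I \<and>
        (\<forall>t\<ge>0. AE \<omega> in M. x t \<omega> = x 0 \<omega> + integral {0..t} (\<lambda>s. f (x s \<omega>)) + I t \<omega>))"

definition exp_NSS ::
  "(real^'n \<Rightarrow> real^'n) \<Rightarrow> (real^'n \<Rightarrow> real^'m^'n) \<Rightarrow> (real \<Rightarrow> real^'m^'m)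
   \<Rightarrow> (real^'n \<Rightarrow> real) \<Rightarrow> (real^'n \<Rightarrow> real^'n) \<Rightarrow> (real^'n \<Rightarrow> real^'n^'n)
   \<Rightarrow> (real \<Rightarrow> real) \<Rightarrow> (real \<Rightarrow> real) \<Rightarrow> (real \<Rightarrow> real) \<Rightarrow> (real \<Rightarrow> real) \<Rightarrow> real \<Rightarrow> bool" where
  "exp_NSS f h \<Sigma> V DV HV \<alpha>1 \<alpha>2 \<alpha>3 \<gamma> c \<longleftrightarrow>
     C2_with V DV HV \<and> class_K_inf \<alpha>1 \<and> class_K_inf \<alpha>2 \<and> class_K_inf \<alpha>3 \<and> class_K_inf \<gamma> \<and> c > 0 \<and>
     (\<forall>x. \<alpha>1 (norm x) \<le> V x \<and> V x \<le> \<alpha>2 (norm x)) \<and>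
     (\<forall>x. \<alpha>3 (norm x) \<ge> c * V x) \<and>
     (\<forall>x. \<forall>t\<ge>0. gen_L f h \<Sigma> DV HV x t \<le> - \<alpha>3 (norm x) + \<gamma> (frob_norm (\<Sigma> t ** transpose (\<Sigma> t))))"

definition gamma_max :: "(real \<Rightarrow> real) \<Rightarrow> (real \<Rightarrow> real^'m^'m) \<Rightarrow> real" where
  "gamma_max \<gamma> \<Sigma> = \<gamma> (SUP s\<in>{0..}. frob_norm (\<Sigma> s ** transpose (\<Sigma> s)))"

end

theory Submission
  imports Defs "HOL-Real_Asymp.Real_Asymp"
begin

text \<open>Put \<open>g = gamma_max \<gamma> \<Sigma> / c\<close>. For every \<open>K > 0\<close> the generator inequality
  \<open>L V \<le> - c (V - g)\<close> makes \<open>(K + V (x T)) exp (\<integral>\<^sub>0\<^sup>T k (x s) ds)\<close> with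
  \<open>k = c (V - g) / (K + V)\<close> a supermartingale, so the expectation of \<open>exp (\<integral>\<^sub>0\<^sup>T k)\<close> stays bounded
  in \<open>T\<close> and almost surely \<open>limsup 1/T \<integral>\<^sub>0\<^sup>T k \<le> 0\<close>. As \<open>k\<close> is at least
  \<open>c (V1 - g) / (K + V1)\<close> where \<open>V \<ge> V1\<close> and at least \<open>- c g / K\<close> elsewhere, letting \<open>K\<close> grow bounds the
  fraction of time spent in \<open>V \<ge> V1\<close> by \<open>g / V1\<close>, which is smaller than \<open>t_dc / (t_dc + t_uc)\<close>.

  The supermartingale bound is obtained without stopping times or a stochastic calculus: \<open>V\<close> is truncated to a
  \<open>C\<^sup>2\<close> function constant outside a compact set, the equation is discretized with coefficients
  frozen along the solution itself, paths are killed at the first grid point where \<open>V > R\<close>, and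
  Fatou's lemma removes the discretization and the killing together.\<close>

section \<open>Matrix estimates and second-order Taylor bounds\<close>

text \<open>The rate is dictated by the identity
  \<open>rate K z * (K + V z) = c * (V z - g)\<close>, which offsets the bound on the generator
  exactly. The shift \<open>K\<close> keeps the quotient between \<open>- c * g / K\<close> and
  \<open>c\<close>, even where V is close to 0; so the weights up to time T are at most
  \<open>exp (c * T)\<close>, and \<open>K \<le> K + V\<close> lets the last factor be dropped at
  the price of a division by K.

  The obstacle is that \<open>ito_integral\<close> fixes the stochastic integral only through limits
  in probability of elementary integrals. Hence every estimate is made for grid sums of Gaussian
  increments, where Taylor's formula and independence suffice. Truncation supplies the boundedness
  and uniform continuity that such an estimate needs, but the truncated function agrees with
  \<open>K + V\<close> only up to level R, which is why paths are killed there. The resulting bound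
  must depend neither on T nor on R. Since no moment of the initial state is assumed, everything is
  localized on the events \<open>V (x 0) \<le> r\<close>, which are known at time 0.\<close>

lemma norm_matrix_vector_mult_le:
  fixes A :: "real^'m^'n"
  shows "norm (A *v x) \<le> norm A * norm x"
proof -
  have "norm ((A *v x) $ i) \<le> norm (norm x *\<^sub>R A $ i)" for i
    using Cauchy_Schwarz_ineq2[of "A $ i" x]
    by (simp add: matrix_vector_mul_component mult.commute)
  then have "norm (A *v x) \<le> norm (norm x *\<^sub>R A)"
    unfolding norm_vec_def[of "A *v x"] norm_vec_def[of "norm x *\<^sub>R A"]
    by (intro L2_set_mono) auto
  then show ?thesis by (simp add: mult.commute)
qed

lemma inner_matrix_vector_mult_le:
  fixes A :: "real^'m^'n"
  shows "\<bar>v \<bullet> (A *v z)\<bar> \<le> norm A * norm v * norm z"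
proof -
  have "\<bar>v \<bullet> (A *v z)\<bar> \<le> norm v * norm (A *v z)" by (rule Cauchy_Schwarz_ineq2)
  also have "\<dots> \<le> norm v * (norm A * norm z)"
    by (intro mult_left_mono norm_matrix_vector_mult_le) auto
  finally show ?thesis by (simp add: ac_simps)
qed

lemma norm_transpose:
  fixes A :: "real^'m^'n"
  shows "norm (transpose A) = norm A"
proof -
  have "(norm (transpose A))\<^sup>2 = (norm A)\<^sup>2"
    unfolding power2_norm_eq_inner inner_vec_def
    by (subst sum.swap) (simp add: transpose_def)
  then show ?thesis by (simp add: power2_eq_iff_nonneg)
qed

text \<open>The norm of nested vectors is the Frobenius norm. Row \<open>i\<close> of
  \<open>A ** B\<close> is \<open>transpose B\<close> applied to row \<open>i\<close> of
  \<open>A\<close>, so submultiplicativity follows row by row from the matrix-vector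
  estimate.\<close>

lemma norm_matrix_mult_le:
  fixes A :: "real^'m^'n" and B :: "real^'k^'m"
  shows "norm (A ** B) \<le> norm A * norm B"
proof -
  have "norm ((A ** B) $ i) \<le> norm (norm B *\<^sub>R A $ i)" for i
  proof -
    have "(A ** B) $ i = transpose B *v (A $ i)"
      by (simp add: vec_eq_iff matrix_matrix_mult_def matrix_vector_mult_def transpose_def mult.commute)
    then show ?thesis
      using norm_matrix_vector_mult_le[of "transpose B" "A $ i"] by (simp add: norm_transpose)
  qed
  then have "norm (A ** B) \<le> norm (norm B *\<^sub>R A)"
    unfolding norm_vec_def[of "A ** B"] norm_vec_def[of "norm B *\<^sub>R A"]
    by (intro L2_set_mono) auto
  then show ?thesis by (simp add: mult.commute)
qed

lemma abs_matrix_nth_le: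
  fixes A :: "real^'m^'n"
  shows "\<bar>A $ i $ j\<bar> \<le> norm A"
  using component_le_norm_cart[of "A $ i" j] Finite_Cartesian_Product.norm_nth_le[of A i] by linarith

lemma abs_trace_le:
  fixes A :: "real^'m^'m"
  shows "\<bar>trace A\<bar> \<le> real CARD('m) * norm A"
proof -
  have "\<bar>trace A\<bar> \<le> (\<Sum>i\<in>UNIV. \<bar>A $ i $ i\<bar>)" unfolding trace_def by (rule sum_abs)
  also have "\<dots> \<le> (\<Sum>i\<in>(UNIV :: 'm set). norm A)" by (intro sum_mono abs_matrix_nth_le)
  finally show ?thesis by simp
qed

lemma inner_matrix_transpose:
  fixes A :: "real^'m^'n"
  shows "v \<bullet> (A *v z) = (transpose A *v v) \<bullet> z"
  by (simp add: dot_lmul_matrix)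

text \<open>Two matrices \<open>A\<close> and \<open>B\<close> are allowed because comparing two
  diffusion matrices in \<open>drift_le\<close> produces mixed products.\<close>

lemma abs_trace_congruence_le:
  fixes A B :: "real^'m^'n" and H :: "real^'n^'n"
  shows "\<bar>trace (transpose A ** H ** B)\<bar> \<le> real CARD('m) * (norm A * norm H * norm B)"
proof -
  have "norm (transpose A ** H ** B) \<le> norm (transpose A ** H) * norm B" by (rule norm_matrix_mult_le)
  also have "\<dots> \<le> norm (transpose A) * norm H * norm B" by (intro mult_right_mono norm_matrix_mult_le) auto
  finally show ?thesis
    using abs_trace_le[of "transpose A ** H ** B"] unfolding norm_transpose
    by (meson mult_left_mono of_nat_0_le_iff order_trans)
qed

lemma bounded_bilinear_matrix_mult:
  "bounded_bilinear (\<lambda>(A :: real^'m^'n) (B :: real^'k^'m). A ** B)"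
proof
  fix A A' :: "real^'m^'n" and B B' :: "real^'k^'m" and r :: real
  show "(A + A') ** B = A ** B + A' ** B"
    by (vector matrix_matrix_mult_def sum.distrib[symmetric] field_simps)
  show "A ** (B + B') = A ** B + A ** B'" by (rule matrix_add_ldistrib)
  show "(r *\<^sub>R A) ** B = r *\<^sub>R (A ** B)" by (simp add: scalar_matrix_assoc)
  show "A ** (r *\<^sub>R B) = r *\<^sub>R (A ** B)" by (simp add: matrix_scalar_ac scalar_matrix_assoc)
  show "\<exists>K. \<forall>(A :: real^'m^'n) (B :: real^'k^'m). norm (A ** B) \<le> norm A * norm B * K"
    using norm_matrix_mult_le by (intro exI[of _ 1]) auto
qed

lemma taylor_second_order:
  fixes u :: "real^'n \<Rightarrow> real"
  assumes "C2_with u Du Hu"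
  obtains \<theta> where "0 < \<theta>" "\<theta> < 1"
    "u (z + e) = u z + Du z \<bullet> e + 1/2 * (e \<bullet> (Hu (z + \<theta> *\<^sub>R e) *v e))"
proof -
  \<comment> \<open>The derivatives of orders 0, 1 and 2 of \<open>u\<close> along the segment from
    \<open>z\<close> to \<open>z + e\<close>, in the indexed form that \<open>Maclaurin\<close> asks
    for; its intermediate point becomes \<theta>.\<close>
  define d where "d m t = (if m = 0 then u (z + t *\<^sub>R e) else if m = 1 then Du (z + t *\<^sub>R e) \<bullet> e
     else e \<bullet> (Hu (z + t *\<^sub>R e) *v e))" for m :: nat and t :: real
  have u: "(u has_derivative (\<lambda>v. Du y \<bullet> v)) (at y)"
    and Du: "(Du has_derivative (\<lambda>v. Hu y *v v)) (at y)" for y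
    using assms by (auto simp: C2_with_def)
  have line: "((\<lambda>t. z + t *\<^sub>R e) has_derivative (\<lambda>s. s *\<^sub>R e)) (at t)" for t
    by (auto intro!: derivative_eq_intros)
  have d0: "DERIV (d 0) t :> d 1 t" for t
    unfolding d_def[abs_def]
    by (rule has_derivative_imp_has_field_derivative, simp, rule has_derivative_compose[OF line u]) simp
  have d1: "DERIV (d 1) t :> d 2 t" for t
    unfolding d_def[abs_def]
    by (rule has_derivative_imp_has_field_derivative, simp,
        rule has_derivative_inner_left[OF has_derivative_compose[OF line Du]])
       (simp add: matrix_vector_mult_scaleR inner_commute)
  have "\<exists>t. 0 < t \<and> t < 1 \<and> d 0 1 = (\<Sum>m<2. d m 0 / fact m * 1 ^ m) + d 2 t / fact 2 * 1 ^ 2"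
  proof (rule Maclaurin[where diff=d])
    show "\<forall>m t. m < 2 \<and> 0 \<le> t \<and> t \<le> 1 \<longrightarrow> DERIV (d m) t :> d (Suc m) t"
      using d0 d1 by (metis One_nat_def Suc_1 less_2_cases)
  qed auto
  moreover have "(\<Sum>m<2. d m 0 / fact m * 1 ^ m) = d 0 0 + d 1 0" by (simp add: lessThan_Suc numeral_2_eq_2)
  ultimately obtain t where "0 < t" "t < 1" "d 0 1 = d 0 0 + d 1 0 + d 2 t / 2" by auto
  then show thesis
    using that[of t] by (simp add: d_def)
qed

text \<open>Below the threshold of uniform continuity the error is at most \<eta>; above it, a
  bounded function changes by at most \<open>2 * B\<close>, which the quadratic term absorbs. The
  square turns the Taylor error into a fourth power of the step, and the cap at 1 makes convergence
  in probability enough for convergence of expectations.\<close>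

lemma uniform_modulus:
  fixes \<phi> :: "'a::metric_space \<Rightarrow> 'b::real_normed_vector"
  assumes "uniformly_continuous_on UNIV \<phi>" and bd: "\<And>x. norm (\<phi> x) \<le> B" and "0 < \<eta>"
  shows "\<exists>D\<ge>0. \<forall>x y. norm (\<phi> x - \<phi> y) \<le> \<eta> + D * (min 1 (dist x y))\<^sup>2"
proof -
  obtain \<delta> where \<delta>: "\<delta> > 0" "\<And>x y. dist x y < \<delta> \<Longrightarrow> dist (\<phi> x) (\<phi> y) < \<eta>"
    using assms(1,3) unfolding uniformly_continuous_on_def by (metis UNIV_I dist_commute)
  define r where "r = min 1 \<delta>"
  have r: "0 < r" "r \<le> 1" "r \<le> \<delta>" using \<delta> by (auto simp: r_def)
  have B: "0 \<le> B" using bd[of undefined] norm_ge_zero order_trans by blast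
  have "norm (\<phi> x - \<phi> y) \<le> \<eta> + (2 * B / r\<^sup>2) * (min 1 (dist x y))\<^sup>2" for x y
  proof (cases "dist x y < \<delta>")
    case True
    then show ?thesis using \<delta>(2)[of x y] B by (simp add: dist_norm add_increasing2 less_imp_le)
  next
    case False
    then have "r\<^sup>2 \<le> (min 1 (dist x y))\<^sup>2" using r by (intro power_mono) auto
    then have "2 * B / r\<^sup>2 * r\<^sup>2 \<le> 2 * B / r\<^sup>2 * (min 1 (dist x y))\<^sup>2"
      using B by (intro mult_left_mono) auto
    moreover have "norm (\<phi> x - \<phi> y) \<le> B + B"
      using norm_triangle_ineq4[of "\<phi> x" "\<phi> y"] bd[of x] bd[of y] by linarith
    ultimately show ?thesis using r assms(3) by simp
  qed
  then show ?thesis using B by (intro exI[of _ "2 * B / r\<^sup>2"]) auto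
qed

lemma uniformly_continuous_const_outside:
  fixes \<phi> :: "'a::euclidean_space \<Rightarrow> 'b::real_normed_vector"
  assumes cont: "continuous_on UNIV \<phi>" and out: "\<And>x. norm x > r \<Longrightarrow> \<phi> x = k"
  shows "uniformly_continuous_on UNIV \<phi>" "\<exists>B\<ge>0. \<forall>x. norm (\<phi> x) \<le> B"
proof -
  have "compact (\<phi> ` cball 0 r)"
    by (intro compact_continuous_image continuous_on_subset[OF cont]) auto
  then have "bounded (\<phi> ` cball 0 r)" by (rule compact_imp_bounded)
  then obtain B where B: "\<And>x. norm x \<le> r \<Longrightarrow> norm (\<phi> x) \<le> B"
    by (metis bounded_iff image_eqI mem_cball_0)
  have "norm (\<phi> x) \<le> max (max B 0) (norm k)" for x
    using B[of x] out[of x] by (cases "norm x \<le> r") auto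
  then show "\<exists>B\<ge>0. \<forall>x. norm (\<phi> x) \<le> B"
    by (intro exI[of _ "max (max B 0) (norm k)"]) auto
  \<comment> \<open>The margin of 1 serves the case distinction below: if two points are at distance
    less than 1 and one lies in the ball of radius \<open>r\<close>, both lie in the larger ball;
    otherwise both values are \<open>k\<close>.\<close>
  have uc: "uniformly_continuous_on (cball 0 (r + 1)) \<phi>"
    by (intro compact_uniformly_continuous continuous_on_subset[OF cont]) auto
  show "uniformly_continuous_on UNIV \<phi>"
    unfolding uniformly_continuous_on_def
  proof (intro allI impI ballI)
    fix e :: real assume e: "e > 0"
    obtain d where d: "d > 0" "\<And>x y. norm x \<le> r + 1 \<Longrightarrow> norm y \<le> r + 1 \<Longrightarrow> dist x y < d \<Longrightarrow> dist (\<phi> x) (\<phi> y) < e"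
      using uc e unfolding uniformly_continuous_on_def by (metis mem_cball_0)
    have "dist (\<phi> x) (\<phi> y) < e" if "dist x y < min d 1" for x y
    proof (cases "norm x \<le> r \<or> norm y \<le> r")
      case True
      then have "norm x \<le> r + 1" "norm y \<le> r + 1"
        using that norm_triangle_sub[of x y] norm_triangle_sub[of y x]
        by (auto simp: dist_norm norm_minus_commute)
      then show ?thesis using d(2)[of x y] that by auto
    next
      case False then show ?thesis using out e by simp
    qed
    then show "\<exists>d>0. \<forall>x\<in>UNIV. \<forall>x'\<in>UNIV. dist x' x < d \<longrightarrow> dist (\<phi> x') (\<phi> x) < e"
      using d(1) by (intro exI[of _ "min d 1"]) auto
  qed
qed

lemma C2_with_continuous:
  assumes "C2_with u Du Hu"
  shows "continuous_on UNIV u" "continuous_on UNIV Du" "continuous_on UNIV Hu"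
  using assms unfolding C2_with_def
  by (auto intro: has_derivative_continuous_on has_derivative_at_withinI)

text \<open>With only a uniformly continuous Hessian there is no third-order remainder. The error is
  split so that a Gaussian step of variance \<open>d\<close> costs \<eta> times order
  \<open>d\<close> plus a fourth moment of order \<open>d^2\<close>; summed over order
  \<open>1 / d\<close> steps, the second part vanishes with the mesh and the first is made small by
  the choice of \<eta>.\<close>

lemma taylor_upper_bound:
  fixes u :: "real^'n \<Rightarrow> real"
  assumes C2: "C2_with u Du Hu" and "uniformly_continuous_on UNIV Hu" and "\<And>x. norm (Hu x) \<le> B"
    and "0 < \<eta>"
  shows "\<exists>D\<ge>0. \<forall>z e. u (z + e) \<le> u z + Du z \<bullet> e + 1/2 * (e \<bullet> (Hu z *v e)) + \<eta> * (norm e)\<^sup>2 + D * (norm e)^4"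
proof -
  obtain D where D: "D \<ge> 0" "\<And>x y. norm (Hu x - Hu y) \<le> \<eta> + D * (min 1 (dist x y))\<^sup>2"
    using uniform_modulus[OF assms(2-4)] by blast
  have "u (z + e) \<le> u z + Du z \<bullet> e + 1/2 * (e \<bullet> (Hu z *v e)) + \<eta> * (norm e)\<^sup>2 + D * (norm e)^4" for z e
  proof -
    obtain \<theta> where \<theta>: "0 < \<theta>" "\<theta> < 1"
      "u (z + e) = u z + Du z \<bullet> e + 1/2 * (e \<bullet> (Hu (z + \<theta> *\<^sub>R e) *v e))"
      using taylor_second_order[OF C2] .
    have "e \<bullet> (Hu (z + \<theta> *\<^sub>R e) *v e) - e \<bullet> (Hu z *v e) = e \<bullet> ((Hu (z + \<theta> *\<^sub>R e) - Hu z) *v e)"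
      by (simp add: matrix_vector_mult_diff_rdistrib inner_diff_right)
    also have "\<dots> \<le> norm (Hu (z + \<theta> *\<^sub>R e) - Hu z) * norm e * norm e"
      using inner_matrix_vector_mult_le[of e "Hu (z + \<theta> *\<^sub>R e) - Hu z" e] by linarith
    also have "\<dots> \<le> (\<eta> + D * (norm e)\<^sup>2) * norm e * norm e"
    proof (intro mult_right_mono)
      have "min 1 (dist (z + \<theta> *\<^sub>R e) z) \<le> norm e"
        using \<theta> by (auto simp: dist_norm min_le_iff_disj mult_left_le_one_le)
      then have "(min 1 (dist (z + \<theta> *\<^sub>R e) z))\<^sup>2 \<le> (norm e)\<^sup>2"
        by (intro power_mono) auto
      then show "norm (Hu (z + \<theta> *\<^sub>R e) - Hu z) \<le> \<eta> + D * (norm e)\<^sup>2"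
        using D(1) by (intro order_trans[OF D(2)] add_left_mono mult_left_mono)
    qed auto
    also have "\<dots> = \<eta> * (norm e)\<^sup>2 + D * (norm e)^4"
      by (simp add: algebra_simps power2_eq_square power4_eq_xxxx)
    finally have "e \<bullet> (Hu (z + \<theta> *\<^sub>R e) *v e) \<le> e \<bullet> (Hu z *v e) + (\<eta> * (norm e)\<^sup>2 + D * (norm e)^4)"
      by simp
    moreover have "0 \<le> \<eta> * (norm e)\<^sup>2 + D * (norm e)^4" using D(1) assms(4) by simp
    ultimately show ?thesis using \<theta>(3) by linarith
  qed
  then show ?thesis using D(1) by blast
qed

section \<open>Smooth truncation of the Lyapunov function\<close>

lemma DERIV_max_0_power:
  assumes "0 < n"
  shows "DERIV (\<lambda>x :: real. max 0 x ^ Suc n) x :> real (Suc n) * max 0 x ^ n"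
proof -
  consider "x < 0" | "x = 0" | "x > 0" by linarith
  then show ?thesis
  proof cases
    case 1
    have "DERIV (\<lambda>x :: real. 0) x :> 0" by simp
    then have "DERIV (\<lambda>x :: real. max 0 x ^ Suc n) x :> 0"
      by (rule has_field_derivative_transform_within_open[where S="{..<0}"]) (use 1 in auto)
    then show ?thesis using 1 assms by (simp del: power_Suc add: zero_power)
  next
    case 2
    \<comment> \<open>At the kink neither formula holds on a whole neighbourhood. The difference
      quotient is bounded by \<open>\<bar>h\<bar> ^ n\<close>, which tends to 0 because
      \<open>0 < n\<close>.\<close>
    have "((\<lambda>h :: real. (max 0 (0 + h) ^ Suc n - max 0 0 ^ Suc n) / h) \<longlongrightarrow> 0) (at 0)"
    proof (rule Lim_null_comparison)
      show "eventually (\<lambda>h :: real. norm ((max 0 (0 + h) ^ Suc n - max 0 0 ^ Suc n) / h) \<le> \<bar>h\<bar> ^ n) (at 0)"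
        by (intro always_eventually allI) (auto simp: max_def abs_mult)
      have "((\<lambda>h :: real. \<bar>h\<bar> ^ n) \<longlongrightarrow> \<bar>0\<bar> ^ n) (at 0)" by (intro tendsto_intros)
      then show "((\<lambda>h :: real. \<bar>h\<bar> ^ n) \<longlongrightarrow> 0) (at 0)" by (simp only: abs_zero zero_power[OF assms])
    qed
    then show ?thesis using 2 assms by (simp add: DERIV_def zero_power del: power_Suc)
  next
    case 3
    have "DERIV (\<lambda>x :: real. x ^ Suc n) x :> real (Suc n) * x ^ n"
      using DERIV_pow[of "Suc n" x] by simp
    then have "DERIV (\<lambda>x :: real. max 0 x ^ Suc n) x :> real (Suc n) * x ^ n"
      by (rule has_field_derivative_transform_within_open[where S="{0<..}"]) (use 3 in auto)
    then show ?thesis using 3 by simp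
  qed
qed

text \<open>The second derivative of the cutoff is minus a tent of unit area on \<open>[R, R + 2]\<close>, so its
  derivative drops from \<open>1\<close> to \<open>0\<close> there.\<close>

lemma C2_cutoff_real:
  assumes "0 \<le> R"
  obtains \<Phi> \<Phi>1 \<Phi>2 :: "real \<Rightarrow> real"
  where "\<And>v. DERIV \<Phi> v :> \<Phi>1 v" "\<And>v. DERIV \<Phi>1 v :> \<Phi>2 v" "continuous_on UNIV \<Phi>2"
    "\<And>v. v \<le> R \<Longrightarrow> \<Phi> v = v \<and> \<Phi>1 v = 1 \<and> \<Phi>2 v = 0"
    "\<And>v. v \<ge> R + 2 \<Longrightarrow> \<Phi> v = R + 1 \<and> \<Phi>1 v = 0 \<and> \<Phi>2 v = 0"
    "\<And>v. v \<ge> 0 \<Longrightarrow> \<Phi> v \<ge> 0"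
proof
  \<comment> \<open>The tent is the second difference (coefficients 1, -2, 1) of
    \<open>max 0\<close> at the knots \<open>R\<close>, \<open>R + 1\<close>, \<open>R + 2\<close>;
    integrating twice turns it into the second difference of truncated cubes, divided by 6.\<close>
  let ?\<Phi> = "\<lambda>v. v - (max 0 (v - R) ^ 3 - 2 * max 0 (v - R - 1) ^ 3 + max 0 (v - R - 2) ^ 3) / 6"
  let ?\<Phi>1 = "\<lambda>v. 1 - (max 0 (v - R) ^ 2 - 2 * max 0 (v - R - 1) ^ 2 + max 0 (v - R - 2) ^ 2) / 2"
  let ?\<Phi>2 = "\<lambda>v. - (max 0 (v - R) - 2 * max 0 (v - R - 1) + max 0 (v - R - 2))"
  have d3: "((\<lambda>v. max 0 (v - a) ^ 3) has_real_derivative 3 * max 0 (v - a) ^ 2) (at v)" for a v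
    using DERIV_max_0_power[of 2 "v + - a"] unfolding DERIV_shift by (simp add: eval_nat_numeral)
  have d2: "((\<lambda>v. max 0 (v - a) ^ 2) has_real_derivative 2 * max 0 (v - a)) (at v)" for a v
    using DERIV_max_0_power[of 1 "v + - a"] unfolding DERIV_shift by (simp add: eval_nat_numeral)
  show "DERIV ?\<Phi> v :> ?\<Phi>1 v" for v
    unfolding diff_diff_eq
    by (rule DERIV_cong, (rule DERIV_diff DERIV_add DERIV_ident DERIV_cdivide DERIV_cmult d3)+) simp
  show "DERIV ?\<Phi>1 v :> ?\<Phi>2 v" for v
    unfolding diff_diff_eq
    by (rule DERIV_cong, (rule DERIV_diff DERIV_add DERIV_const DERIV_cdivide DERIV_cmult d2)+)
       (simp add: diff_divide_distrib add_divide_distrib)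
  show "continuous_on UNIV ?\<Phi>2" by (intro continuous_intros)
  show "v \<le> R \<Longrightarrow> ?\<Phi> v = v \<and> ?\<Phi>1 v = 1 \<and> ?\<Phi>2 v = 0" for v by simp
  show above: "?\<Phi> v = R + 1 \<and> ?\<Phi>1 v = 0 \<and> ?\<Phi>2 v = 0" if "v \<ge> R + 2" for v
  proof -
    define s where "s = v - R"
    have v: "v = R + s" and s: "max 0 s = s" "max 0 (s - 1) = s - 1" "max 0 (s - 2) = s - 2"
      using that by (auto simp: s_def)
    \<comment> \<open>Past the last knot nothing is truncated and the second difference of the cube
      is affine: \<open>s - (6 * s - 6) / 6 = 1\<close> leaves the constant
      \<open>R + 1\<close>.\<close>
    have "s ^ 3 - 2 * (s - 1) ^ 3 + (s - 2) ^ 3 = 6 * s - 6" "s\<^sup>2 - 2 * (s - 1)\<^sup>2 + (s - 2)\<^sup>2 = 2"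
      by (simp_all add: power2_eq_square power3_eq_cube algebra_simps)
    then show ?thesis unfolding v by (simp add: s diff_divide_distrib)
  qed
  show "?\<Phi> v \<ge> 0" if "v \<ge> 0" for v
  proof -
    consider "v \<le> R" | "R \<le> v" "v \<le> R + 2" | "v \<ge> R + 2" by linarith
    then show ?thesis
    proof cases
      case 2
      \<comment> \<open>With \<open>s = v - R\<close> in \<open>[0, 2]\<close>,
        \<open>s ^ 3 \<le> 4 * s \<le> 6 * s\<close>, so at most \<open>s\<close> is subtracted from
        \<open>v\<close> and at least \<open>R\<close> remains.\<close>
      have "(v - R) * (v - R)\<^sup>2 \<le> (v - R) * 2\<^sup>2" using 2 by (intro mult_left_mono power_mono) auto
      then have "(v - R) ^ 3 \<le> 4 * (v - R)" by (simp add: power2_eq_square power3_eq_cube)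
      moreover have "max 0 (v - R - 1) ^ 3 \<ge> 0" by simp
      ultimately have "(v - R) ^ 3 - 2 * max 0 (v - R - 1) ^ 3 \<le> 6 * (v - R)"
        using 2(1) by argo
      moreover have "max 0 (v - R) = v - R" "max 0 (v - R - 2) = 0" using 2 by auto
      ultimately show ?thesis using assms by simp
    next
      case 3
      then show ?thesis using assms above[of v] by linarith
    qed (use that in auto)
  qed
qed

text \<open>Coercivity makes the composition of the cutoff with \<open>V\<close> constant off a
  ball; hence it and its first two derivatives are bounded and uniformly continuous. The lower bound
  \<open>K\<close> later strips the factor \<open>u\<close> from an expectation.\<close>

lemma C2_with_truncate:
  fixes V :: "real^'n \<Rightarrow> real"
  assumes C2: "C2_with V DV HV" and V0: "\<And>z. 0 \<le> V z" and coercive: "\<And>r. bounded {z. V z \<le> r}"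
    and "0 \<le> R"
  obtains u Du Hu B where "C2_with u Du Hu" "\<And>z. K \<le> u z"
    "\<And>z. V z \<le> R \<Longrightarrow> u z = K + V z \<and> Du z = DV z \<and> Hu z = HV z"
    "uniformly_continuous_on UNIV u" "uniformly_continuous_on UNIV Du" "uniformly_continuous_on UNIV Hu"
    "\<And>z. \<bar>u z\<bar> \<le> B" "\<And>z. norm (Du z) \<le> B" "\<And>z. norm (Hu z) \<le> B"
proof -
  obtain \<Phi> \<Phi>1 \<Phi>2 :: "real \<Rightarrow> real" where
    d1: "\<And>v. DERIV \<Phi> v :> \<Phi>1 v" and d2: "\<And>v. DERIV \<Phi>1 v :> \<Phi>2 v" and c2: "continuous_on UNIV \<Phi>2"
    and low: "\<And>v. v \<le> R \<Longrightarrow> \<Phi> v = v \<and> \<Phi>1 v = 1 \<and> \<Phi>2 v = 0"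
    and high: "\<And>v. v \<ge> R + 2 \<Longrightarrow> \<Phi> v = R + 1 \<and> \<Phi>1 v = 0 \<and> \<Phi>2 v = 0"
    and nn: "\<And>v. v \<ge> 0 \<Longrightarrow> \<Phi> v \<ge> 0"
    using C2_cutoff_real[OF \<open>0 \<le> R\<close>] by blast
  define u where "u z = K + \<Phi> (V z)" for z
  define Du where "Du z = \<Phi>1 (V z) *\<^sub>R DV z" for z
  \<comment> \<open>Differentiating the scalar factor of the gradient contributes the outer product
    of \<open>DV z\<close> with itself.\<close>
  define Hu where "Hu z = \<Phi>1 (V z) *\<^sub>R HV z + \<Phi>2 (V z) *\<^sub>R (\<chi> i j. DV z $ i * DV z $ j)" for z
  have dV: "(V has_derivative (\<lambda>v. DV z \<bullet> v)) (at z)" and dDV: "(DV has_derivative (\<lambda>v. HV z *v v)) (at z)"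
    and cHV: "continuous_on UNIV HV" for z
    using C2 by (auto simp: C2_with_def)
  note cV = C2_with_continuous(1)[OF C2] and cDV = C2_with_continuous(2)[OF C2]
  have rank1: "(\<chi> i j. a $ i * a $ j) *v v = (a \<bullet> v) *\<^sub>R a" for a v :: "real^'n"
    by (simp add: vec_eq_iff matrix_vector_mult_def inner_vec_def sum_distrib_left ac_simps)
  have du: "(u has_derivative (\<lambda>v. Du z \<bullet> v)) (at z)" for z
    unfolding u_def[abs_def] Du_def
    using has_derivative_compose[OF dV d1[of "V z", unfolded has_field_derivative_def]]
    by (auto intro!: derivative_eq_intros)
  have "((\<lambda>z. \<Phi>1 (V z)) has_derivative (\<lambda>v. \<Phi>2 (V z) * (DV z \<bullet> v))) (at z)" for z
    using has_derivative_compose[OF dV d2[of "V z", unfolded has_field_derivative_def]] by simp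
  then have dDu: "(Du has_derivative (\<lambda>v. Hu z *v v)) (at z)" for z
    unfolding Du_def[abs_def] Hu_def
    by (rule has_derivative_eq_rhs[OF has_derivative_scaleR[OF _ dDV]])
       (simp add: fun_eq_iff matrix_vector_mult_add_rdistrib rank1 scaleR_matrix_vector_assoc[symmetric])
  have c1: "continuous_on UNIV \<Phi>1" by (meson DERIV_continuous_on d2 has_field_derivative_at_within)
  have cHu: "continuous_on UNIV Hu"
    unfolding Hu_def[abs_def]
    by (intro continuous_intros cHV cV continuous_on_compose2[OF c1 cV] continuous_on_compose2[OF c2 cV]
        continuous_on_vec_lambda continuous_on_compose2[OF continuous_on_component cDV])
       auto
  have C2u: "C2_with u Du Hu" using du dDu cHu by (simp add: C2_with_def)
  obtain r where r: "\<And>z. V z \<le> R + 2 \<Longrightarrow> norm z \<le> r"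
    using coercive[of "R + 2"] by (auto simp: bounded_iff)
  have out: "u z = K + R + 1" "Du z = 0" "Hu z = 0" if "norm z > r" for z
  proof -
    have "V z \<ge> R + 2" using r[of z] that by linarith
    then show "u z = K + R + 1" "Du z = 0" "Hu z = 0" using high[of "V z"] by (auto simp: u_def Du_def Hu_def)
  qed
  note cu = C2_with_continuous[OF C2u]
  obtain B1 where B1: "\<And>z. norm (u z) \<le> B1"
    using uniformly_continuous_const_outside(2)[OF cu(1) out(1)] by auto
  obtain B2 where B2: "\<And>z. norm (Du z) \<le> B2"
    using uniformly_continuous_const_outside(2)[OF cu(2) out(2)] by auto
  obtain B3 where B3: "\<And>z. norm (Hu z) \<le> B3"
    using uniformly_continuous_const_outside(2)[OF cu(3) out(3)] by auto
  show thesis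
  proof (rule that[OF C2u])
    show "K \<le> u z" for z using nn[OF V0, of z] by (simp add: u_def)
    show "V z \<le> R \<Longrightarrow> u z = K + V z \<and> Du z = DV z \<and> Hu z = HV z" for z
      using low[of "V z"] by (simp add: u_def Du_def Hu_def)
    show "uniformly_continuous_on UNIV u"
      by (rule uniformly_continuous_const_outside(1)[OF cu(1) out(1)])
    show "uniformly_continuous_on UNIV Du"
      by (rule uniformly_continuous_const_outside(1)[OF cu(2) out(2)])
    show "uniformly_continuous_on UNIV Hu"
      by (rule uniformly_continuous_const_outside(1)[OF cu(3) out(3)])
    show "\<bar>u z\<bar> \<le> max B1 (max B2 B3)" "norm (Du z) \<le> max B1 (max B2 B3)" "norm (Hu z) \<le> max B1 (max B2 B3)" for z
      using B1[of z] B2[of z] B3[of z] by auto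
  qed
qed

section \<open>Gaussian increments\<close>

text \<open>\<open>lborel\<close> on \<open>real^'m\<close> is the image of a product measure
  indexed by \<open>Basis\<close>, while the factors are indexed by \<open>'m\<close>. The map
  \<open>idx\<close> inverts \<open>\<lambda>i. axis i 1\<close> and carries one indexing to the
  other; the rest is Fubini for products.\<close>

lemma has_bochner_integral_lborel_prod_vec:
  fixes q :: "'m::finite \<Rightarrow> real \<Rightarrow> real"
  assumes q: "\<And>i. integrable lborel (q i)"
  shows "has_bochner_integral lborel (\<lambda>y :: real^'m. \<Prod>i\<in>UNIV. q i (y $ i)) (\<Prod>i\<in>UNIV. \<integral>x. q i x \<partial>lborel)"
proof -
  interpret product_sigma_finite "\<lambda>b :: real^'m. lborel :: real measure" ..
  let ?P = "\<Pi>\<^sub>M b\<in>(Basis :: (real^'m) set). (lborel :: real measure)"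
  define T where "T f = (\<Sum>b\<in>Basis. f b *\<^sub>R b)" for f :: "real^'m \<Rightarrow> real"
  define idx where "idx b = (THE i. b = axis i (1::real))" for b :: "real^'m"
  have idx: "idx (axis i 1) = i" for i
    unfolding idx_def by (rule the_equality) (auto simp: axis_eq_axis)
  have Basis: "(Basis :: (real^'m) set) = range (\<lambda>i. axis i 1)"
    by (auto simp: Basis_vec_def)
  have inj: "inj (\<lambda>i :: 'm. axis i (1::real))" by (auto simp: inj_on_def axis_eq_axis)
  have re: "(\<Prod>b\<in>Basis. p (idx b) b) = (\<Prod>i\<in>UNIV. p i (axis i 1 :: real^'m))" for p :: "'m \<Rightarrow> real^'m \<Rightarrow> real"
    unfolding Basis by (subst prod.reindex[OF inj]) (simp add: idx)
  have T: "T f $ i = f (axis i 1)" for f i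
  proof -
    have "T f $ i = T f \<bullet> axis i 1" by (simp add: inner_axis)
    also have "\<dots> = f (axis i 1)"
      unfolding T_def by (rule inner_sum_left_Basis) (simp add: Basis)
    finally show ?thesis .
  qed
  have [measurable]: "T \<in> measurable ?P borel"
    unfolding T_def[abs_def] by measurable
  have [measurable]: "q i \<in> borel_measurable borel" for i using q[of i] by (simp add: borel_measurable_integrable)
  have m: "(\<lambda>y :: real^'m. \<Prod>i\<in>UNIV. q i (y $ i)) \<in> borel_measurable borel" by measurable
  have eq: "(\<Prod>i\<in>UNIV. q i (T f $ i)) = (\<Prod>b\<in>Basis. q (idx b) (f b))" for f
    unfolding T using re[of "\<lambda>i b. q i (f b)"] by simp
  have "integrable ?P (\<lambda>f. \<Prod>b\<in>Basis. q (idx b) (f b))"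
    by (intro product_integrable_prod q) auto
  moreover have "(\<integral>f. (\<Prod>b\<in>Basis. q (idx b) (f b)) \<partial>?P) = (\<Prod>b\<in>Basis. \<integral>x. q (idx b) x \<partial>lborel)"
    by (intro product_integral_prod q) auto
  ultimately have "has_bochner_integral ?P (\<lambda>f. \<Prod>b\<in>Basis. q (idx b) (f b)) (\<Prod>i\<in>UNIV. \<integral>x. q i x \<partial>lborel)"
    using re[of "\<lambda>i b. \<integral>x. q i x \<partial>lborel"] by (simp add: has_bochner_integral_iff)
  then show ?thesis
    unfolding lborel_eq[where 'a="real^'m"] T_def[abs_def, symmetric]
    by (intro has_bochner_integral_distr m \<open>T \<in> measurable ?P borel\<close>) (simp only: eq)
qed

context prob_space begin

lemma gaussian_vector_product_moment:
  fixes Z :: "'a \<Rightarrow> real^'m"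
  assumes Z: "distributed M lborel Z (\<lambda>y. ennreal (\<Prod>i\<in>UNIV. normal_density 0 \<sigma> (y $ i)))"
    and p: "\<And>i. integrable lborel (\<lambda>x. normal_density 0 \<sigma> x * p i x)"
    and [measurable]: "\<And>i. p i \<in> borel_measurable borel"
  shows "has_bochner_integral M (\<lambda>\<omega>. \<Prod>i\<in>UNIV. p i (Z \<omega> $ i)) (\<Prod>i\<in>UNIV. \<integral>x. normal_density 0 \<sigma> x * p i x \<partial>lborel)"
proof -
  have "has_bochner_integral lborel (\<lambda>y :: real^'m. (\<Prod>i\<in>UNIV. normal_density 0 \<sigma> (y $ i)) * (\<Prod>i\<in>UNIV. p i (y $ i)))
     (\<Prod>i\<in>UNIV. \<integral>x. normal_density 0 \<sigma> x * p i x \<partial>lborel)"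
    unfolding prod.distrib[symmetric] by (rule has_bochner_integral_lborel_prod_vec[OF p])
  moreover have m: "(\<lambda>y :: real^'m. \<Prod>i\<in>UNIV. p i (y $ i)) \<in> borel_measurable lborel" by measurable
  ultimately show ?thesis
    using distributed_integrable[OF Z m] distributed_integral[OF Z m]
    by (simp add: has_bochner_integral_iff prod_nonneg)
qed

text \<open>Coordinates that do not occur in the monomial receive the factor 1, whose normal
  integral is 1, so each moment reduces to one-dimensional ones.\<close>

lemma gaussian_vector_moments:
  fixes Z :: "'a \<Rightarrow> real^'m"
  assumes Z: "distributed M lborel Z (\<lambda>y. ennreal (\<Prod>i\<in>UNIV. normal_density 0 \<sigma> (y $ i)))"
    and [arith]: "0 < \<sigma>"
  shows "has_bochner_integral M (\<lambda>\<omega>. Z \<omega> $ i) 0"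
    and "has_bochner_integral M (\<lambda>\<omega>. Z \<omega> $ i * Z \<omega> $ j) (if i = j then \<sigma>\<^sup>2 else 0)"
    and "has_bochner_integral M (\<lambda>\<omega>. (Z \<omega> $ i) ^ 4) (3 * \<sigma> ^ 4)"
proof -
  note n1 = normal_moment_nz_1[of \<sigma> 0] and n2 = normal_moment_even[of \<sigma> 0 1] and n4 = normal_moment_even[of \<sigma> 0 2]
  have 0: "has_bochner_integral lborel (normal_density 0 \<sigma>) 1" by (simp add: has_bochner_integral_iff)
  have 1: "has_bochner_integral lborel (\<lambda>x. normal_density 0 \<sigma> x * x) 0" using n1 by simp
  have 2: "has_bochner_integral lborel (\<lambda>x. normal_density 0 \<sigma> x * (x * x)) (\<sigma>\<^sup>2)"
    using n2 by (simp add: power2_eq_square)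
  have 4: "has_bochner_integral lborel (\<lambda>x. normal_density 0 \<sigma> x * x ^ 4) (3 * \<sigma> ^ 4)"
    using n4 by (simp add: fact_numeral field_simps power2_eq_square power4_eq_xxxx)
  have sel: "(\<Prod>k\<in>UNIV. if k = i then f k else 1) = f i" for f :: "'m \<Rightarrow> real" and i by (simp add: prod.delta)
  note g = gaussian_vector_product_moment[OF Z]
  have single: "has_bochner_integral M (\<lambda>\<omega>. p (Z \<omega> $ i)) e"
    if p: "has_bochner_integral lborel (\<lambda>x. normal_density 0 \<sigma> x * p x) e" and [measurable]: "p \<in> borel_measurable borel"
    for p e
  proof -
    let ?p = "\<lambda>k x. if k = i then p x else 1"
    have int: "integrable lborel (\<lambda>x. normal_density 0 \<sigma> x * ?p k x)" for k
      using 0 p by (cases "k = i") (auto simp: has_bochner_integral_iff)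
    have "has_bochner_integral M (\<lambda>\<omega>. \<Prod>k\<in>UNIV. ?p k (Z \<omega> $ k)) (\<Prod>k\<in>UNIV. \<integral>x. normal_density 0 \<sigma> x * ?p k x \<partial>lborel)"
      by (intro g int) auto
    moreover have "(\<Prod>k\<in>UNIV. \<integral>x. normal_density 0 \<sigma> x * ?p k x \<partial>lborel) = (\<Prod>k\<in>UNIV. if k = i then e else 1)"
      using 0 p by (intro prod.cong) (auto simp: has_bochner_integral_iff)
    ultimately show ?thesis by (simp add: sel)
  qed
  show "has_bochner_integral M (\<lambda>\<omega>. Z \<omega> $ i) 0" using single[OF 1] by simp
  show "has_bochner_integral M (\<lambda>\<omega>. (Z \<omega> $ i) ^ 4) (3 * \<sigma> ^ 4)" using single[OF 4] by simp
  have sq: "has_bochner_integral M (\<lambda>\<omega>. Z \<omega> $ i * Z \<omega> $ i) (\<sigma>\<^sup>2)" using single[OF 2] by simp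
  show "has_bochner_integral M (\<lambda>\<omega>. Z \<omega> $ i * Z \<omega> $ j) (if i = j then \<sigma>\<^sup>2 else 0)"
  proof (cases "i = j")
    case True
    then show ?thesis using sq by simp
  next
    case False
    \<comment> \<open>For distinct coordinates the product contains the first moment of a centred
      normal law, which is 0.\<close>
    let ?p = "\<lambda>k x. if k = i then x else if k = j then x else (1 :: real)"
    have int: "integrable lborel (\<lambda>x. normal_density 0 \<sigma> x * ?p k x)" for k
      using 0 1 by (cases "k = i"; cases "k = j") (auto simp: has_bochner_integral_iff)
    have "has_bochner_integral M (\<lambda>\<omega>. \<Prod>k\<in>UNIV. ?p k (Z \<omega> $ k)) (\<Prod>k\<in>UNIV. \<integral>x. normal_density 0 \<sigma> x * ?p k x \<partial>lborel)"
      by (intro g int) auto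
    moreover have "(\<Prod>k\<in>UNIV. ?p k (z $ k)) = z $ i * z $ j" for z :: "real^'m"
    proof -
      have "(\<Prod>k\<in>UNIV. ?p k (z $ k)) = (\<Prod>k\<in>UNIV. (if k = i then z $ k else 1) * (if k = j then z $ k else 1))"
        using False by (intro prod.cong) auto
      then show ?thesis by (simp add: prod.distrib sel)
    qed
    moreover have "(\<Prod>k\<in>UNIV. \<integral>x. normal_density 0 \<sigma> x * ?p k x \<partial>lborel) = 0"
      using 1 by (intro prod_zero bexI[of _ i]) (auto simp: has_bochner_integral_iff)
    ultimately show ?thesis using False by simp
  qed
qed

text \<open>The Wiener property gives the product rule only for events of \<open>G\<close> against
  preimages under \<open>Z\<close>. Recasting it as \<open>indep_var\<close> of \<open>Y\<close> and
  \<open>\<lambda>\<omega>. q (Z \<omega>)\<close> makes the expectation factorize.\<close>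

lemma indep_mult_integral:
  fixes Y :: "'a \<Rightarrow> real" and Z :: "'a \<Rightarrow> 'b::topological_space"
  assumes G: "subalgebra M G" and Z[measurable]: "Z \<in> borel_measurable M"
    and ind: "\<And>A B. A \<in> sets G \<Longrightarrow> B \<in> sets borel \<Longrightarrow>
        prob (A \<inter> {\<omega>\<in>space M. Z \<omega> \<in> B}) = prob A * prob {\<omega>\<in>space M. Z \<omega> \<in> B}"
    and Y: "Y \<in> borel_measurable G" "\<And>\<omega>. \<omega> \<in> space M \<Longrightarrow> \<bar>Y \<omega>\<bar> \<le> C"
    and q[measurable]: "q \<in> borel_measurable borel" and int: "has_bochner_integral M (\<lambda>\<omega>. q (Z \<omega>)) e"
  shows "has_bochner_integral M (\<lambda>\<omega>. Y \<omega> * q (Z \<omega>)) (expectation Y * e)"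
proof -
  have YM[measurable]: "Y \<in> borel_measurable M" using measurable_from_subalg[OF G Y(1)] .
  have "indep_var borel Y borel (\<lambda>\<omega>. q (Z \<omega>))"
    unfolding indep_var_eq indep_sets2_eq
  proof (intro conjI YM ballI)
    show "(\<lambda>\<omega>. q (Z \<omega>)) \<in> borel_measurable M" by measurable
    show "sigma_sets (space M) {Y -` A \<inter> space M |A. A \<in> sets borel} \<subseteq> events"
      by (intro sets.sigma_sets_subset) auto
    show "sigma_sets (space M) {(\<lambda>\<omega>. q (Z \<omega>)) -` A \<inter> space M |A. A \<in> sets borel} \<subseteq> events"
      by (intro sets.sigma_sets_subset) auto
    fix a b assume a: "a \<in> sigma_sets (space M) {Y -` A \<inter> space M |A. A \<in> sets borel}"
      and b: "b \<in> sigma_sets (space M) {(\<lambda>\<omega>. q (Z \<omega>)) -` A \<inter> space M |A. A \<in> sets borel}"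
    have sp: "space G = space M" using G by (simp add: subalgebra_def)
    have "{Y -` A \<inter> space M |A. A \<in> sets borel} \<subseteq> sets G"
      using Y(1) by (auto simp: sp[symmetric] measurable_def)
    then have aG: "a \<in> sets G" using a sets.sigma_sets_subset[of _ G] sp by auto
    \<comment> \<open>Every event generated by \<open>\<lambda>\<omega>. q (Z \<omega>)\<close> is
      itself a preimage, by induction over the generated sigma-algebra; this brings it into the form
      that \<open>ind\<close> covers.\<close>
    have "\<exists>B\<in>sets borel. b = {\<omega>\<in>space M. q (Z \<omega>) \<in> B}"
      using b
    proof induction
      case (Basic b) then show ?case by blast
    next
      case Empty then show ?case by (intro bexI[of _ "{}"]) auto
    next
      case (Compl b)
      then obtain B where "B \<in> sets borel" "b = {\<omega>\<in>space M. q (Z \<omega>) \<in> B}" by blast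
      then show ?case by (intro bexI[of _ "- B"]) auto
    next
      case (Union b)
      then obtain B where "\<And>i. B i \<in> sets borel" "\<And>i. b i = {\<omega>\<in>space M. q (Z \<omega>) \<in> B i}" by metis
      then show ?case by (intro bexI[of _ "\<Union>i. B i"]) auto
    qed
    then obtain B where B: "B \<in> sets borel" "b = {\<omega>\<in>space M. Z \<omega> \<in> q -` B}" by auto
    moreover have "q -` B \<in> sets borel" using B(1) measurable_sets_borel[OF q] by auto
    ultimately show "prob (a \<inter> b) = prob a * prob b" using ind[OF aG, of "q -` B"] by simp
  qed
  moreover have "integrable M Y"
    by (rule integrable_const_bound[where B=C]) (use Y(2) YM in auto)
  ultimately show ?thesis
    using int indep_var_lebesgue_integral[of Y "\<lambda>\<omega>. q (Z \<omega>)"] indep_var_integrable[of Y "\<lambda>\<omega>. q (Z \<omega>)"]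
    by (simp add: has_bochner_integral_iff)
qed

end

section \<open>Measurability of matrix operations and elementary inequalities\<close>

lemma borel_measurable_bounded_bilinear:
  fixes p :: "'b::{second_countable_topology, real_normed_vector} \<Rightarrow> 'c::{second_countable_topology, real_normed_vector} \<Rightarrow> 'd::real_normed_vector"
  assumes "bounded_bilinear p" "a \<in> borel_measurable M" "b \<in> borel_measurable M"
  shows "(\<lambda>\<omega>. p (a \<omega>) (b \<omega>)) \<in> borel_measurable M"
  using assms(2,3)
proof (rule borel_measurable_continuous_Pair)
  show "continuous_on UNIV (\<lambda>x. p (fst x) (snd x))"
    by (intro bounded_bilinear.continuous_on[OF assms(1)] continuous_intros)
qed

lemma borel_measurable_matrix_mult [measurable (raw)]:
  fixes A :: "'a \<Rightarrow> real^'m^'n" and B :: "'a \<Rightarrow> real^'k^'m"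
  shows "A \<in> borel_measurable M \<Longrightarrow> B \<in> borel_measurable M \<Longrightarrow> (\<lambda>\<omega>. A \<omega> ** B \<omega>) \<in> borel_measurable M"
  by (rule borel_measurable_bounded_bilinear[OF bounded_bilinear_matrix_mult])

lemma bounded_bilinear_matrix_vector_mult:
  "bounded_bilinear (\<lambda>(A :: real^'m^'n) z. A *v z)"
proof
  show "\<exists>K. \<forall>(A :: real^'m^'n) z. norm (A *v z) \<le> norm A * norm z * K"
    using norm_matrix_vector_mult_le by (intro exI[of _ 1]) auto
qed (auto simp: matrix_vector_mult_add_rdistrib matrix_vector_right_distrib scaleR_matrix_vector_assoc
       matrix_vector_mult_scaleR)

lemma borel_measurable_matrix_vector_mult [measurable (raw)]:
  fixes A :: "'a \<Rightarrow> real^'m^'n"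
  shows "A \<in> borel_measurable M \<Longrightarrow> b \<in> borel_measurable M \<Longrightarrow> (\<lambda>\<omega>. A \<omega> *v b \<omega>) \<in> borel_measurable M"
  by (rule borel_measurable_bounded_bilinear[OF bounded_bilinear_matrix_vector_mult])

lemma borel_measurable_transpose [measurable (raw)]:
  fixes A :: "'a \<Rightarrow> real^'m^'n"
  assumes "A \<in> borel_measurable M"
  shows "(\<lambda>\<omega>. transpose (A \<omega>)) \<in> borel_measurable M"
proof (rule borel_measurable_continuous_on[OF _ assms])
  show "continuous_on UNIV (transpose :: real^'m^'n \<Rightarrow> _)"
    unfolding transpose_def[abs_def] by (intro continuous_on_vec_lambda continuous_intros)
qed

lemma borel_measurable_vec_nth [measurable (raw)]:
  fixes A :: "'a \<Rightarrow> 'b::topological_space^'n"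
  assumes "A \<in> borel_measurable M"
  shows "(\<lambda>\<omega>. A \<omega> $ i) \<in> borel_measurable M"
  by (rule borel_measurable_continuous_on[OF _ assms, of "\<lambda>A. A $ i"]) (intro continuous_intros)

lemma borel_measurable_trace [measurable (raw)]:
  fixes A :: "'a \<Rightarrow> real^'m^'m"
  assumes "A \<in> borel_measurable M"
  shows "(\<lambda>\<omega>. trace (A \<omega>)) \<in> borel_measurable M"
  unfolding trace_def
  by (intro borel_measurable_sum borel_measurable_vec_nth assms)

lemma abs_mult_le_mult:
  fixes y q :: real
  assumes "0 \<le> y" "y \<le> c" "\<bar>q\<bar> \<le> k"
  shows "\<bar>y * q\<bar> \<le> c * k"
  using mult_mono[OF assms(2,3)] assms by (simp add: abs_mult)

lemma add_power4_le: "(a + b) ^ 4 \<le> 8 * (a ^ 4 + b ^ 4)" for a b :: real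
proof -
  have sq: "(p + q)\<^sup>2 \<le> 2 * p\<^sup>2 + 2 * q\<^sup>2" for p q :: real
    using sum_squares_bound[of p q] by (simp add: power2_sum)
  have "((a + b)\<^sup>2)\<^sup>2 \<le> (2 * a\<^sup>2 + 2 * b\<^sup>2)\<^sup>2" by (intro power_mono sq) auto
  also have "\<dots> \<le> 2 * (2 * a\<^sup>2)\<^sup>2 + 2 * (2 * b\<^sup>2)\<^sup>2" by (rule sq)
  finally show ?thesis by (simp add: power_mult_distrib)
qed

lemma norm_power4_le:
  fixes z :: "real^'m"
  shows "norm z ^ 4 \<le> real CARD('m) * (\<Sum>i\<in>UNIV. (z $ i) ^ 4)"
proof -
  have n2: "(norm z)\<^sup>2 = (\<Sum>i\<in>UNIV. (z $ i)\<^sup>2)"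
    unfolding power2_norm_eq_inner inner_vec_def by (simp add: power2_eq_square)
  have "norm z ^ 4 = (\<Sum>i\<in>UNIV. (z $ i)\<^sup>2)\<^sup>2"
    unfolding n2[symmetric] by simp
  also have "\<dots> \<le> (\<Sum>i\<in>UNIV. ((z $ i)\<^sup>2)\<^sup>2) * real CARD('m)"
    by (rule sum_squared_le_sum_of_squares)
  finally show ?thesis by (simp add: mult.commute)
qed

context prob_space begin

text \<open>A one-step Ito formula: in the second-order Taylor bound only the mean and the covariance of the
  Gaussian increment survive, by independence.\<close>

lemma euler_step_expectation_le:
  fixes Z :: "'a \<Rightarrow> real^'m" and X b :: "'a \<Rightarrow> real^'n" and S :: "'a \<Rightarrow> real^'m^'n" and Y :: "'a \<Rightarrow> real"
    and u :: "real^'n \<Rightarrow> real"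
  assumes G: "subalgebra M G" and d: "0 < d" "d \<le> 1"
    and Z: "distributed M lborel Z (\<lambda>y. ennreal (\<Prod>i\<in>UNIV. normal_density 0 (sqrt d) (y $ i)))"
    and ind: "\<And>A B. A \<in> sets G \<Longrightarrow> B \<in> sets borel \<Longrightarrow>
        prob (A \<inter> {\<omega>\<in>space M. Z \<omega> \<in> B}) = prob A * prob {\<omega>\<in>space M. Z \<omega> \<in> B}"
    and [measurable]: "Y \<in> borel_measurable G" "X \<in> borel_measurable G" "b \<in> borel_measurable G" "S \<in> borel_measurable G"
    and Y: "\<And>\<omega>. \<omega> \<in> space M \<Longrightarrow> 0 \<le> Y \<omega>" "\<And>\<omega>. \<omega> \<in> space M \<Longrightarrow> Y \<omega> \<le> CY"
    and Cb: "\<And>\<omega>. \<omega> \<in> space M \<Longrightarrow> Y \<omega> \<noteq> 0 \<Longrightarrow> norm (b \<omega>) \<le> C"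
    and CS: "\<And>\<omega>. \<omega> \<in> space M \<Longrightarrow> Y \<omega> \<noteq> 0 \<Longrightarrow> norm (S \<omega>) \<le> C" and C: "0 \<le> C"
    and [measurable]: "u \<in> borel_measurable borel" "Du \<in> borel_measurable borel" "Hu \<in> borel_measurable borel"
    and B: "\<And>z. \<bar>u z\<bar> \<le> B" "\<And>z. norm (Du z) \<le> B" "\<And>z. norm (Hu z) \<le> B"
    and taylor: "\<And>z e. u (z + e) \<le> u z + Du z \<bullet> e + 1/2 * (e \<bullet> (Hu z *v e)) + \<eta> * (norm e)\<^sup>2 + D * (norm e)^4"
    and \<eta>: "0 \<le> \<eta>" and D: "0 \<le> D"
  shows "expectation (\<lambda>\<omega>. Y \<omega> * u (X \<omega> + d *\<^sub>R b \<omega> + S \<omega> *v Z \<omega>)) \<le>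
      expectation (\<lambda>\<omega>. Y \<omega> * (u (X \<omega>) + d * (Du (X \<omega>) \<bullet> b \<omega> +
         1/2 * trace (transpose (S \<omega>) ** Hu (X \<omega>) ** S \<omega>))))
      + CY * d * (\<eta> * (2 * C\<^sup>2 * (1 + real CARD('m))) + d * (B * C\<^sup>2 + 8 * D * C ^ 4 * (1 + 3 * (real CARD('m))\<^sup>2)))"
proof -
  note GM = measurable_from_subalg[OF G]
  have [measurable]: "Y \<in> borel_measurable M" "X \<in> borel_measurable M" "b \<in> borel_measurable M" "S \<in> borel_measurable M"
    by (rule GM, measurable)+
  have ZM[measurable]: "Z \<in> borel_measurable M" using distributed_measurable[OF Z] by simp
  have B0: "0 \<le> B" using B(1)[of 0] by linarith
  have CY: "0 \<le> CY" using Y not_empty by (meson all_not_in_conv order_trans)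
  let ?m = "real CARD('m)" and ?U = "\<lambda>\<omega>. Y \<omega> * u (X \<omega> + d *\<^sub>R b \<omega> + S \<omega> *v Z \<omega>)"
    and ?L = "\<lambda>\<omega>. u (X \<omega>) + d * (Du (X \<omega>) \<bullet> b \<omega>)"
  define a where "a \<omega> = d *\<^sub>R b \<omega>" for \<omega>
  \<comment> \<open>Everything linear in the increment: the gradient term and the two mixed terms of
    the quadratic form. Symmetry of \<open>Hu\<close> is not assumed, so the mixed terms stay apart.
    As \<open>l\<close> is known before the increment, which has mean zero, this part averages
    out.\<close>
  define l where "l \<omega> = transpose (S \<omega>) *v Du (X \<omega>) + (1/2) *\<^sub>R (transpose (Hu (X \<omega>) ** S \<omega>) *v a \<omega>)
     + (1/2) *\<^sub>R (transpose (S \<omega>) *v (Hu (X \<omega>) *v a \<omega>))" for \<omega>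
  define Q where "Q \<omega> = transpose (S \<omega>) ** Hu (X \<omega>) ** S \<omega>" for \<omega>
  have [measurable]: "a \<in> borel_measurable G" "l \<in> borel_measurable G" "Q \<in> borel_measurable G"
    unfolding a_def[abs_def] l_def[abs_def] Q_def[abs_def] by measurable
  have [measurable]: "a \<in> borel_measurable M" "l \<in> borel_measurable M" "Q \<in> borel_measurable M"
    by (rule GM, measurable)+
  have s0: "0 < sqrt d" using d by simp
  have expand: "Du (X \<omega>) \<bullet> (a \<omega> + S \<omega> *v z) + 1/2 * ((a \<omega> + S \<omega> *v z) \<bullet> (Hu (X \<omega>) *v (a \<omega> + S \<omega> *v z)))
     = Du (X \<omega>) \<bullet> a \<omega> + 1/2 * (a \<omega> \<bullet> (Hu (X \<omega>) *v a \<omega>)) + l \<omega> \<bullet> z + 1/2 * (z \<bullet> (Q \<omega> *v z))" for \<omega> z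
  proof -
    let ?H = "Hu (X \<omega>)" and ?s = "S \<omega>"
    have "?H *v (?s *v z) = (?H ** ?s) *v z" by (simp add: matrix_vector_mul_assoc)
    then have 1: "a \<omega> \<bullet> (?H *v (?s *v z)) = (transpose (?H ** ?s) *v a \<omega>) \<bullet> z"
      by (simp only: inner_matrix_transpose)
    have 2: "(?s *v z) \<bullet> y = (transpose ?s *v y) \<bullet> z" for y
      using inner_matrix_transpose[of y ?s z] by (simp add: inner_commute)
    have 3: "(?s *v z) \<bullet> (?H *v (?s *v z)) = z \<bullet> (Q \<omega> *v z)"
      unfolding 2 Q_def by (simp add: matrix_vector_mul_assoc inner_commute matrix_mul_assoc)
    have 4: "Du (X \<omega>) \<bullet> (?s *v z) = (transpose ?s *v Du (X \<omega>)) \<bullet> z" by (rule inner_matrix_transpose)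
    show ?thesis
      by (simp add: matrix_vector_right_distrib inner_add_left inner_add_right 1 3 4 2[of "?H *v a \<omega>"] l_def algebra_simps
           del: transpose_matrix_vector)
  qed
  have Qsum: "z \<bullet> (A *v z) = (\<Sum>i\<in>UNIV. \<Sum>j\<in>UNIV. A $ i $ j * (z $ i * z $ j))" for z and A :: "real^'m^'m"
    by (simp add: inner_vec_def matrix_vector_mult_def sum_distrib_left ac_simps)
  define Kl where "Kl = C * B + C * (B * C)"
  \<comment> \<open>\<open>b\<close> and \<open>S\<close> are bounded only where \<open>Y\<close> is
    nonzero, so boundedness is claimed for products with \<open>Y\<close>; this is how killing makes
    unbounded coefficients harmless.\<close>
  have boundl: "\<bar>Y \<omega> * (l \<omega> $ i)\<bar> \<le> CY * Kl" if \<omega>: "\<omega> \<in> space M" for \<omega> i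
  proof (cases "Y \<omega> = 0")
    case True
    then show ?thesis using CY C B0 by (simp add: Kl_def)
  next
    case False
    note bs = Cb[OF \<omega> False] CS[OF \<omega> False]
    have na: "norm (a \<omega>) \<le> C"
    proof -
      have "d * norm (b \<omega>) \<le> 1 * C" using d bs by (intro mult_mono) auto
      then show ?thesis using d by (simp add: a_def)
    qed
    have n1: "norm (transpose (S \<omega>) *v v) \<le> C * norm v" for v
      using norm_matrix_vector_mult_le[of "transpose (S \<omega>)" v] bs(2)
      by (metis mult_right_mono norm_ge_zero norm_transpose order_trans)
    have n2: "norm (Hu (X \<omega>) *v a \<omega>) \<le> B * C"
      using mult_mono[OF B(3) na B0 norm_ge_zero] norm_matrix_vector_mult_le[of "Hu (X \<omega>)" "a \<omega>"] by (metis order_trans)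
    have n3: "norm (transpose (Hu (X \<omega>) ** S \<omega>) *v a \<omega>) \<le> (B * C) * C"
    proof -
      have "norm (Hu (X \<omega>) ** S \<omega>) \<le> B * C"
        using mult_mono[OF B(3) bs(2) B0 norm_ge_zero] norm_matrix_mult_le[of "Hu (X \<omega>)" "S \<omega>"] by (metis order_trans)
      then have "norm (transpose (Hu (X \<omega>) ** S \<omega>)) * norm (a \<omega>) \<le> (B * C) * C"
        unfolding norm_transpose using na C B0 by (intro mult_mono) auto
      then show ?thesis using norm_matrix_vector_mult_le order_trans by blast
    qed
    have "norm (l \<omega>) \<le> C * B + (1/2) * ((B * C) * C) + (1/2) * (C * (B * C))"
      unfolding l_def
    proof (intro norm_triangle_le add_mono)
      show "norm (transpose (S \<omega>) *v Du (X \<omega>)) \<le> C * B"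
        using n1[of "Du (X \<omega>)"] mult_left_mono[OF B(2) C] by (metis order_trans)
      show "norm ((1/2) *\<^sub>R (transpose (Hu (X \<omega>) ** S \<omega>) *v a \<omega>)) \<le> (1/2) * ((B * C) * C)"
        using n3 by simp
      have "norm (transpose (S \<omega>) *v (Hu (X \<omega>) *v a \<omega>)) \<le> C * (B * C)"
        using n1[of "Hu (X \<omega>) *v a \<omega>"] mult_left_mono[OF n2 C] by (metis order_trans)
      then show "norm ((1/2) *\<^sub>R (transpose (S \<omega>) *v (Hu (X \<omega>) *v a \<omega>))) \<le> (1/2) * (C * (B * C))"
        by simp
    qed
    also have "\<dots> = Kl" by (simp add: Kl_def field_simps)
    finally have "norm (l \<omega>) \<le> Kl" .
    then have "\<bar>l \<omega> $ i\<bar> \<le> Kl" using component_le_norm_cart[of "l \<omega>" i] by linarith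
    then show ?thesis by (rule abs_mult_le_mult[OF Y[OF \<omega>]])
  qed
  have boundQ: "\<bar>Y \<omega> * (Q \<omega> $ i $ j)\<bar> \<le> CY * (C * B * C)" if \<omega>: "\<omega> \<in> space M" for \<omega> i j
  proof (cases "Y \<omega> = 0")
    case True
    then show ?thesis using CY C B0 by simp
  next
    case False
    have "norm (Q \<omega>) \<le> norm (transpose (S \<omega>) ** Hu (X \<omega>)) * norm (S \<omega>)"
      unfolding Q_def by (rule norm_matrix_mult_le)
    also have "\<dots> \<le> (norm (S \<omega>) * norm (Hu (X \<omega>))) * norm (S \<omega>)"
      using norm_matrix_mult_le[of "transpose (S \<omega>)" "Hu (X \<omega>)"] by (intro mult_right_mono) (auto simp: norm_transpose)
    also have "\<dots> \<le> C * B * C"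
      using CS[OF \<omega> False] B(3)[of "X \<omega>"] C B0 by (intro mult_mono) auto
    finally have "\<bar>Q \<omega> $ i $ j\<bar> \<le> C * B * C" using abs_matrix_nth_le[of "Q \<omega>" i j] by linarith
    then show ?thesis by (rule abs_mult_le_mult[OF Y[OF \<omega>]])
  qed
  have L: "has_bochner_integral M (\<lambda>\<omega>. Y \<omega> * (l \<omega> $ i) * (Z \<omega> $ i)) 0" for i
  proof -
    have "has_bochner_integral M (\<lambda>\<omega>. Y \<omega> * (l \<omega> $ i) * (Z \<omega> $ i)) (expectation (\<lambda>\<omega>. Y \<omega> * (l \<omega> $ i)) * 0)"
    proof (rule indep_mult_integral[OF G ZM ind _ boundl _ gaussian_vector_moments(1)[OF Z s0]])
      show "(\<lambda>\<omega>. Y \<omega> * (l \<omega> $ i)) \<in> borel_measurable G" "(\<lambda>z :: real^'m. z $ i) \<in> borel_measurable borel"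
        by measurable
    qed
    then show ?thesis by simp
  qed
  have QQ: "has_bochner_integral M (\<lambda>\<omega>. Y \<omega> * (Q \<omega> $ i $ j) * (Z \<omega> $ i * Z \<omega> $ j))
      (expectation (\<lambda>\<omega>. Y \<omega> * (Q \<omega> $ i $ j)) * (if i = j then d else 0))" for i j
  proof -
    have "has_bochner_integral M (\<lambda>\<omega>. Y \<omega> * (Q \<omega> $ i $ j) * (Z \<omega> $ i * Z \<omega> $ j))
      (expectation (\<lambda>\<omega>. Y \<omega> * (Q \<omega> $ i $ j)) * (if i = j then (sqrt d)\<^sup>2 else 0))"
    proof (rule indep_mult_integral[OF G ZM ind _ boundQ _ gaussian_vector_moments(2)[OF Z s0]])
      show "(\<lambda>\<omega>. Y \<omega> * (Q \<omega> $ i $ j)) \<in> borel_measurable G"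
        "(\<lambda>z :: real^'m. z $ i * z $ j) \<in> borel_measurable borel"
        by measurable
    qed
    moreover have "(sqrt d)\<^sup>2 = d" using d by simp
    ultimately show ?thesis by (simp only:)
  qed
  have Lsum: "has_bochner_integral M (\<lambda>\<omega>. Y \<omega> * (l \<omega> \<bullet> Z \<omega>)) 0"
    using has_bochner_integral_sum[of UNIV, OF L] by (simp add: inner_vec_def sum_distrib_left mult.assoc)
  have intQ: "integrable M (\<lambda>\<omega>. Y \<omega> * (Q \<omega> $ i $ j))" for i j
    by (rule integrable_const_bound[where B="CY * (C * B * C)"]) (use boundQ in auto)
  \<comment> \<open>Only the diagonal survives: the coordinates of the increment are uncorrelated
    with variance \<open>d\<close>, so the quadratic form averages to \<open>d\<close> times the
    trace.\<close>
  have Qsum': "has_bochner_integral M (\<lambda>\<omega>. Y \<omega> * (Z \<omega> \<bullet> (Q \<omega> *v Z \<omega>))) (d * expectation (\<lambda>\<omega>. Y \<omega> * trace (Q \<omega>)))"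
  proof -
    have "has_bochner_integral M (\<lambda>\<omega>. \<Sum>i\<in>UNIV. \<Sum>j\<in>UNIV. Y \<omega> * (Q \<omega> $ i $ j) * (Z \<omega> $ i * Z \<omega> $ j))
      (\<Sum>i\<in>UNIV. \<Sum>j\<in>UNIV. expectation (\<lambda>\<omega>. Y \<omega> * (Q \<omega> $ i $ j)) * (if i = j then d else 0))"
      by (intro has_bochner_integral_sum QQ)
    moreover have "(\<Sum>i\<in>UNIV. \<Sum>j\<in>UNIV. expectation (\<lambda>\<omega>. Y \<omega> * (Q \<omega> $ i $ j)) * (if i = j then d else 0))
       = d * expectation (\<lambda>\<omega>. Y \<omega> * trace (Q \<omega>))"
    proof -
      have "(\<Sum>j\<in>UNIV. q j * (if i = j then d else 0)) = d * q i" for i and q :: "'m \<Rightarrow> real"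
        by (simp add: if_distrib mult.commute cong: if_cong)
      then show ?thesis
        unfolding trace_def sum_distrib_left
        by (subst Bochner_Integration.integral_sum) (auto intro: intQ simp: sum_distrib_left)
    qed
    ultimately show ?thesis by (simp add: Qsum sum_distrib_left mult.assoc)
  qed
  \<comment> \<open>A polynomial in the increment alone that dominates the Taylor remainder: the
    random coefficients have been replaced by their bound \<open>C\<close>, so its mean needs only
    second and fourth moments.\<close>
  define rem where "rem z = \<eta> * (2 * (d * C)\<^sup>2 + 2 * (C\<^sup>2 * (\<Sum>i\<in>UNIV. (z $ i)\<^sup>2)))
     + D * (8 * ((d * C) ^ 4 + C ^ 4 * (?m * (\<Sum>i\<in>UNIV. (z $ i) ^ 4))))" for z :: "real^'m"
  have rem: "has_bochner_integral M (\<lambda>\<omega>. CY * rem (Z \<omega>))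
     (CY * (\<eta> * (2 * (d * C)\<^sup>2 + 2 * (C\<^sup>2 * (\<Sum>i\<in>(UNIV :: 'm set). d)))
       + D * (8 * ((d * C) ^ 4 + C ^ 4 * (?m * (\<Sum>i\<in>(UNIV :: 'm set). 3 * d\<^sup>2))))))"
  proof -
    have const: "has_bochner_integral M (\<lambda>\<omega>. k) k" for k :: real
      by (simp add: has_bochner_integral_iff prob_space)
    have m2: "has_bochner_integral M (\<lambda>\<omega>. (Z \<omega> $ i)\<^sup>2) d" for i
      using gaussian_vector_moments(2)[OF Z s0, of i i] d by (simp add: power2_eq_square)
    have m4: "has_bochner_integral M (\<lambda>\<omega>. (Z \<omega> $ i) ^ 4) (3 * d\<^sup>2)" for i
    proof -
      have "sqrt d ^ 4 = ((sqrt d)\<^sup>2)\<^sup>2" by simp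
      also have "\<dots> = d\<^sup>2" using d by simp
      finally show ?thesis using gaussian_vector_moments(3)[OF Z s0, of i] by (simp only:)
    qed
    show ?thesis
      unfolding rem_def
      by (intro has_bochner_integral_mult_right has_bochner_integral_add has_bochner_integral_sum const m2 m4)
  qed
  have pointwise: "?U \<omega> \<le>
      Y \<omega> * ?L \<omega> + CY * (d\<^sup>2 * B * C\<^sup>2)
      + Y \<omega> * (l \<omega> \<bullet> Z \<omega>) + 1/2 * (Y \<omega> * (Z \<omega> \<bullet> (Q \<omega> *v Z \<omega>))) + CY * rem (Z \<omega>)" if \<omega>: "\<omega> \<in> space M" for \<omega>
  proof (cases "Y \<omega> = 0")
    case True
    have "0 \<le> CY * rem (Z \<omega>)" unfolding rem_def
      using CY \<eta> D C by (intro mult_nonneg_nonneg add_nonneg_nonneg sum_nonneg) auto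
    then show ?thesis using True CY B0 C by simp
  next
    case False
    note bs = Cb[OF \<omega> False] CS[OF \<omega> False]
    define e where "e = a \<omega> + S \<omega> *v Z \<omega>"
    have na: "norm (a \<omega>) \<le> d * C" using bs d by (simp add: a_def)
    have ns: "norm (S \<omega> *v Z \<omega>) \<le> C * norm (Z \<omega>)"
      using norm_matrix_vector_mult_le[of "S \<omega>" "Z \<omega>"] bs(2) by (metis mult_right_mono norm_ge_zero order_trans)
    have ne: "norm e \<le> d * C + C * norm (Z \<omega>)" unfolding e_def using na ns norm_triangle_mono by blast
    have e2: "(norm e)\<^sup>2 \<le> 2 * (d * C)\<^sup>2 + 2 * (C\<^sup>2 * (\<Sum>i\<in>UNIV. (Z \<omega> $ i)\<^sup>2))"
    proof -
      have "(norm e)\<^sup>2 \<le> (d * C + C * norm (Z \<omega>))\<^sup>2" using ne by (intro power_mono) auto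
      also have "\<dots> \<le> 2 * (d * C)\<^sup>2 + 2 * (C * norm (Z \<omega>))\<^sup>2"
        using sum_squares_bound[of "d * C" "C * norm (Z \<omega>)"] by (simp add: power2_sum)
      also have "(C * norm (Z \<omega>))\<^sup>2 = C\<^sup>2 * (\<Sum>i\<in>UNIV. (Z \<omega> $ i)\<^sup>2)"
        unfolding power_mult_distrib power2_norm_eq_inner inner_vec_def by (simp add: power2_eq_square)
      finally show ?thesis .
    qed
    have e4: "norm e ^ 4 \<le> 8 * ((d * C) ^ 4 + C ^ 4 * (?m * (\<Sum>i\<in>UNIV. (Z \<omega> $ i) ^ 4)))"
    proof -
      have "norm e ^ 4 \<le> (d * C + C * norm (Z \<omega>)) ^ 4" using ne by (intro power_mono) auto
      also have "\<dots> \<le> 8 * ((d * C) ^ 4 + (C * norm (Z \<omega>)) ^ 4)" by (rule add_power4_le)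
      also have "(C * norm (Z \<omega>)) ^ 4 \<le> C ^ 4 * (?m * (\<Sum>i\<in>UNIV. (Z \<omega> $ i) ^ 4))"
        unfolding power_mult_distrib by (intro mult_left_mono norm_power4_le) simp
      finally show ?thesis by simp
    qed
    have r: "\<eta> * (norm e)\<^sup>2 + D * norm e ^ 4 \<le> rem (Z \<omega>)"
      unfolding rem_def using e2 e4 \<eta> D by (intro add_mono mult_left_mono)
    have r0: "0 \<le> rem (Z \<omega>)" using r \<eta> D by (meson add_nonneg_nonneg mult_nonneg_nonneg order_trans zero_le_power norm_ge_zero)
    have aHa: "a \<omega> \<bullet> (Hu (X \<omega>) *v a \<omega>) \<le> d\<^sup>2 * B * C\<^sup>2"
    proof -
      have "a \<omega> \<bullet> (Hu (X \<omega>) *v a \<omega>) \<le> norm (Hu (X \<omega>)) * norm (a \<omega>) * norm (a \<omega>)"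
        using inner_matrix_vector_mult_le[of "a \<omega>" "Hu (X \<omega>)" "a \<omega>"] by linarith
      also have "\<dots> \<le> B * (d * C) * (d * C)"
        using na B(3)[of "X \<omega>"] B0 C d by (intro mult_mono) auto
      finally show ?thesis by (simp add: power2_eq_square ac_simps)
    qed
    have "0 \<le> d\<^sup>2 * B * C\<^sup>2" using B0 by simp
    then have "u (X \<omega> + e) \<le> ?L \<omega> + d\<^sup>2 * B * C\<^sup>2 + l \<omega> \<bullet> Z \<omega>
        + 1/2 * (Z \<omega> \<bullet> (Q \<omega> *v Z \<omega>)) + rem (Z \<omega>)"
      using taylor[of "X \<omega>" e] expand[of \<omega> "Z \<omega>"] r aHa unfolding e_def[symmetric]
      by (simp add: a_def)
    then have "Y \<omega> * u (X \<omega> + e) \<le> Y \<omega> * (?L \<omega> + d\<^sup>2 * B * C\<^sup>2 + l \<omega> \<bullet> Z \<omega>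
        + 1/2 * (Z \<omega> \<bullet> (Q \<omega> *v Z \<omega>)) + rem (Z \<omega>))"
      using Y(1)[OF \<omega>] by (rule mult_left_mono)
    moreover have "Y \<omega> * (d\<^sup>2 * B * C\<^sup>2) \<le> CY * (d\<^sup>2 * B * C\<^sup>2)"
      using Y(2)[OF \<omega>] B0 by (intro mult_right_mono) auto
    moreover have "Y \<omega> * rem (Z \<omega>) \<le> CY * rem (Z \<omega>)"
      using Y(2)[OF \<omega>] r0 by (intro mult_right_mono) auto
    moreover have eq: "X \<omega> + d *\<^sub>R b \<omega> + S \<omega> *v Z \<omega> = X \<omega> + e" by (simp add: e_def a_def)
    ultimately show ?thesis unfolding eq by (simp add: distrib_left)
  qed
  have bnd1: "\<bar>Y \<omega> * ?L \<omega>\<bar> \<le> CY * (B + B * C)" if \<omega>: "\<omega> \<in> space M" for \<omega>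
  proof (cases "Y \<omega> = 0")
    case True
    then show ?thesis using CY C B0 by simp
  next
    case False
    have "\<bar>Du (X \<omega>) \<bullet> b \<omega>\<bar> \<le> B * C"
      using Cauchy_Schwarz_ineq2[of "Du (X \<omega>)" "b \<omega>"] mult_mono[OF B(2) Cb[OF \<omega> False] B0 norm_ge_zero] by (metis order_trans)
    then have "d * \<bar>Du (X \<omega>) \<bullet> b \<omega>\<bar> \<le> 1 * (B * C)" using d by (intro mult_mono) auto
    then have "\<bar>d * (Du (X \<omega>) \<bullet> b \<omega>)\<bar> \<le> B * C" using d by (simp add: abs_mult)
    then have "\<bar>?L \<omega>\<bar> \<le> B + B * C" using B(1)[of "X \<omega>"] by linarith
    then show ?thesis by (rule abs_mult_le_mult[OF Y[OF \<omega>]])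
  qed
  have int1: "integrable M (\<lambda>\<omega>. Y \<omega> * ?L \<omega>)"
    by (rule integrable_const_bound[where B="CY * (B + B * C)"]) (use bnd1 in auto)
  have inttr: "integrable M (\<lambda>\<omega>. Y \<omega> * trace (Q \<omega>))"
    unfolding trace_def sum_distrib_left by (intro Bochner_Integration.integrable_sum intQ)
  have "expectation ?U \<le>
     expectation (\<lambda>\<omega>. Y \<omega> * ?L \<omega> + CY * (d\<^sup>2 * B * C\<^sup>2)
      + Y \<omega> * (l \<omega> \<bullet> Z \<omega>) + 1/2 * (Y \<omega> * (Z \<omega> \<bullet> (Q \<omega> *v Z \<omega>))) + CY * rem (Z \<omega>))"
  proof (rule integral_mono)
    have "\<bar>?U \<omega>\<bar> \<le> CY * B" if "\<omega> \<in> space M" for \<omega>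
      by (rule abs_mult_le_mult[OF Y[OF that] B(1)])
    then show "integrable M ?U"
      by (intro integrable_const_bound[where B="CY * B"]) auto
    show "integrable M (\<lambda>\<omega>. Y \<omega> * ?L \<omega> + CY * (d\<^sup>2 * B * C\<^sup>2)
      + Y \<omega> * (l \<omega> \<bullet> Z \<omega>) + 1/2 * (Y \<omega> * (Z \<omega> \<bullet> (Q \<omega> *v Z \<omega>))) + CY * rem (Z \<omega>))"
      using int1 Lsum Qsum' rem unfolding has_bochner_integral_iff
      by (intro Bochner_Integration.integrable_add integrable_mult_right) auto
  qed (rule pointwise)
  also have "\<dots> = expectation (\<lambda>\<omega>. Y \<omega> * ?L \<omega>) + CY * (d\<^sup>2 * B * C\<^sup>2) + 0
      + 1/2 * (d * expectation (\<lambda>\<omega>. Y \<omega> * trace (Q \<omega>))) + expectation (\<lambda>\<omega>. CY * rem (Z \<omega>))"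
    using int1 Lsum Qsum' rem by (simp add: has_bochner_integral_iff prob_space)
  also have "expectation (\<lambda>\<omega>. Y \<omega> * ?L \<omega>) + CY * (d\<^sup>2 * B * C\<^sup>2) + 0
      + 1/2 * (d * expectation (\<lambda>\<omega>. Y \<omega> * trace (Q \<omega>))) + expectation (\<lambda>\<omega>. CY * rem (Z \<omega>))
     = expectation (\<lambda>\<omega>. Y \<omega> * (u (X \<omega>) + d * (Du (X \<omega>) \<bullet> b \<omega> + 1/2 * trace (Q \<omega>))))
       + (CY * (d\<^sup>2 * B * C\<^sup>2) + expectation (\<lambda>\<omega>. CY * rem (Z \<omega>)))"
  proof -
    have "expectation (\<lambda>\<omega>. Y \<omega> * (u (X \<omega>) + d * (Du (X \<omega>) \<bullet> b \<omega> + 1/2 * trace (Q \<omega>))))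
      = expectation (\<lambda>\<omega>. Y \<omega> * ?L \<omega> + (1/2 * d) * (Y \<omega> * trace (Q \<omega>)))"
      by (simp add: algebra_simps)
    also have "\<dots> = expectation (\<lambda>\<omega>. Y \<omega> * ?L \<omega>) + (1/2 * d) * expectation (\<lambda>\<omega>. Y \<omega> * trace (Q \<omega>))"
      using int1 inttr by simp
    finally show ?thesis by simp
  qed
  also have "CY * (d\<^sup>2 * B * C\<^sup>2) + expectation (\<lambda>\<omega>. CY * rem (Z \<omega>)) \<le>
     CY * d * (\<eta> * (2 * C\<^sup>2 * (1 + ?m)) + d * (B * C\<^sup>2 + 8 * D * C ^ 4 * (1 + 3 * ?m\<^sup>2)))"
  proof -
    \<comment> \<open>Since \<open>d \<le> 1\<close>, the \<eta> part is bounded to order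
      \<open>d\<close> and the rest to order \<open>d^2\<close>; only the former survives summation
      over a fixed time span.\<close>
    have d2: "d\<^sup>2 \<le> d" using d by (simp add: power2_eq_square mult_left_le)
    have d4: "d ^ 4 \<le> d\<^sup>2" using d by (intro power_decreasing) auto
    have "expectation (\<lambda>\<omega>. CY * rem (Z \<omega>)) = CY * (\<eta> * (2 * C\<^sup>2 * (d\<^sup>2 + ?m * d))
        + 8 * D * C ^ 4 * (d ^ 4 + 3 * ?m\<^sup>2 * d\<^sup>2))"
      using rem by (simp add: has_bochner_integral_iff power_mult_distrib algebra_simps power2_eq_square)
    also have "\<dots> \<le> CY * (\<eta> * (2 * C\<^sup>2 * (d + ?m * d)) + 8 * D * C ^ 4 * (d\<^sup>2 + 3 * ?m\<^sup>2 * d\<^sup>2))"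
      using d2 d4 CY \<eta> D by (intro mult_left_mono add_mono) auto
    finally show ?thesis by (simp add: algebra_simps power2_eq_square)
  qed
  finally show ?thesis by (simp add: Q_def)
qed

end

section \<open>Step approximation and convergence in probability\<close>

abbreviation cell :: "nat \<Rightarrow> real \<Rightarrow> nat" where
  "cell m s \<equiv> nat \<lfloor>s * real m\<rfloor>"

lemma floor_grid_le:
  assumes "0 < m" "0 \<le> s"
  shows "real (cell m s) / m \<le> s" "s < (real (cell m s) + 1) / m"
    "s - real (cell m s) / m < 1 / m"
proof -
  have fl: "real (cell m s) = of_int \<lfloor>s * real m\<rfloor>" using assms by simp
  show "real (cell m s) / m \<le> s" unfolding fl using assms by (simp add: pos_divide_le_eq)
  show lt: "s < (real (cell m s) + 1) / m"
    unfolding fl using assms real_of_int_floor_add_one_gt[of "s * real m"] by (simp add: pos_less_divide_eq)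
  then show "s - real (cell m s) / m < 1 / m" by (simp add: add_divide_distrib)
qed

text \<open>Sampling a merely measurable \<open>S\<close> on grids need not converge to it.
  Continuous functions converging to \<open>S\<close> almost everywhere are sampled instead, on
  grids so fine that sampling costs less than \<open>1 / Suc n\<close>.\<close>

lemma AE_step_approximation:
  fixes S :: "real \<Rightarrow> 'b::euclidean_space"
  assumes S: "S \<in> borel_measurable (restrict_space borel {0..})" and C: "\<And>t. 0 \<le> t \<Longrightarrow> norm (S t) \<le> C"
  obtains m :: "nat \<Rightarrow> nat" and G :: "nat \<Rightarrow> nat \<Rightarrow> 'b"
  where "\<And>n. n < m n" "\<And>n i. norm (G n i) \<le> C"
    "AE s in lborel. s \<in> {0..T} \<longrightarrow> (\<lambda>n. G n (cell (m n) s)) \<longlonglongrightarrow> S s"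
proof -
  have C0: "0 \<le> C" using C[of 0] norm_ge_zero order_trans by blast
  define S' where "S' t = indicator {0..} t *\<^sub>R S t" for t
  have "S' \<in> borel_measurable borel"
    using S unfolding S'_def[abs_def] by (subst (asm) borel_measurable_restrict_space_iff) auto
  then have "S' \<in> borel_measurable lebesgue" by (auto intro: measurable_completion)
  then have "S' measurable_on UNIV" by (intro lebesgue_measurable_imp_measurable_on) auto
  then obtain N g where N: "negligible N" and g: "\<And>n. continuous_on UNIV (g n)"
    and lim: "\<And>s. s \<notin> N \<Longrightarrow> (\<lambda>n. g n s) \<longlonglongrightarrow> S' s"
    unfolding measurable_on_def by auto
  \<comment> \<open>The continuous approximants need not respect the bound \<open>C\<close>.
    Projection onto the ball restores it, is continuous and fixes \<open>S s\<close>, so the limit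
    is unchanged.\<close>
  define p where "p = closest_point (cball (0 :: 'b) C)"
  have p_cont: "continuous_on UNIV p" unfolding p_def using C0 by (intro continuous_on_closest_point) auto
  have p_in: "norm (p y) \<le> C" for y
    using closest_point_in_set[of "cball (0 :: 'b) C" y] C0 by (auto simp: p_def)
  define g' where "g' n = p \<circ> g n" for n :: nat
  have g'_cont: "continuous_on UNIV (g' n)" for n
    unfolding g'_def by (intro continuous_on_compose g continuous_on_subset[OF p_cont]) auto
  \<comment> \<open>The mesh is chosen after the \<open>n\<close>-th approximant;
    \<open>k > n\<close> makes the meshes shrink even where uniform continuity would allow a coarse
    grid.\<close>
  have "\<exists>k > n. \<forall>s\<in>{0..T}. dist (g' n (cell k s / k)) (g' n s) < 1 / Suc n" for n
  proof -
    have "uniformly_continuous_on {0..T} (g' n)"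
      by (intro compact_uniformly_continuous continuous_on_subset[OF g'_cont]) auto
    then obtain d where d: "d > 0" "\<And>s t. s \<in> {0..T} \<Longrightarrow> t \<in> {0..T} \<Longrightarrow> dist t s < d \<Longrightarrow> dist (g' n t) (g' n s) < 1 / Suc n"
      unfolding uniformly_continuous_on_def by (auto dest!: spec[of _ "1 / Suc n"])
    obtain k where k: "1 / d + n < real k" using reals_Archimedean2 by blast
    have "1 / d > 0" using d by simp
    then have kn: "n < k" and kd: "1 / d < k" using k by linarith+
    have "dist (g' n (cell k s / k)) (g' n s) < 1 / Suc n" if s: "s \<in> {0..T}" for s
    proof (rule d(2)[OF s])
      have k0: "0 < real k" using kn by simp
      have le: "real (cell k s) / k \<le> s" "s - real (cell k s) / k < 1 / k"
        using floor_grid_le[of k s] k0 s by auto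
      show "cell k s / k \<in> {0..T}" using le s by auto
      note le(2)
      also have "1 / k < d" using kd d k0 by (simp add: field_simps)
      finally show "dist (real (cell k s) / k) s < d" using le(1) by (simp add: dist_real_def)
    qed
    then show ?thesis using kn by blast
  qed
  then obtain m where m: "\<And>n. n < m n"
    "\<And>n s. s \<in> {0..T} \<Longrightarrow> dist (g' n (cell (m n) s / m n)) (g' n s) < 1 / Suc n"
    by metis
  define G where "G n i = g' n (real i / m n)" for n i
  have "AE s in lebesgue. s \<notin> N" using N by (intro AE_not_in) (simp add: negligible_iff_null_sets)
  then have "AE s in lborel. s \<notin> N" by (simp add: AE_completion_iff)
  then have "AE s in lborel. s \<in> {0..T} \<longrightarrow> (\<lambda>n. G n (cell (m n) s)) \<longlonglongrightarrow> S s"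
  proof eventually_elim
    case (elim s)
    show ?case
    proof
      assume s: "s \<in> {0..T}"
      have "(\<lambda>n. g n s) \<longlonglongrightarrow> S s" using lim[OF elim] s by (simp add: S'_def)
      then have "(\<lambda>n. g' n s) \<longlonglongrightarrow> p (S s)"
        unfolding g'_def comp_def by (rule continuous_on_tendsto_compose[OF p_cont]) auto
      moreover have "p (S s) = S s" unfolding p_def using C s by (intro closest_point_self) auto
      ultimately have 1: "(\<lambda>n. g' n s) \<longlonglongrightarrow> S s" by simp
      have "(\<lambda>n. G n (cell (m n) s) - g' n s) \<longlonglongrightarrow> 0"
      proof (rule Lim_null_comparison)
        show "\<forall>\<^sub>F n in sequentially. norm (G n (cell (m n) s) - g' n s) \<le> 1 / Suc n"
          using m(2)[OF s] by (auto simp: G_def dist_norm[symmetric] intro!: always_eventually less_imp_le)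
        show "(\<lambda>n. 1 / real (Suc n)) \<longlonglongrightarrow> 0"
          using LIMSEQ_inverse_real_of_nat by (simp add: inverse_eq_divide)
      qed
      from tendsto_add[OF this 1] show "(\<lambda>n. G n (cell (m n) s)) \<longlonglongrightarrow> S s" by simp
    qed
  qed
  moreover have "norm (G n i) \<le> C" for n i using p_in by (simp add: G_def g'_def)
  ultimately show thesis using m(1) by (intro that)
qed

lemma floor_grid_tendsto:
  fixes m :: "nat \<Rightarrow> nat" and s :: real
  assumes m: "\<And>n. n < m n" and s: "0 \<le> s"
  shows "(\<lambda>n. real (cell (m n) s) / real (m n)) \<longlonglongrightarrow> s"
proof -
  have bound: "\<bar>real (cell (m n) s) / real (m n) - s\<bar> \<le> 1 / real (Suc n)" for n
  proof -
    have k0: "0 < m n" using m[of n] by simp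
    have "1 / real (m n) \<le> 1 / real (Suc n)" using m[of n] by (intro divide_left_mono) auto
    then show ?thesis using floor_grid_le(1,3)[OF k0 s] by linarith
  qed
  have "\<forall>\<^sub>F n in sequentially. norm (real (cell (m n) s) / real (m n) - s) \<le> 1 / real (Suc n)"
    unfolding real_norm_def by (intro always_eventually allI bound)
  moreover have "(\<lambda>n. 1 / real (Suc n)) \<longlonglongrightarrow> 0"
    using LIMSEQ_inverse_real_of_nat by (simp add: inverse_eq_divide)
  ultimately have "(\<lambda>n. real (cell (m n) s) / real (m n) - s) \<longlonglongrightarrow> 0"
    by (rule Lim_null_comparison)
  then show ?thesis by (rule LIM_zero_cancel)
qed

lemma (in prob_space) small_in_prob_AE_tendsto_0:
  fixes Z :: "nat \<Rightarrow> 'a \<Rightarrow> ennreal"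
  assumes [measurable]: "\<And>n. Z n \<in> borel_measurable M" and lim: "AE \<omega> in M. (\<lambda>n. Z n \<omega>) \<longlonglongrightarrow> 0"
  shows "small_in_prob M Z"
  unfolding small_in_prob_def
proof (intro allI impI)
  fix \<epsilon> \<delta> :: real assume \<epsilon>: "0 < \<epsilon>" and \<delta>: "0 < \<delta>"
  define A where "A n = {\<omega>\<in>space M. ennreal \<epsilon> < Z n \<omega>}" for n
  have [measurable]: "A n \<in> sets M" for n unfolding A_def by measurable
  have "(\<lambda>n. expectation (indicator (A n))) \<longlonglongrightarrow> expectation (\<lambda>_. 0 :: real)"
  proof (rule integral_dominated_convergence[where w="\<lambda>_. 1"])
    show "AE \<omega> in M. (\<lambda>n. indicator (A n) \<omega> :: real) \<longlonglongrightarrow> 0"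
      using lim
    proof eventually_elim
      case (elim \<omega>)
      have "\<forall>\<^sub>F n in sequentially. Z n \<omega> < ennreal \<epsilon>" using elim \<epsilon> by (intro order_tendstoD(2)) auto
      then have "\<forall>\<^sub>F n in sequentially. (indicator (A n) \<omega> :: real) = 0"
        by eventually_elim (auto simp: A_def indicator_def)
      then show ?case by (rule tendsto_eventually)
    qed
  qed (auto simp: indicator_def)
  then have "(\<lambda>n. prob (A n)) \<longlonglongrightarrow> 0" by simp
  then have "\<forall>\<^sub>F n in sequentially. prob (A n) < \<delta>" using \<delta> by (rule order_tendstoD(2))
  then show "\<forall>\<^sub>F n in sequentially. \<exists>A\<in>events. prob A \<le> \<delta> \<and> {\<omega>\<in>space M. ennreal \<epsilon> < Z n \<omega>} \<subseteq> A"
    by eventually_elim (auto simp: A_def[symmetric] intro!: bexI[where x="A _"])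
qed

text \<open>The cap at 1 controls the exceptional event: outside it the integrand is at most
  \<open>a / 3\<close>, on it at most 1, and its probability is at most
  \<open>a / 3\<close>.\<close>

lemma (in prob_space) small_in_prob_expectation_tendsto_0:
  fixes d :: "nat \<Rightarrow> 'a \<Rightarrow> real"
  assumes [measurable]: "\<And>n. d n \<in> borel_measurable M" and nn: "\<And>n \<omega>. 0 \<le> d n \<omega>"
    and small: "small_in_prob M (\<lambda>n \<omega>. ennreal (d n \<omega>))"
  shows "(\<lambda>n. expectation (\<lambda>\<omega>. min 1 (d n \<omega>))) \<longlonglongrightarrow> 0"
proof (rule order_tendstoI)
  fix a :: real assume "a < 0"
  moreover have "0 \<le> expectation (\<lambda>\<omega>. min 1 (d n \<omega>))" for n by (intro integral_nonneg_AE) (simp add: nn)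
  ultimately show "\<forall>\<^sub>F n in sequentially. a < expectation (\<lambda>\<omega>. min 1 (d n \<omega>))"
    by (intro always_eventually allI) (meson less_le_trans)
next
  fix a :: real assume a: "0 < a"
  have "\<forall>\<^sub>F n in sequentially. \<exists>A\<in>sets M. measure M A \<le> a / 3 \<and> {\<omega>\<in>space M. ennreal (a / 3) < ennreal (d n \<omega>)} \<subseteq> A"
    by (rule small[unfolded small_in_prob_def, rule_format]) (use a in auto)
  then show "\<forall>\<^sub>F n in sequentially. expectation (\<lambda>\<omega>. min 1 (d n \<omega>)) < a"
  proof eventually_elim
    case (elim n)
    then obtain A where A[measurable]: "A \<in> sets M" and pA: "prob A \<le> a / 3"
      and sub: "{\<omega>\<in>space M. ennreal (a / 3) < ennreal (d n \<omega>)} \<subseteq> A" by blast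
    have "expectation (\<lambda>\<omega>. min 1 (d n \<omega>)) \<le> expectation (\<lambda>\<omega>. a / 3 + indicator A \<omega>)"
    proof (rule integral_mono)
      show "integrable M (\<lambda>\<omega>. min 1 (d n \<omega>))"
        by (rule integrable_const_bound[where B=1]) (auto simp: nn min_def)
      show "integrable M (\<lambda>\<omega>. a / 3 + indicator A \<omega>)"
        by (rule integrable_const_bound[where B="a / 3 + 1"]) (use a in \<open>auto simp: indicator_def\<close>)
      show "min 1 (d n \<omega>) \<le> a / 3 + indicator A \<omega>" if "\<omega> \<in> space M" for \<omega>
        using sub that a nn[of n \<omega>] by (cases "\<omega> \<in> A") (auto simp: ennreal_less_iff not_less)
    qed
    also have "\<dots> = a / 3 + prob A" using A by (subst Bochner_Integration.integral_add) (auto simp: prob_space emeasure_eq_measure)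
    finally show ?case using pA a by linarith
  qed
qed

lemma integral_left_rectangle_le:
  fixes q :: "real \<Rightarrow> 'b::banach"
  assumes "a \<le> b" "continuous_on {a..b} q" "\<And>r. r \<in> {a..b} \<Longrightarrow> norm (q r - q a) \<le> \<epsilon>"
  shows "norm (integral {a..b} q - (b - a) *\<^sub>R q a) \<le> \<epsilon> * (b - a)"
proof -
  have "integral {a..b} q - (b - a) *\<^sub>R q a = integral {a..b} (\<lambda>r. q r - q a)"
    using assms by (subst integral_diff) (auto intro!: integrable_continuous_interval)
  also have "norm \<dots> \<le> \<epsilon> * (b - a)"
    by (rule integral_bound) (use assms in \<open>auto intro!: continuous_intros\<close>)
  finally show ?thesis .
qed

text \<open>The last, partial cell is included so that the upper limit \<open>s\<close> need not be
  a grid point.\<close>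

definition left_riemann :: "(real \<Rightarrow> 'b::real_vector) \<Rightarrow> nat \<Rightarrow> real \<Rightarrow> 'b" where
  "left_riemann q m s = (\<Sum>j<cell m s. (1 / real m) *\<^sub>R q (real j / m)) + (s - cell m s / m) *\<^sub>R q (cell m s / m)"

lemma left_riemann_tendsto:
  fixes q :: "real \<Rightarrow> 'b::banach"
  assumes q: "continuous_on {0..s} q" and s: "0 \<le> s" and m: "\<And>n. n < m n"
  shows "(\<lambda>n. left_riemann q (m n) s) \<longlonglongrightarrow> integral {0..s} q"
proof (rule LIM_zero_cancel, rule tendstoI)
  fix e :: real assume e: "0 < e"
  define \<epsilon> where "\<epsilon> = e / (s + 1)"
  have \<epsilon>: "0 < \<epsilon>" "\<epsilon> * s < e" using e s by (auto simp: \<epsilon>_def field_simps)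
  have "uniformly_continuous_on {0..s} q" using q by (intro compact_uniformly_continuous) auto
  then obtain \<delta> where \<delta>: "\<delta> > 0" "\<And>r t. r \<in> {0..s} \<Longrightarrow> t \<in> {0..s} \<Longrightarrow> dist t r < \<delta> \<Longrightarrow> dist (q t) (q r) < \<epsilon>"
    unfolding uniformly_continuous_on_def using \<epsilon>(1) by metis
  have "(\<lambda>n. 1 / real (Suc n)) \<longlonglongrightarrow> 0" using LIMSEQ_inverse_real_of_nat by (simp add: inverse_eq_divide)
  then have "\<forall>\<^sub>F n in sequentially. 1 / real (Suc n) < \<delta>" using \<delta>(1) by (rule order_tendstoD)
  then show "\<forall>\<^sub>F n in sequentially. dist (left_riemann q (m n) s - integral {0..s} q) 0 < e"
  proof eventually_elim
    case (elim n)
    define k where "k = m n"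
    have k0: "0 < k" "0 < real k" using m[of n] by (auto simp: k_def)
    have "1 / real k \<le> 1 / real (Suc n)" using m[of n] by (intro divide_left_mono) (auto simp: k_def)
    then have k\<delta>: "1 / real k < \<delta>" using elim by linarith
    have piece: "norm (integral {a..b} q - (b - a) *\<^sub>R q a) \<le> \<epsilon> * (b - a)"
      if "0 \<le> a" "a \<le> b" "b \<le> s" "b - a \<le> 1 / k" for a b
    proof (rule integral_left_rectangle_le)
      show "continuous_on {a..b} q" using that by (intro continuous_on_subset[OF q]) auto
      show "norm (q r - q a) \<le> \<epsilon>" if "r \<in> {a..b}" for r
        using \<delta>(2)[of a r] that \<open>0 \<le> a\<close> \<open>b \<le> s\<close> \<open>b - a \<le> 1 / k\<close> k\<delta>
        by (auto simp: dist_norm intro!: less_imp_le)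
    qed (use that in auto)
    have comb: "integral {0..b} q = integral {0..a} q + integral {a..b} q" if "0 \<le> a" "a \<le> b" "b \<le> s" for a b
      by (rule Henstock_Kurzweil_Integration.integral_combine[symmetric]) (use that in \<open>auto intro!: integrable_continuous_interval continuous_on_subset[OF q]\<close>)
    have grid: "norm (integral {0..real i / k} q - (\<Sum>j<i. (1 / k) *\<^sub>R q (real j / k))) \<le> \<epsilon> * (real i / k)" if "real i / k \<le> s" for i
      using that
    proof (induction i)
      case (Suc i)
      have i: "real i / k \<le> real (Suc i) / k" using k0 by (simp add: divide_right_mono)
      have d: "real (Suc i) / k - real i / k = 1 / k" by (simp add: diff_divide_distrib[symmetric])
      have "norm (integral {0..real i / k} q - (\<Sum>j<i. (1 / k) *\<^sub>R q (real j / k))) \<le> \<epsilon> * (real i / k)"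
        using Suc i by simp
      moreover have "norm (integral {real i / k..real (Suc i) / k} q - (1 / k) *\<^sub>R q (real i / k)) \<le> \<epsilon> * (1 / k)"
        using piece[of "real i / k" "real (Suc i) / k"] i Suc.prems k0 unfolding d by simp
      ultimately have "norm ((integral {0..real i / k} q - (\<Sum>j<i. (1 / k) *\<^sub>R q (real j / k)))
          + (integral {real i / k..real (Suc i) / k} q - (1 / k) *\<^sub>R q (real i / k))) \<le> \<epsilon> * (real i / k) + \<epsilon> * (1 / k)"
        by (rule norm_triangle_mono)
      moreover have "\<epsilon> * (real i / k) + \<epsilon> * (1 / k) = \<epsilon> * (real (Suc i) / k)" by (simp add: add_divide_distrib distrib_left)
      ultimately show ?case using comb[of "real i / k" "real (Suc i) / k"] i Suc.prems k0 by (simp add: algebra_simps)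
    qed simp
    define i where "i = cell k s"
    have i: "real i / k \<le> s" "s - real i / k < 1 / k" using floor_grid_le[OF k0(1) s] by (auto simp: i_def)
    have "norm ((integral {0..real i / k} q - (\<Sum>j<i. (1 / k) *\<^sub>R q (real j / k)))
        + (integral {real i / k..s} q - (s - real i / k) *\<^sub>R q (real i / k))) \<le> \<epsilon> * (real i / k) + \<epsilon> * (s - real i / k)"
      using i k0 by (intro norm_triangle_mono grid piece) auto
    then have "norm (left_riemann q k s - integral {0..s} q) \<le> \<epsilon> * s"
      using comb[of "real i / k" s] i(1) k0
      by (subst norm_minus_commute) (simp add: left_riemann_def i_def[symmetric] algebra_simps)
    then show ?case using \<epsilon> by (simp add: k_def)
  qed
qed

text \<open>Turns a sum over grid steps into a time integral, so that dominated convergence in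
  \<open>s\<close> can be applied although the approximations converge only for almost every
  \<open>s\<close>.\<close>

lemma integral_step_grid:
  fixes p :: "nat \<Rightarrow> real"
  assumes m: "0 < m"
  shows "has_bochner_integral lborel (\<lambda>s. indicator {0..<real T} s * p (cell m s)) (\<Sum>j<T * m. p j / m)"
proof -
  have "has_bochner_integral lborel (\<lambda>s. \<Sum>j<T * m. indicator {real j / m..<real (Suc j) / m} s * p j)
     (\<Sum>j<T * m. measure lborel {real j / m..<real (Suc j) / m} * p j)"
  proof (intro has_bochner_integral_sum has_bochner_integral_mult_left)
    fix j
    have "real j / m \<le> real (Suc j) / m" using m by (intro divide_right_mono) auto
    then show "has_bochner_integral lborel (indicat_real {real j / m..<real (Suc j) / m})
         (measure lborel {real j / m..<real (Suc j) / m})"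
      by (intro has_bochner_integral_real_indicator) auto
  qed
  moreover have "measure lborel {real j / m..<real (Suc j) / m} * p j = p j / m" for j
  proof -
    have "real j / m \<le> real (Suc j) / m" using m by (intro divide_right_mono) auto
    then show ?thesis by (simp add: diff_divide_distrib[symmetric])
  qed
  moreover have "(\<Sum>j<T * m. indicator {real j / m..<real (Suc j) / m} s * p j)
     = indicator {0..<real T} s * p (cell m s)" for s
  proof -
    \<comment> \<open>The conjunct \<open>0 \<le> s\<close> matters: \<open>nat\<close> sends
      negative floors to 0, so negative \<open>s\<close> would otherwise be counted in cell
      0.\<close>
    have cell: "s \<in> {real j / m..<real (Suc j) / m} \<longleftrightarrow> 0 \<le> s \<and> cell m s = j" for j
    proof -
      have m0: "0 < real m" using m by simp
      have "s \<in> {real j / m..<real (Suc j) / m} \<longleftrightarrow> real j \<le> s * m \<and> s * m < real j + 1"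
        using m0 by (auto simp: pos_divide_le_eq pos_less_divide_eq ac_simps)
      also have "\<dots> \<longleftrightarrow> \<lfloor>s * real m\<rfloor> = int j"
        by (auto simp: floor_eq_iff)
      also have "\<dots> \<longleftrightarrow> 0 \<le> s \<and> cell m s = j"
      proof (cases "0 \<le> s")
        case True
        then have "0 \<le> \<lfloor>s * real m\<rfloor>" by simp
        then show ?thesis using True by auto
      next
        case False
        then have "s * real m < 0" using m0 by (simp add: mult_neg_pos)
        then have "\<lfloor>s * real m\<rfloor> \<noteq> int j" by linarith
        then show ?thesis using False by simp
      qed
      finally show ?thesis .
    qed
    have T: "s \<in> {0..<real T} \<longleftrightarrow> 0 \<le> s \<and> cell m s < T * m"
    proof -
      have "0 \<le> s \<Longrightarrow> cell m s < T * m \<longleftrightarrow> \<lfloor>s * real m\<rfloor> < int (T * m)" using m by (subst nat_less_iff) auto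
      moreover have "\<lfloor>s * real m\<rfloor> < int (T * m) \<longleftrightarrow> s < real T" using m by (simp add: floor_less_iff)
      ultimately show ?thesis by auto
    qed
    have "(\<Sum>j<T * m. indicator {real j / m..<real (Suc j) / m} s * p j)
       = (\<Sum>j<T * m. if cell m s = j then (if 0 \<le> s then p j else 0) else 0)"
    proof (intro sum.cong refl)
      show "indicator {real j / m..<real (Suc j) / m} s * p j
        = (if cell m s = j then (if 0 \<le> s then p j else 0) else 0)" for j
        using cell[of j] by (cases "s \<in> {real j / m..<real (Suc j) / m}") (simp_all only: indicator_simps, auto)
    qed
    also have "\<dots> = (if cell m s < T * m then (if 0 \<le> s then p (cell m s) else 0) else 0)"
      by (simp add: sum.delta)
    also have "\<dots> = indicator {0..<real T} s * p (cell m s)"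
      using T by (auto simp: indicator_def simp del: atLeastLessThan_iff)
    finally show ?thesis .
  qed
  ultimately show ?thesis by simp
qed

text \<open>Continuity in time makes the process a limit of processes frozen at the last grid point,
  which are jointly measurable because they consist of countably many pieces. \<open>max 0\<close>
  covers the negative times, where nothing is assumed.\<close>

lemma borel_measurable_continuous_process:
  fixes p :: "real \<Rightarrow> 'a \<Rightarrow> 'b::{second_countable_topology, metric_space}"
  assumes p: "\<And>t. 0 \<le> t \<Longrightarrow> p t \<in> borel_measurable M"
    and cont: "\<And>\<omega>. \<omega> \<in> space M \<Longrightarrow> continuous_on {0..} (\<lambda>t. p t \<omega>)"
  shows "(\<lambda>(\<omega>, t). p (max 0 t) \<omega>) \<in> borel_measurable (M \<Otimes>\<^sub>M lborel)"
proof -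
  define a where "a n z = p (real (cell (Suc n) (max 0 (snd z))) / Suc n) (fst z)" for n :: nat and z :: "'a \<times> real"
  show ?thesis
  proof (rule borel_measurable_LIMSEQ_metric)
    show "a n \<in> borel_measurable (M \<Otimes>\<^sub>M lborel)" for n
      unfolding a_def[abs_def]
    proof (rule measurable_compose_countable[of "\<lambda>i z. p (real i / Suc n) (fst z)"])
      show "(\<lambda>z. p (real i / Suc n) (fst z)) \<in> borel_measurable (M \<Otimes>\<^sub>M lborel)" for i
        by (rule measurable_compose[OF measurable_fst p]) simp
    qed measurable
    fix z assume "z \<in> space (M \<Otimes>\<^sub>M (lborel :: real measure))"
    then have "fst z \<in> space M" by (auto simp: space_pair_measure)
    then have c: "continuous_on {0..} (\<lambda>t. p t (fst z))" by (rule cont)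
    have "(\<lambda>n. real (cell (Suc n) (max 0 (snd z))) / Suc n) \<longlonglongrightarrow> max 0 (snd z)"
      by (rule floor_grid_tendsto[where m=Suc]) auto
    then have "(\<lambda>n. p (real (cell (Suc n) (max 0 (snd z))) / Suc n) (fst z)) \<longlonglongrightarrow> p (max 0 (snd z)) (fst z)"
      by (rule continuous_on_tendsto_compose[OF c]) simp_all
    then show "(\<lambda>n. a n z) \<longlonglongrightarrow> (case z of (\<omega>, t) \<Rightarrow> p (max 0 t) \<omega>)"
      by (simp add: a_def case_prod_beta)
  qed
qed

section \<open>Discretization along a solution\<close>

lemma continuous_on_UNIV_if_locally_lipschitz:
  assumes "locally_lipschitz p"
  shows "continuous_on UNIV p"
  unfolding continuous_on_eq_continuous_at[OF open_UNIV]
proof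
  fix z
  obtain r L where r: "r > 0" "L-lipschitz_on (cball z r) p"
    using assms unfolding locally_lipschitz_def by blast
  then have "continuous_on (ball z r) p"
    using lipschitz_on_continuous_on continuous_on_subset ball_subset_cball by metis
  then show "isCont p z" using r(1) by (simp add: continuous_on_eq_continuous_at)
qed

lemma bounded_image_sublevel:
  fixes V :: "'a::euclidean_space \<Rightarrow> real" and p :: "'a \<Rightarrow> 'b::real_normed_vector"
  assumes V: "continuous_on UNIV V" "bounded {z. V z \<le> r}" and p: "continuous_on UNIV p"
  obtains C where "0 \<le> C" "\<And>z. V z \<le> r \<Longrightarrow> norm (p z) \<le> C"
proof -
  have "closed {z. V z \<le> r}" using V(1) by (intro closed_Collect_le) auto
  then have "compact (p ` {z. V z \<le> r})"
    using V(2) by (intro compact_continuous_image continuous_on_subset[OF p]) (auto simp: compact_eq_bounded_closed)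
  then have "bounded (p ` {z. V z \<le> r})" by (rule compact_imp_bounded)
  then obtain C where "0 < C" "\<forall>y\<in>p ` {z. V z \<le> r}. norm y \<le> C" using bounded_pos by blast
  then show thesis by (intro that[of C]) auto
qed

lemma gen_L_alt:
  "gen_L f h \<Sigma> DV HV z t = DV z \<bullet> f z + 1/2 * trace (transpose (h z ** \<Sigma> t) ** HV z ** (h z ** \<Sigma> t))"
  by (simp add: gen_L_def matrix_transpose_mul matrix_mul_assoc)

text \<open>\<open>g\<close> stands for \<open>gamma_max \<gamma> \<Sigma> / c\<close>. The
  inequalities of \<open>exp_NSS\<close> are condensed into \<open>generator\<close>;
  \<open>coercive\<close> makes the closed sublevel sets of \<open>V\<close> compact, which bounds
  all coefficients up to a killing level.\<close>

locale lyapunov_sde = prob_space M for M :: "'a measure" +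
  fixes F :: "real \<Rightarrow> 'a measure" and w :: "real \<Rightarrow> 'a \<Rightarrow> real^'m"
    and f :: "real^'n \<Rightarrow> real^'n" and h :: "real^'n \<Rightarrow> real^'m^'n" and \<Sigma> :: "real \<Rightarrow> real^'m^'m"
    and x :: "real \<Rightarrow> 'a \<Rightarrow> real^'n"
    and V :: "real^'n \<Rightarrow> real" and DV :: "real^'n \<Rightarrow> real^'n" and HV :: "real^'n \<Rightarrow> real^'n^'n" and c g :: real
  assumes filtration: "filtration_of M F" and wiener: "wiener_process M F w"
    and f_cont: "continuous_on UNIV f" and h_cont: "continuous_on UNIV h"
    and \<Sigma>_meas: "\<Sigma> \<in> borel_measurable (restrict_space borel {0..})" and \<Sigma>_bounded: "bounded (\<Sigma> ` {0..})"
    and solution: "sde_solution M F w f h \<Sigma> x"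
    and C2: "C2_with V DV HV" and V_nonneg: "\<And>z. 0 \<le> V z" and coercive: "\<And>r. bounded {z. V z \<le> r}"
    and generator: "\<And>z t. 0 \<le> t \<Longrightarrow> gen_L f h \<Sigma> DV HV z t \<le> - c * (V z - g)"
    and c_pos: "0 < c" and g_nonneg: "0 \<le> g"
begin

lemma V_cont: "continuous_on UNIV V" by (rule C2_with_continuous(1)[OF C2])

lemma subalg: "0 \<le> t \<Longrightarrow> subalgebra M (F t)"
  using filtration by (auto simp: filtration_of_def subalgebra_def)

lemma subalg_mono: "0 \<le> s \<Longrightarrow> s \<le> t \<Longrightarrow> subalgebra (F t) (F s)"
  using filtration by (auto simp: filtration_of_def subalgebra_def)

lemma x_adapted: "0 \<le> t \<Longrightarrow> x t \<in> borel_measurable (F t)"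
  and x_path: "\<omega> \<in> space M \<Longrightarrow> continuous_on {0..} (\<lambda>t. x t \<omega>)"
  using solution by (auto simp: sde_solution_def)

lemma w_adapted: "0 \<le> t \<Longrightarrow> w t \<in> borel_measurable (F t)"
  and w_path: "\<omega> \<in> space M \<Longrightarrow> continuous_on {0..} (\<lambda>t. w t \<omega>)"
  using wiener by (auto simp: wiener_process_def)

lemma x_meas: "0 \<le> s \<Longrightarrow> s \<le> t \<Longrightarrow> x s \<in> borel_measurable (F t)"
  by (rule measurable_from_subalg[OF subalg_mono x_adapted])

lemma w_meas: "0 \<le> s \<Longrightarrow> s \<le> t \<Longrightarrow> w s \<in> borel_measurable (F t)"
  by (rule measurable_from_subalg[OF subalg_mono w_adapted])

lemma x_meas_M: "0 \<le> t \<Longrightarrow> x t \<in> borel_measurable M"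
  by (rule measurable_from_subalg[OF subalg x_adapted])

lemma w_meas_M: "0 \<le> t \<Longrightarrow> w t \<in> borel_measurable M"
  by (rule measurable_from_subalg[OF subalg w_adapted])

lemma f_borel [measurable]: "f \<in> borel_measurable borel" and h_borel [measurable]: "h \<in> borel_measurable borel"
  and V_borel [measurable]: "V \<in> borel_measurable borel"
  using f_cont h_cont V_cont by (auto intro: borel_measurable_continuous_onI)

definition rate :: "real \<Rightarrow> real^'n \<Rightarrow> real" where
  "rate K z = c * (V z - g) / (K + V z)"

lemma rate_le: "0 < K \<Longrightarrow> rate K z \<le> c"
  using c_pos g_nonneg V_nonneg[of z] by (simp add: rate_def pos_divide_le_eq add_pos_nonneg)

lemma rate_borel [measurable]: "rate K \<in> borel_measurable borel"
  unfolding rate_def[abs_def] by measurable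

lemma rate_cont: "0 < K \<Longrightarrow> continuous_on UNIV (rate K)"
  unfolding rate_def[abs_def] using V_nonneg
  by (intro continuous_intros V_cont) (metis add_pos_nonneg less_irrefl)

text \<open>The scheme evaluates \<open>u\<close> at its own position \<open>y\<close>, but the
  coefficients at the position \<open>z\<close> of the solution and with an approximation
  \<open>A\<close> of \<Sigma>. For \<open>y = z\<close> and \<open>A = \<Sigma> s\<close> the left
  side is at most 0; the moduli of \<open>u\<close>, \<open>Du\<close>, \<open>Hu\<close> and the
  quadratic dependence on \<open>A\<close> account for the rest.\<close>

lemma drift_le:
  assumes K: "0 < K" and u: "\<And>z. V z \<le> R \<Longrightarrow> u z = K + V z \<and> Du z = DV z \<and> Hu z = HV z"
    and uc: "uniformly_continuous_on UNIV u" "uniformly_continuous_on UNIV Du" "uniformly_continuous_on UNIV Hu"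
    and B: "\<And>z. \<bar>u z\<bar> \<le> B" "\<And>z. norm (Du z) \<le> B" "\<And>z. norm (Hu z) \<le> B"
    and CS: "\<And>t. 0 \<le> t \<Longrightarrow> norm (\<Sigma> t) \<le> CS" and \<eta>: "0 < \<eta>"
  shows "\<exists>D\<ge>0. \<forall>z y A s. V z \<le> R \<longrightarrow> norm A \<le> CS \<longrightarrow> 0 \<le> s \<longrightarrow>
     rate K z * u y + Du y \<bullet> f z + 1/2 * trace (transpose (h z ** A) ** Hu y ** (h z ** A))
       \<le> \<eta> + D * (min 1 (dist y z))\<^sup>2 + D * norm (A - \<Sigma> s)"
proof -
  obtain Cf where Cf: "0 \<le> Cf" "\<And>z. V z \<le> R \<Longrightarrow> norm (f z) \<le> Cf"
    using bounded_image_sublevel[OF V_cont coercive f_cont] by metis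
  obtain Ch where Ch: "0 \<le> Ch" "\<And>z. V z \<le> R \<Longrightarrow> norm (h z) \<le> Ch"
    using bounded_image_sublevel[OF V_cont coercive h_cont] by metis
  obtain Cr where Cr: "0 \<le> Cr" "\<And>z. V z \<le> R \<Longrightarrow> norm (rate K z) \<le> Cr"
    using bounded_image_sublevel[OF V_cont coercive rate_cont[OF K]] by metis
  have CS0: "0 \<le> CS" using CS[of 0] norm_ge_zero order_trans by blast
  have B0: "0 \<le> B" using B(1)[of 0] by linarith
  define m where "m = real CARD('m)"
  have m0: "0 \<le> m" by (simp add: m_def)
  define C\<xi> where "C\<xi> = Ch * CS"
  have C\<xi>0: "0 \<le> C\<xi>" using Ch CS0 by (simp add: C\<xi>_def)
  \<comment> \<open>Collects the factors that multiply \<eta>' when \<open>u\<close>,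
    \<open>Du\<close> and \<open>Hu\<close> are moved from \<open>y\<close> to \<open>z\<close>;
    dividing \<eta> by \<open>W + 1\<close> keeps the denominator positive.\<close>
  define W where "W = Cr + Cf + 1/2 * (m * C\<xi>\<^sup>2)"
  have W0: "0 \<le> W" using Cr Cf m0 by (simp add: W_def)
  define \<eta>' where "\<eta>' = \<eta> / (W + 1)"
  have \<eta>': "0 < \<eta>'" "\<eta>' * W \<le> \<eta>" using \<eta> W0 by (auto simp: \<eta>'_def field_simps)
  obtain D1 where D1: "D1 \<ge> 0" "\<And>y z. norm (u y - u z) \<le> \<eta>' + D1 * (min 1 (dist y z))\<^sup>2"
    using uniform_modulus[OF uc(1) _ \<eta>'(1), of B] B(1) by auto
  obtain D2 where D2: "D2 \<ge> 0" "\<And>y z. norm (Du y - Du z) \<le> \<eta>' + D2 * (min 1 (dist y z))\<^sup>2"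
    using uniform_modulus[OF uc(2) B(2) \<eta>'(1)] by auto
  obtain D3 where D3: "D3 \<ge> 0" "\<And>y z. norm (Hu y - Hu z) \<le> \<eta>' + D3 * (min 1 (dist y z))\<^sup>2"
    using uniform_modulus[OF uc(3) B(3) \<eta>'(1)] by auto
  define Dq where "Dq = Cr * D1 + D2 * Cf + 1/2 * (m * C\<xi>\<^sup>2 * D3)"
  define Da where "Da = m * (Ch * B * C\<xi>)"
  have D0: "0 \<le> Dq" "0 \<le> Da" using Cr Cf Ch D1 D2 D3 m0 B0 C\<xi>0 by (auto simp: Dq_def Da_def)
  have main: "rate K z * u y + Du y \<bullet> f z + 1/2 * trace (transpose (h z ** A) ** Hu y ** (h z ** A))
       \<le> \<eta> + Dq * (min 1 (dist y z))\<^sup>2 + Da * norm (A - \<Sigma> s)"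
    if z: "V z \<le> R" and A: "norm A \<le> CS" and s: "0 \<le> s" for z y A s
  proof -
    define q where "q = (min 1 (dist y z))\<^sup>2"
    have q0: "0 \<le> q" by (simp add: q_def)
    define \<xi> where "\<xi> = h z ** A"
    define \<zeta> where "\<zeta> = h z ** \<Sigma> s"
    have n\<xi>: "norm \<xi> \<le> C\<xi>" "norm \<zeta> \<le> C\<xi>"
      unfolding \<xi>_def \<zeta>_def C\<xi>_def
      using norm_matrix_mult_le[of "h z"] mult_mono[OF Ch(2)[OF z] A Ch(1) norm_ge_zero]
        mult_mono[OF Ch(2)[OF z] CS[OF s] Ch(1) norm_ge_zero] by (metis order_trans)+
    have n\<xi>\<zeta>: "norm (\<xi> - \<zeta>) \<le> Ch * norm (A - \<Sigma> s)"
    proof -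
      have "\<xi> - \<zeta> = h z ** (A - \<Sigma> s)"
        unfolding \<xi>_def \<zeta>_def by (simp add: bounded_bilinear.diff_right[OF bounded_bilinear_matrix_mult])
      then show ?thesis
        using norm_matrix_mult_le[of "h z" "A - \<Sigma> s"] mult_right_mono[OF Ch(2)[OF z] norm_ge_zero[of "A - \<Sigma> s"]] by simp
    qed
    note diffl = bounded_bilinear.diff_left[OF bounded_bilinear_matrix_mult]
      and diffr = bounded_bilinear.diff_right[OF bounded_bilinear_matrix_mult]
    have 1: "rate K z * (u y - u z) \<le> Cr * (\<eta>' + D1 * q)"
    proof -
      have "rate K z * (u y - u z) \<le> norm (rate K z) * norm (u y - u z)"
        by (metis abs_ge_self abs_mult real_norm_def)
      also have "\<dots> \<le> Cr * (\<eta>' + D1 * q)"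
        using Cr(2)[OF z] D1(2)[of y z] Cr(1) by (intro mult_mono) (auto simp: q_def)
      finally show ?thesis .
    qed
    have 2: "(Du y - Du z) \<bullet> f z \<le> (\<eta>' + D2 * q) * Cf"
    proof -
      have "(Du y - Du z) \<bullet> f z \<le> norm (Du y - Du z) * norm (f z)" by (rule norm_cauchy_schwarz)
      also have "\<dots> \<le> (\<eta>' + D2 * q) * Cf"
        using Cf(2)[OF z] D2 q0 \<eta>' by (intro mult_mono add_nonneg_nonneg) (auto simp: q_def)
      finally show ?thesis .
    qed
    have 3: "trace (transpose \<xi> ** Hu y ** \<xi>) - trace (transpose \<xi> ** Hu z ** \<xi>) \<le> m * C\<xi>\<^sup>2 * (\<eta>' + D3 * q)"
    proof -
      have "trace (transpose \<xi> ** Hu y ** \<xi>) - trace (transpose \<xi> ** Hu z ** \<xi>) = trace (transpose \<xi> ** (Hu y - Hu z) ** \<xi>)"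
        by (simp add: diffl diffr trace_sub)
      also have "\<dots> \<le> m * (norm \<xi> * norm (Hu y - Hu z) * norm \<xi>)"
        using abs_trace_congruence_le[of \<xi> "Hu y - Hu z" \<xi>] by (simp add: m_def)
      also have "\<dots> \<le> m * (C\<xi> * (\<eta>' + D3 * q) * C\<xi>)"
        using n\<xi>(1) D3 q0 \<eta>' C\<xi>0 m0 by (intro mult_left_mono mult_mono mult_nonneg_nonneg add_nonneg_nonneg) (auto simp: q_def)
      finally show ?thesis by (simp add: power2_eq_square ac_simps)
    qed
    \<comment> \<open>A quadratic expression in the diffusion matrix changes by two mixed products,
      each linear in \<open>A - \<Sigma> s\<close>.\<close>
    have 4: "trace (transpose \<xi> ** Hu z ** \<xi>) - trace (transpose \<zeta> ** Hu z ** \<zeta>) \<le> 2 * (Da * norm (A - \<Sigma> s))"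
    proof -
      have tr: "transpose (\<xi> - \<zeta>) = transpose \<xi> - transpose \<zeta>" by (simp add: transpose_def vec_eq_iff)
      have "trace (transpose \<xi> ** Hu z ** \<xi>) - trace (transpose \<zeta> ** Hu z ** \<zeta>)
        = trace (transpose (\<xi> - \<zeta>) ** Hu z ** \<xi>) + trace (transpose \<zeta> ** Hu z ** (\<xi> - \<zeta>))"
        by (simp add: diffl diffr trace_sub tr)
      also have "\<dots> \<le> m * (norm (\<xi> - \<zeta>) * norm (Hu z) * norm \<xi>) + m * (norm \<zeta> * norm (Hu z) * norm (\<xi> - \<zeta>))"
        using abs_trace_congruence_le[of "\<xi> - \<zeta>" "Hu z" \<xi>] abs_trace_congruence_le[of \<zeta> "Hu z" "\<xi> - \<zeta>"]
        unfolding m_def by linarith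
      also have "\<dots> \<le> m * ((Ch * norm (A - \<Sigma> s)) * B * C\<xi>) + m * (C\<xi> * B * (Ch * norm (A - \<Sigma> s)))"
        using n\<xi> n\<xi>\<zeta> B(3)[of z] m0 Ch(1) B0 C\<xi>0
        by (intro add_mono mult_left_mono mult_mono mult_nonneg_nonneg) auto
      finally show ?thesis by (simp add: Da_def algebra_simps)
    qed
    \<comment> \<open>The cancellation for which the rate was designed; \<open>0 < K\<close> and
      \<open>V_nonneg\<close> make the division by \<open>K + V z\<close> legitimate.\<close>
    have 5: "rate K z * u z + Du z \<bullet> f z + 1/2 * trace (transpose \<zeta> ** Hu z ** \<zeta>) \<le> 0"
    proof -
      have "rate K z * u z = c * (V z - g)"
        using u[OF z] K V_nonneg[of z] by (simp add: rate_def)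
      then show ?thesis
        using generator[OF s, of z] u[OF z] by (simp add: gen_L_alt \<zeta>_def)
    qed
    have eq1: "rate K z * (u y - u z) = rate K z * u y - rate K z * u z" by (simp add: right_diff_distrib)
    have eq2: "(Du y - Du z) \<bullet> f z = Du y \<bullet> f z - Du z \<bullet> f z" by (simp add: inner_diff_left)
    have "rate K z * u y + Du y \<bullet> f z + 1/2 * trace (transpose \<xi> ** Hu y ** \<xi>)
       \<le> Cr * (\<eta>' + D1 * q) + (\<eta>' + D2 * q) * Cf + 1/2 * (m * C\<xi>\<^sup>2 * (\<eta>' + D3 * q)) + Da * norm (A - \<Sigma> s)"
      using 1 2 3 4 5 unfolding eq1 eq2 by linarith
    also have "\<dots> = \<eta>' * W + Dq * q + Da * norm (A - \<Sigma> s)"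
      by (simp add: W_def Dq_def algebra_simps)
    finally show ?thesis using \<eta>'(2) by (simp add: \<xi>_def q_def)
  qed
  show ?thesis
  proof (intro exI[of _ "Dq + Da"] conjI allI impI)
    fix z y :: "real^'n" and A :: "real^'m^'m" and s :: real
    assume *: "V z \<le> R" "norm A \<le> CS" "0 \<le> s"
    have "Dq * (min 1 (dist y z))\<^sup>2 \<le> (Dq + Da) * (min 1 (dist y z))\<^sup>2"
      "Da * norm (A - \<Sigma> s) \<le> (Dq + Da) * norm (A - \<Sigma> s)"
      using D0 by (auto intro!: mult_right_mono)
    then show "rate K z * u y + Du y \<bullet> f z + 1/2 * trace (transpose (h z ** A) ** Hu y ** (h z ** A))
       \<le> \<eta> + (Dq + Da) * (min 1 (dist y z))\<^sup>2 + (Dq + Da) * norm (A - \<Sigma> s)"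
      using main[OF *, of y] by linarith
  qed (use D0 in auto)
qed

text \<open>The coefficients are evaluated along the solution \<open>x\<close>, not along the scheme. The martingale part is
  then an elementary integral as in the definition of \<open>ito_integral\<close>, and no Gronwall estimate is needed.\<close>

definition euler :: "nat \<Rightarrow> (nat \<Rightarrow> real^'m^'m) \<Rightarrow> nat \<Rightarrow> 'a \<Rightarrow> real^'n" where
  "euler m G i \<omega> = x 0 \<omega> + (\<Sum>j<i. (1 / real m) *\<^sub>R f (x (real j / m) \<omega>)
     + (h (x (real j / m) \<omega>) ** G j) *v (w (real (Suc j) / m) \<omega> - w (real j / m) \<omega>))"

lemma euler_meas:
  assumes "real i / m \<le> t"
  shows "euler m G i \<in> borel_measurable (F t)"
proof -
  have [measurable]: "x 0 \<in> borel_measurable (F t)"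
    using assms by (intro x_meas) (auto intro: order_trans[of _ "real i / m"])
  have grid: "real j / m \<le> t" if "j \<le> i" for j
    using that assms by (intro order_trans[OF _ assms] divide_right_mono) auto
  have summand: "(\<lambda>\<omega>. (1 / real m) *\<^sub>R f (x (real j / m) \<omega>)
     + (h (x (real j / m) \<omega>) ** G j) *v (w (real (Suc j) / m) \<omega> - w (real j / m) \<omega>)) \<in> borel_measurable (F t)"
    if "j < i" for j
  proof -
    have [measurable]: "x (real j / m) \<in> borel_measurable (F t)" "w (real j / m) \<in> borel_measurable (F t)"
      "w (real (Suc j) / m) \<in> borel_measurable (F t)"
      using that by (auto intro!: x_meas w_meas grid simp del: of_nat_Suc)
    show ?thesis by measurable
  qed
  show ?thesis
    unfolding euler_def[abs_def]
    by (intro borel_measurable_add borel_measurable_sum summand) auto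
qed

text \<open>An irrational \<open>s\<close> is never a grid point, so the grid points below \<open>s\<close> together with \<open>s\<close> form an
  admissible partition of \<open>[0, s]\<close>.\<close>

lemma euler_tendsto:
  fixes m :: "nat \<Rightarrow> nat"
  assumes m: "\<And>n. n < m n" and GC: "\<And>n i. norm (G n i) \<le> CS" and CS: "\<And>t. 0 \<le> t \<Longrightarrow> norm (\<Sigma> t) \<le> CS"
    and G: "AE r in lborel. r \<in> {0..T} \<longrightarrow> (\<lambda>n. G n (cell (m n) r)) \<longlonglongrightarrow> \<Sigma> r"
    and s: "0 < s" "s \<le> T" "s \<notin> \<rat>"
  shows "(\<lambda>n. expectation (\<lambda>\<omega>. min 1 (dist (euler (m n) (G n) (cell (m n) s) \<omega>)
     (x (real (cell (m n) s) / m n) \<omega>)))) \<longlonglongrightarrow> 0"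
proof -
  obtain I where I: "ito_integral M F w (\<lambda>s \<omega>. h (x s \<omega>) ** \<Sigma> s) I"
    and xI: "AE \<omega> in M. x s \<omega> = x 0 \<omega> + integral {0..s} (\<lambda>r. f (x r \<omega>)) + I s \<omega>"
    using solution s(1) unfolding sde_solution_def by (meson less_imp_le)
  define i where "i n = cell (m n) s" for n
  let ?t = "\<lambda>n. real (i n) / m n"
  have m0: "0 < m n" for n using m[of n] by simp
  have i_lt: "?t n < s" for n
  proof -
    have "?t n \<le> s" using floor_grid_le(1)[OF m0[of n], of s] s by (simp add: i_def)
    moreover have "?t n \<noteq> s" using s(3) by auto
    ultimately show ?thesis by simp
  qed
  have i_gt: "s < real (Suc (i n)) / m n" for n
    using floor_grid_le(2)[OF m0[of n], of s] s by (simp add: i_def add.commute)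
  have i_tendsto: "(\<lambda>n. ?t n) \<longlonglongrightarrow> s"
    unfolding i_def using m s by (intro floor_grid_tendsto) auto
  define \<tau> where "\<tau> n j = (if j \<le> i n then real j / m n else s)" for n j
  define \<xi> where "\<xi> n j \<omega> = h (x (real j / m n) \<omega>) ** G n j" for n j \<omega>
  have \<xi>_meas: "\<xi> n j \<in> borel_measurable (F (real j / m n))" for n j
  proof -
    have [measurable]: "x (real j / m n) \<in> borel_measurable (F (real j / m n))" by (intro x_adapted) simp
    show ?thesis unfolding \<xi>_def[abs_def] by measurable
  qed
  have part: "adapted_partition F s (Suc (i n)) (\<tau> n) (\<xi> n)" for n
    unfolding adapted_partition_def
  proof (intro conjI allI impI)
    fix j assume j: "j < Suc (i n)"
    show "\<tau> n j < \<tau> n (Suc j)"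
      using j i_lt[of n] m0[of n] by (cases "j = i n") (auto simp: \<tau>_def divide_strict_right_mono)
    show "\<xi> n j \<in> borel_measurable (F (\<tau> n j))"
      using j \<xi>_meas[of n j] by (simp add: \<tau>_def)
  qed (auto simp: \<tau>_def)
  \<comment> \<open>Below \<open>s\<close> the last interval of the partition, cut off at
    \<open>s\<close>, carries the same coefficient as its full grid cell, so the step process
    depends only on the cell of \<open>r\<close>.\<close>
  have step: "step_proc (Suc (i n)) (\<tau> n) (\<xi> n) r \<omega> = \<xi> n (cell (m n) r) \<omega>" if r: "0 \<le> r" "r < s" for n r \<omega>
  proof -
    define k where "k = cell (m n) r"
    have k: "real k / m n \<le> r" "r < real (Suc k) / m n"
      using floor_grid_le[OF m0[of n] r(1)] by (auto simp: k_def add.commute)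
    have ki: "k \<le> i n"
      unfolding k_def i_def using r m0[of n] by (intro nat_mono floor_mono mult_right_mono) auto
    have grid: "real a / m n < real b / m n \<longleftrightarrow> a < b" for a b using m0[of n] by (simp add: divide_less_cancel)
    have "(indicator {\<tau> n j..<\<tau> n (Suc j)} r :: real) = (if j = k then 1 else 0)" if j: "j < Suc (i n)" for j
    proof -
      have "r \<in> {\<tau> n j..<\<tau> n (Suc j)} \<longleftrightarrow> j = k"
      proof
        assume rj: "r \<in> {\<tau> n j..<\<tau> n (Suc j)}"
        then have "real j / m n < real (Suc k) / m n" using j k(2) by (auto simp: \<tau>_def)
        then have "j < Suc k" using grid[of j "Suc k"] by blast
        then have jk: "j \<le> k" by simp
        show "j = k"
        proof (cases "Suc j \<le> i n")
          case True
          then have "real k / m n < real (Suc j) / m n" using rj k(1) by (auto simp: \<tau>_def)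
          then have "k < Suc j" using grid[of k "Suc j"] by blast
          then show ?thesis using jk by simp
        next
          case False
          then show ?thesis using j jk ki by simp
        qed
      next
        assume "j = k"
        then show "r \<in> {\<tau> n j..<\<tau> n (Suc j)}" using k r(2) ki by (auto simp: \<tau>_def)
      qed
      then show ?thesis by (simp add: indicator_def)
    qed
    then have "step_proc (Suc (i n)) (\<tau> n) (\<xi> n) r \<omega> = (\<Sum>j<Suc (i n). (if j = k then 1 else 0) *\<^sub>R \<xi> n j \<omega>)"
      unfolding step_proc_def by (intro sum.cong) auto
    also have "\<dots> = (\<Sum>j<Suc (i n). if j = k then \<xi> n j \<omega> else 0)" by (intro sum.cong) auto
    also have "\<dots> = \<xi> n k \<omega>" using ki by (simp add: sum.delta)
    finally show ?thesis by (simp add: k_def)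
  qed
  \<comment> \<open>\<Sigma> is measurable only on nonnegative times; extension by zero makes it
    Borel on the line.\<close>
  define S' where "S' r = indicator {0..} r *\<^sub>R \<Sigma> r" for r
  have [measurable]: "S' \<in> borel_measurable borel"
    using \<Sigma>_meas unfolding S'_def[abs_def] by (subst (asm) borel_measurable_restrict_space_iff) auto
  define Z where "Z n \<omega> = (\<integral>\<^sup>+ r\<in>{0..s}. ennreal ((norm (step_proc (Suc (i n)) (\<tau> n) (\<xi> n) r \<omega> - h (x r \<omega>) ** \<Sigma> r))\<^sup>2) \<partial>lborel)" for n \<omega>
  \<comment> \<open>A jointly measurable version of the integrand: times are clipped by
    \<open>max 0\<close>, and the endpoint \<open>s\<close> is removed as a null set, since the
    half-open step process vanishes there.\<close>
  define q where "q n \<omega> r = ennreal ((norm (step_proc (Suc (i n)) (\<tau> n) (\<xi> n) r \<omega> - h (x (max 0 r) \<omega>) ** S' r))\<^sup>2) * indicator {0..<s} r" for n \<omega> r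
  have Zq: "Z n \<omega> = (\<integral>\<^sup>+ r. q n \<omega> r \<partial>lborel)" for n \<omega>
    unfolding Z_def
  proof (rule nn_integral_cong_AE)
    show "AE r in lborel. ennreal ((norm (step_proc (Suc (i n)) (\<tau> n) (\<xi> n) r \<omega> - h (x r \<omega>) ** \<Sigma> r))\<^sup>2) * indicator {0..s} r = q n \<omega> r"
      using AE_lborel_singleton[of s]
      by eventually_elim (auto simp: q_def S'_def indicator_def max_def)
  qed
  have xjoint: "(\<lambda>z. x (max 0 (snd z)) (fst z)) \<in> borel_measurable (M \<Otimes>\<^sub>M lborel)"
    using borel_measurable_continuous_process[of x M, OF x_meas_M x_path] by (simp add: case_prod_beta')
  have stepjoint: "(\<lambda>z. step_proc (Suc (i n)) (\<tau> n) (\<xi> n) (snd z) (fst z)) \<in> borel_measurable (M \<Otimes>\<^sub>M (lborel :: real measure))" for n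
  proof -
    have [measurable]: "\<xi> n j \<in> borel_measurable M" for j
      by (rule measurable_from_subalg[OF subalg \<xi>_meas]) simp
    show ?thesis unfolding step_proc_def by measurable
  qed
  have qjoint: "(\<lambda>z. q n (fst z) (snd z)) \<in> borel_measurable (M \<Otimes>\<^sub>M lborel)" for n
    unfolding q_def using xjoint stepjoint by measurable
  have Z_meas: "Z n \<in> borel_measurable M" for n
    unfolding Zq[abs_def] using qjoint[of n]
    by (intro lborel.borel_measurable_nn_integral) (simp add: case_prod_beta')
  have "small_in_prob M Z"
  proof (rule small_in_prob_AE_tendsto_0[OF Z_meas], rule AE_I2)
    fix \<omega> assume \<omega>: "\<omega> \<in> space M"
    have hx: "continuous_on {0..} (\<lambda>t. h (x t \<omega>))"
      by (rule continuous_on_compose2[OF h_cont x_path[OF \<omega>]]) auto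
    have "bounded ((\<lambda>t. h (x t \<omega>)) ` {0..s})"
      by (intro compact_imp_bounded compact_continuous_image continuous_on_subset[OF hx]) auto
    then obtain Ch where Ch: "0 < Ch" "\<And>t. t \<in> {0..s} \<Longrightarrow> norm (h (x t \<omega>)) \<le> Ch"
      unfolding bounded_pos by auto
    have CS0: "0 \<le> CS" using GC norm_ge_zero order_trans by blast
    have "(\<lambda>n. \<integral>\<^sup>+ r. q n \<omega> r \<partial>lborel) \<longlonglongrightarrow> (\<integral>\<^sup>+ (r :: real). 0 \<partial>lborel)"
    proof (rule nn_integral_dominated_convergence[where w="\<lambda>r. ennreal ((2 * (Ch * CS))\<^sup>2) * indicator {0..s} r"])
      show "q n \<omega> \<in> borel_measurable lborel" for n
        using measurable_compose[OF measurable_Pair1'[OF \<omega>] qjoint[of n]] by simp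
      have "q n \<omega> r \<le> ennreal ((2 * (Ch * CS))\<^sup>2) * indicator {0..s} r" for n r
      proof (cases "r \<in> {0..<s}")
        case True
        define t where "t = real (cell (m n) r) / m n"
        have t: "0 \<le> t" "t \<le> r" using floor_grid_le(1)[OF m0[of n], of r] True by (auto simp: t_def)
        have "norm (\<xi> n (cell (m n) r) \<omega>) \<le> Ch * CS"
          unfolding \<xi>_def t_def[symmetric]
          using norm_matrix_mult_le[of "h (x t \<omega>)"] mult_mono[OF Ch(2)[of t] GC] t True Ch(1) by (force intro: order_trans)
        moreover have "norm (h (x r \<omega>) ** \<Sigma> r) \<le> Ch * CS"
          using norm_matrix_mult_le[of "h (x r \<omega>)"] mult_mono[OF Ch(2)[of r] CS[of r]] True Ch(1) by (force intro: order_trans)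
        ultimately have "norm (\<xi> n (cell (m n) r) \<omega> - h (x r \<omega>) ** \<Sigma> r) \<le> 2 * (Ch * CS)"
          by (intro order_trans[OF norm_triangle_ineq4]) simp
        then have "(norm (\<xi> n (cell (m n) r) \<omega> - h (x r \<omega>) ** \<Sigma> r))\<^sup>2 \<le> (2 * (Ch * CS))\<^sup>2"
          by (intro power_mono) auto
        then show ?thesis using True step[of r n \<omega>] by (simp add: q_def S'_def max_def ennreal_leI)
      qed (simp add: q_def)
      then show "AE r in lborel. q n \<omega> r \<le> ennreal ((2 * (Ch * CS))\<^sup>2) * indicator {0..s} r" for n by simp
      show "(\<integral>\<^sup>+ r. ennreal ((2 * (Ch * CS))\<^sup>2) * indicator {0..s} r \<partial>lborel) < \<infinity>"
        using s by (simp add: nn_integral_cmult_indicator ennreal_mult_less_top)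
      show "AE r in lborel. (\<lambda>n. q n \<omega> r) \<longlonglongrightarrow> 0"
        using G
      proof eventually_elim
        case (elim r)
        show ?case
        proof (cases "r \<in> {0..<s}")
          case True
          have "(\<lambda>n. h (x (real (cell (m n) r) / m n) \<omega>)) \<longlonglongrightarrow> h (x r \<omega>)"
            using True by (intro continuous_on_tendsto_compose[OF hx floor_grid_tendsto] m) auto
          moreover have "(\<lambda>n. G n (cell (m n) r)) \<longlonglongrightarrow> \<Sigma> r" using elim True s by simp
          ultimately have "(\<lambda>n. \<xi> n (cell (m n) r) \<omega>) \<longlonglongrightarrow> h (x r \<omega>) ** \<Sigma> r"
            unfolding \<xi>_def by (rule bounded_bilinear.tendsto[OF bounded_bilinear_matrix_mult])
          then have "(\<lambda>n. (norm (\<xi> n (cell (m n) r) \<omega> - h (x r \<omega>) ** \<Sigma> r))\<^sup>2) \<longlonglongrightarrow> (norm (h (x r \<omega>) ** \<Sigma> r - h (x r \<omega>) ** \<Sigma> r))\<^sup>2"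
            by (intro tendsto_intros)
          then have "(\<lambda>n. ennreal ((norm (\<xi> n (cell (m n) r) \<omega> - h (x r \<omega>) ** \<Sigma> r))\<^sup>2)) \<longlonglongrightarrow> ennreal 0"
            by (intro tendsto_ennrealI) simp
          then show ?thesis using True step[of r _ \<omega>] by (simp add: q_def S'_def max_def)
        qed (simp add: q_def)
      qed
    qed auto
    then show "(\<lambda>n. Z n \<omega>) \<longlonglongrightarrow> 0" by (simp add: Zq)
  qed
  then have small: "small_in_prob M (\<lambda>n \<omega>. ennreal (dist (elem_integral w (Suc (i n)) (\<tau> n) (\<xi> n) \<omega>) (I s \<omega>)))"
    using I part s(1) unfolding ito_integral_def Z_def[abs_def] by (meson less_imp_le)
  have [measurable]: "I s \<in> borel_measurable M"
    by (rule measurable_from_subalg[OF subalg[of s]]) (use I s(1) in \<open>auto simp: ito_integral_def\<close>)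
  define e where "e n \<omega> = elem_integral w (Suc (i n)) (\<tau> n) (\<xi> n) \<omega>" for n \<omega>
  have [measurable]: "e n \<in> borel_measurable M" for n
  proof -
    have \<tau>0: "0 \<le> \<tau> n j" for j using s by (simp add: \<tau>_def)
    have [measurable]: "\<xi> n j \<in> borel_measurable M" "w (\<tau> n j) \<in> borel_measurable M" for j
      by (rule measurable_from_subalg[OF subalg \<xi>_meas], simp, rule w_meas_M[OF \<tau>0])
    show ?thesis unfolding e_def[abs_def] elem_integral_def by measurable
  qed
  have e1: "(\<lambda>n. expectation (\<lambda>\<omega>. min 1 (dist (e n \<omega>) (I s \<omega>)))) \<longlonglongrightarrow> 0"
    by (rule small_in_prob_expectation_tendsto_0[OF _ _ small[folded e_def]]) auto
  define X where "X n \<omega> = euler (m n) (G n) (i n) \<omega>" for n \<omega>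
  define y where "y n \<omega> = x (?t n) \<omega>" for n \<omega>
  have [measurable]: "X n \<in> borel_measurable M" "y n \<in> borel_measurable M" for n
  proof -
    have "euler (m n) (G n) (i n) \<in> borel_measurable (F s)" using i_lt[of n] by (intro euler_meas) simp
    then show "X n \<in> borel_measurable M"
      unfolding X_def[abs_def] using s by (intro measurable_from_subalg[OF subalg[of s]]) auto
    show "y n \<in> borel_measurable M" unfolding y_def[abs_def] by (intro x_meas_M) simp
  qed
  \<comment> \<open>The part of the error that vanishes path by path. Subtracting the error
    \<open>e n - I s\<close> of the elementary integral leaves a Riemann-sum error and contributions
    of continuous paths between the last grid point and \<open>s\<close>.\<close>
  define b where "b n \<omega> = (X n \<omega> - y n \<omega>) - (e n \<omega> - I s \<omega>)" for n \<omega>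
  have [measurable]: "b n \<in> borel_measurable M" for n unfolding b_def[abs_def] by measurable
  have b_lim: "AE \<omega> in M. (\<lambda>n. b n \<omega>) \<longlonglongrightarrow> 0"
    using xI AE_space
  proof eventually_elim
    case (elim \<omega>)
    note xc = x_path[OF elim(2)] and wc = w_path[OF elim(2)]
    have fx: "continuous_on {0..} (\<lambda>t. f (x t \<omega>))" by (rule continuous_on_compose2[OF f_cont xc]) auto
    have hx: "continuous_on {0..} (\<lambda>t. h (x t \<omega>))" by (rule continuous_on_compose2[OF h_cont xc]) auto
    have grid: "(\<lambda>n. p (?t n)) \<longlonglongrightarrow> p s" if "continuous_on {0..} p" for p :: "real \<Rightarrow> 'b::topological_space"
      using s by (intro continuous_on_tendsto_compose[OF that i_tendsto]) auto
    have beq: "b n \<omega> = (left_riemann (\<lambda>r. f (x r \<omega>)) (m n) s - (s - ?t n) *\<^sub>R f (x (?t n) \<omega>)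
        - integral {0..s} (\<lambda>r. f (x r \<omega>)))
        - (h (x (?t n) \<omega>) ** G n (i n)) *v (w s \<omega> - w (?t n) \<omega>)
        + (x s \<omega> - x (?t n) \<omega>)" for n
    proof -
      have "e n \<omega> = (\<Sum>j<i n. \<xi> n j \<omega> *v (w (real (Suc j) / m n) \<omega> - w (real j / m n) \<omega>))
         + \<xi> n (i n) \<omega> *v (w s \<omega> - w (?t n) \<omega>)"
        unfolding e_def elem_integral_def sum.lessThan_Suc
        by (intro arg_cong2[where f="(+)"] sum.cong) (auto simp: \<tau>_def)
      moreover have "X n \<omega> = x 0 \<omega> + (\<Sum>j<i n. (1 / real (m n)) *\<^sub>R f (x (real j / m n) \<omega>))
         + (\<Sum>j<i n. \<xi> n j \<omega> *v (w (real (Suc j) / m n) \<omega> - w (real j / m n) \<omega>))"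
        unfolding X_def euler_def sum.distrib \<xi>_def by (simp add: add.assoc)
      moreover have "left_riemann (\<lambda>r. f (x r \<omega>)) (m n) s = (\<Sum>j<i n. (1 / real (m n)) *\<^sub>R f (x (real j / m n) \<omega>))
          + (s - ?t n) *\<^sub>R f (x (?t n) \<omega>)"
        by (simp add: left_riemann_def i_def)
      moreover have "I s \<omega> = x s \<omega> - x 0 \<omega> - integral {0..s} (\<lambda>r. f (x r \<omega>))" using elim(1) by simp
      ultimately show ?thesis by (simp add: b_def y_def \<xi>_def)
    qed
    have l1: "(\<lambda>n. left_riemann (\<lambda>r. f (x r \<omega>)) (m n) s) \<longlonglongrightarrow> integral {0..s} (\<lambda>r. f (x r \<omega>))"
      using s by (intro left_riemann_tendsto continuous_on_subset[OF fx] m) auto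
    have l2: "(\<lambda>n. (s - ?t n) *\<^sub>R f (x (?t n) \<omega>)) \<longlonglongrightarrow> (s - s) *\<^sub>R f (x s \<omega>)"
      by (intro tendsto_intros i_tendsto grid[OF fx])
    have l4: "(\<lambda>n. x s \<omega> - x (?t n) \<omega>) \<longlonglongrightarrow> x s \<omega> - x s \<omega>"
      by (intro tendsto_intros grid[OF xc])
    \<comment> \<open>\<open>G n (i n)\<close> need not converge at this particular
      \<open>s\<close>; its bound \<open>CS\<close> and the continuity of \<open>w\<close> are
      enough.\<close>
    have l3: "(\<lambda>n. (h (x (?t n) \<omega>) ** G n (i n)) *v (w s \<omega> - w (?t n) \<omega>)) \<longlonglongrightarrow> 0"
    proof (rule Lim_null_comparison)
      show "\<forall>\<^sub>F n in sequentially. norm ((h (x (?t n) \<omega>) ** G n (i n)) *v (w s \<omega> - w (?t n) \<omega>))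
         \<le> (norm (h (x (?t n) \<omega>)) * CS) * norm (w s \<omega> - w (?t n) \<omega>)"
      proof (intro always_eventually allI)
        fix n
        let ?H = "h (x (?t n) \<omega>)" and ?v = "w s \<omega> - w (?t n) \<omega>"
        have "norm ((?H ** G n (i n)) *v ?v) \<le> norm (?H ** G n (i n)) * norm ?v" by (rule norm_matrix_vector_mult_le)
        also have "\<dots> \<le> (norm ?H * CS) * norm ?v"
          using norm_matrix_mult_le[of ?H "G n (i n)"] mult_left_mono[OF GC[of n "i n"] norm_ge_zero[of ?H]]
          by (intro mult_right_mono) auto
        finally show "norm ((?H ** G n (i n)) *v ?v) \<le> (norm ?H * CS) * norm ?v" .
      qed
      have "(\<lambda>n. (norm (h (x (?t n) \<omega>)) * CS) * norm (w s \<omega> - w (?t n) \<omega>))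
         \<longlonglongrightarrow> (norm (h (x s \<omega>)) * CS) * norm (w s \<omega> - w s \<omega>)"
        by (intro tendsto_intros grid[OF hx] grid[OF wc])
      then show "(\<lambda>n. (norm (h (x (?t n) \<omega>)) * CS) * norm (w s \<omega> - w (?t n) \<omega>)) \<longlonglongrightarrow> 0" by simp
    qed
    have "(\<lambda>n. b n \<omega>) \<longlonglongrightarrow> (integral {0..s} (\<lambda>r. f (x r \<omega>)) - (s - s) *\<^sub>R f (x s \<omega>) - integral {0..s} (\<lambda>r. f (x r \<omega>)))
        - 0 + (x s \<omega> - x s \<omega>)"
      unfolding beq by (intro tendsto_intros l1 l2 l3 l4)
    then show ?case by simp
  qed
  have "(\<lambda>n. expectation (\<lambda>\<omega>. min 1 (norm (b n \<omega>)))) \<longlonglongrightarrow> expectation (\<lambda>_. 0 :: real)"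
  proof (rule integral_dominated_convergence[where w="\<lambda>_. 1"])
    show "AE \<omega> in M. (\<lambda>n. min 1 (norm (b n \<omega>))) \<longlonglongrightarrow> 0"
      using b_lim
    proof eventually_elim
      case (elim \<omega>)
      have "(\<lambda>n. min 1 (norm (b n \<omega>))) \<longlonglongrightarrow> min 1 (norm (0 :: real^'n))" by (intro tendsto_intros elim)
      then show ?case by simp
    qed
  qed auto
  then have e2: "(\<lambda>n. expectation (\<lambda>\<omega>. min 1 (norm (b n \<omega>)))) \<longlonglongrightarrow> 0" by simp
  have min_int: "integrable M (\<lambda>\<omega>. min 1 (norm (p \<omega>)))" if [measurable]: "p \<in> borel_measurable M" for p :: "'a \<Rightarrow> real^'n"
    by (rule integrable_const_bound[where B=1]) auto
  have bound: "expectation (\<lambda>\<omega>. min 1 (dist (X n \<omega>) (y n \<omega>)))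
     \<le> expectation (\<lambda>\<omega>. min 1 (dist (e n \<omega>) (I s \<omega>))) + expectation (\<lambda>\<omega>. min 1 (norm (b n \<omega>)))" for n
  proof -
    have "expectation (\<lambda>\<omega>. min 1 (dist (X n \<omega>) (y n \<omega>)))
      \<le> expectation (\<lambda>\<omega>. min 1 (dist (e n \<omega>) (I s \<omega>)) + min 1 (norm (b n \<omega>)))"
    proof (rule integral_mono)
      show "integrable M (\<lambda>\<omega>. min 1 (dist (X n \<omega>) (y n \<omega>)))"
        "integrable M (\<lambda>\<omega>. min 1 (dist (e n \<omega>) (I s \<omega>)) + min 1 (norm (b n \<omega>)))"
        unfolding dist_norm by (intro Bochner_Integration.integrable_add min_int; measurable)+
      fix \<omega>
      have "X n \<omega> - y n \<omega> = (e n \<omega> - I s \<omega>) + b n \<omega>" by (simp add: b_def)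
      then have "dist (X n \<omega>) (y n \<omega>) \<le> dist (e n \<omega>) (I s \<omega>) + norm (b n \<omega>)"
        unfolding dist_norm by (metis norm_triangle_ineq)
      then show "min 1 (dist (X n \<omega>) (y n \<omega>)) \<le> min 1 (dist (e n \<omega>) (I s \<omega>)) + min 1 (norm (b n \<omega>))"
        using zero_le_dist[of "e n \<omega>" "I s \<omega>"] norm_ge_zero[of "b n \<omega>"] by linarith
    qed
    also have "\<dots> = expectation (\<lambda>\<omega>. min 1 (dist (e n \<omega>) (I s \<omega>))) + expectation (\<lambda>\<omega>. min 1 (norm (b n \<omega>)))"
      unfolding dist_norm by (intro Bochner_Integration.integral_add min_int; measurable)
    finally show ?thesis .
  qed
  have "(\<lambda>n. expectation (\<lambda>\<omega>. min 1 (dist (X n \<omega>) (y n \<omega>)))) \<longlonglongrightarrow> 0"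
  proof (rule Lim_null_comparison)
    show "\<forall>\<^sub>F n in sequentially. norm (expectation (\<lambda>\<omega>. min 1 (dist (X n \<omega>) (y n \<omega>))))
      \<le> expectation (\<lambda>\<omega>. min 1 (dist (e n \<omega>) (I s \<omega>))) + expectation (\<lambda>\<omega>. min 1 (norm (b n \<omega>)))"
      using bound by (auto intro!: always_eventually simp: integral_nonneg_AE)
    show "(\<lambda>n. expectation (\<lambda>\<omega>. min 1 (dist (e n \<omega>) (I s \<omega>))) + expectation (\<lambda>\<omega>. min 1 (norm (b n \<omega>)))) \<longlonglongrightarrow> 0"
      using tendsto_add[OF e1 e2] by simp
  qed
  then show ?thesis by (simp add: X_def y_def i_def)
qed

end

section \<open>A discrete supermartingale inequality for the killed and weighted scheme\<close>

context lyapunov_sde begin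

text \<open>The current grid point is included, so a path that is alive at step \<open>i\<close> has
  bounded coefficients in that step.\<close>

definition alive :: "real \<Rightarrow> nat \<Rightarrow> nat \<Rightarrow> 'a \<Rightarrow> real" where
  "alive R m i \<omega> = (\<Prod>j\<le>i. if V (x (real j / m) \<omega>) \<le> R then 1 else 0)"

text \<open>The exponent is a left Riemann sum that excludes grid point \<open>i\<close>, so the
  weight with index \<open>Suc i\<close> is already known at time \<open>i / m\<close>.\<close>

definition weight :: "real \<Rightarrow> nat \<Rightarrow> nat \<Rightarrow> 'a \<Rightarrow> real" where
  "weight K m i \<omega> = exp (\<Sum>j<i. rate K (x (real j / m) \<omega>) / m)"

abbreviation killed :: "real \<Rightarrow> real \<Rightarrow> nat \<Rightarrow> 'a set \<Rightarrow> nat \<Rightarrow> 'a \<Rightarrow> real" where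
  "killed K R m A i \<omega> \<equiv> indicator A \<omega> * alive R m i \<omega> * weight K m i \<omega>"

lemma alive_bounds: "0 \<le> alive R m i \<omega>" "alive R m i \<omega> \<le> 1"
  unfolding alive_def by (auto intro!: prod_nonneg prod_le_1)

lemma alive_Suc_le: "alive R m (Suc i) \<omega> \<le> alive R m i \<omega>"
  using alive_bounds(1)[of R m i \<omega>] by (simp add: alive_def)

lemma alive_nonzeroD: "alive R m i \<omega> \<noteq> 0 \<Longrightarrow> V (x (real i / m) \<omega>) \<le> R"
  unfolding alive_def by (auto split: if_splits)

lemma alive_eq_1: "(\<And>j. j \<le> i \<Longrightarrow> V (x (real j / m) \<omega>) \<le> R) \<Longrightarrow> alive R m i \<omega> = 1"
  unfolding alive_def by (intro prod.neutral) auto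

lemma grid_x_meas:
  fixes i j m :: nat
  assumes "real i / m \<le> t" "j \<le> i"
  shows "x (real j / m) \<in> borel_measurable (F t)"
  using assms by (intro x_meas order_trans[OF _ assms(1)] divide_right_mono) auto

lemma alive_meas:
  assumes "real i / m \<le> t"
  shows "alive R m i \<in> borel_measurable (F t)"
proof -
  have "(\<lambda>\<omega>. if V (x (real j / m) \<omega>) \<le> R then 1 else 0 :: real) \<in> borel_measurable (F t)" if "j \<le> i" for j
  proof -
    have [measurable]: "x (real j / m) \<in> borel_measurable (F t)" using assms that by (rule grid_x_meas)
    show ?thesis by measurable
  qed
  then show ?thesis unfolding alive_def[abs_def] by (intro borel_measurable_prod) auto
qed

lemma weight_meas:
  assumes "real i / m \<le> t"
  shows "weight K m (Suc i) \<in> borel_measurable (F t)"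
proof -
  have "(\<lambda>\<omega>. rate K (x (real j / m) \<omega>) / m) \<in> borel_measurable (F t)" if "j < Suc i" for j
  proof -
    have [measurable]: "x (real j / m) \<in> borel_measurable (F t)" using assms that by (intro grid_x_meas) auto
    show ?thesis by measurable
  qed
  then show ?thesis
    unfolding weight_def[abs_def]
    by (rule measurable_compose[OF borel_measurable_sum, of _ _ _ exp borel]) auto
qed

lemma alive_meas_M: "alive R m i \<in> borel_measurable M"
  by (rule measurable_from_subalg[OF subalg alive_meas[OF order_refl]]) simp

lemma weight_meas_M: "weight K m i \<in> borel_measurable M"
proof -
  have "(\<lambda>\<omega>. rate K (x (real j / m) \<omega>) / m) \<in> borel_measurable M" for j
  proof -
    have [measurable]: "x (real j / m) \<in> borel_measurable M" by (intro x_meas_M) simp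
    show ?thesis by measurable
  qed
  then show ?thesis
    unfolding weight_def[abs_def]
    by (rule measurable_compose[OF borel_measurable_sum, of _ _ _ exp borel]) auto
qed

lemma weight_le:
  assumes "0 < K"
  shows "weight K m i \<omega> \<le> exp (c * real i / m)"
proof -
  have "(\<Sum>j<i. rate K (x (real j / m) \<omega>) / m) \<le> (\<Sum>j<i. c / m)"
    by (intro sum_mono divide_right_mono rate_le assms) simp
  then show ?thesis by (simp add: weight_def mult.commute)
qed

lemma euler_meas_M: "euler m G i \<in> borel_measurable M"
  by (rule measurable_from_subalg[OF subalg euler_meas[OF order_refl]]) simp

lemma increment:
  assumes "0 < m"
  shows "distributed M lborel (\<lambda>\<omega>. w (real (Suc i) / m) \<omega> - w (real i / m) \<omega>)
      (\<lambda>y. ennreal (\<Prod>k\<in>UNIV. normal_density 0 (sqrt (1 / real m)) (y $ k)))"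
    and "A \<in> sets (F (real i / m)) \<Longrightarrow> B \<in> sets borel \<Longrightarrow>
      prob (A \<inter> {\<omega>\<in>space M. w (real (Suc i) / m) \<omega> - w (real i / m) \<omega> \<in> B})
        = prob A * prob {\<omega>\<in>space M. w (real (Suc i) / m) \<omega> - w (real i / m) \<omega> \<in> B}"
proof -
  have lt: "real i / m < real (Suc i) / m" and eq: "real (Suc i) / m - real i / m = 1 / real m"
    using assms by (auto simp: divide_strict_right_mono diff_divide_distrib[symmetric])
  note W = wiener[unfolded wiener_process_def, THEN conjunct2, THEN conjunct2, rule_format, of "real i / m" "real (Suc i) / m"]
  show "distributed M lborel (\<lambda>\<omega>. w (real (Suc i) / m) \<omega> - w (real i / m) \<omega>)
      (\<lambda>y. ennreal (\<Prod>k\<in>UNIV. normal_density 0 (sqrt (1 / real m)) (y $ k)))"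
    using W lt unfolding eq by simp
  show "A \<in> sets (F (real i / m)) \<Longrightarrow> B \<in> sets borel \<Longrightarrow>
      prob (A \<inter> {\<omega>\<in>space M. w (real (Suc i) / m) \<omega> - w (real i / m) \<omega> \<in> B})
        = prob A * prob {\<omega>\<in>space M. w (real (Suc i) / m) \<omega> - w (real i / m) \<omega> \<in> B}"
    using W lt by simp
qed

definition weight_bound :: "nat \<Rightarrow> real" where
  "weight_bound T = exp (c * real T)"

text \<open>The remainder of \<open>euler_step_expectation_le\<close> for step size
  \<open>d = 1 / m\<close>, per unit of \<open>CY * d\<close>.\<close>

definition step_err :: "real \<Rightarrow> real \<Rightarrow> real \<Rightarrow> real \<Rightarrow> nat \<Rightarrow> real" where
  "step_err B \<eta> E C m = \<eta> * (2 * C\<^sup>2 * (1 + real CARD('m)))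
    + 1 / real m * (B * C\<^sup>2 + 8 * E * C ^ 4 * (1 + 3 * (real CARD('m))\<^sup>2))"

definition gap :: "nat \<Rightarrow> (nat \<Rightarrow> real^'m^'m) \<Rightarrow> nat \<Rightarrow> real" where
  "gap m G i = expectation (\<lambda>\<omega>. (min 1 (dist (euler m G i \<omega>) (x (real i / m) \<omega>)))\<^sup>2)"

text \<open>A function of the time \<open>s\<close> instead of the grid index: \<Sigma> is
  approximated only for almost every \<open>s\<close>, so the limit is taken under a time
  integral.\<close>

abbreviation disc_err :: "nat \<Rightarrow> real \<Rightarrow> real \<Rightarrow> nat \<Rightarrow> (nat \<Rightarrow> real^'m^'m) \<Rightarrow> real \<Rightarrow> real" where
  "disc_err T \<eta> D m G s \<equiv>
     weight_bound T * (\<eta> + D * gap m G (cell m s) + D * norm (G (cell m s) - \<Sigma> s))"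

lemma gap_bounds: "0 \<le> gap m G i" "gap m G i \<le> 1"
proof -
  have [measurable]: "euler m G i \<in> borel_measurable M" "x (real i / m) \<in> borel_measurable M"
    by (auto intro: euler_meas_M x_meas_M)
  have b: "(min 1 (dist (euler m G i \<omega>) (x (real i / m) \<omega>)))\<^sup>2 \<le> 1" for \<omega>
    by (intro power_le_one) auto
  show "0 \<le> gap m G i" unfolding gap_def by (intro integral_nonneg_AE) simp
  show "gap m G i \<le> 1" unfolding gap_def by (intro integral_le_const integrable_const_bound[where B=1]) (use b in auto)
qed

text \<open>One discretization level: horizon \<open>T\<close>, mesh \<open>1 / m\<close>, killing
  level \<open>R\<close>, the truncated function and all constants. In
  \<open>killed_weight_le\<close> the constants are chosen independently of the mesh.\<close>

context
  fixes K R B \<eta> D E C CS r :: real and m T :: nat and G :: "nat \<Rightarrow> real^'m^'m" and A :: "'a set"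
    and u :: "real^'n \<Rightarrow> real" and Du :: "real^'n \<Rightarrow> real^'n" and Hu :: "real^'n \<Rightarrow> real^'n^'n"
  assumes K: "0 < K" and m: "0 < m" and A: "A \<in> sets (F 0)" and Ar: "\<And>\<omega>. \<omega> \<in> A \<Longrightarrow> V (x 0 \<omega>) \<le> r"
    and r: "0 \<le> r" "r \<le> R"
    and u_ge: "\<And>z. K \<le> u z" and u_eq: "\<And>z. V z \<le> R \<Longrightarrow> u z = K + V z"
    and u_borel [measurable]: "u \<in> borel_measurable borel" "Du \<in> borel_measurable borel" "Hu \<in> borel_measurable borel"
    and B: "\<And>z. \<bar>u z\<bar> \<le> B" "\<And>z. norm (Du z) \<le> B" "\<And>z. norm (Hu z) \<le> B"
    and taylor: "\<And>z e. u (z + e) \<le> u z + Du z \<bullet> e + 1/2 * (e \<bullet> (Hu z *v e)) + \<eta> * (norm e)\<^sup>2 + E * (norm e)^4"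
    and drift: "\<And>z y A s. V z \<le> R \<Longrightarrow> norm A \<le> CS \<Longrightarrow> 0 \<le> s \<Longrightarrow>
     rate K z * u y + Du y \<bullet> f z + 1/2 * trace (transpose (h z ** A) ** Hu y ** (h z ** A))
       \<le> \<eta> + D * (min 1 (dist y z))\<^sup>2 + D * norm (A - \<Sigma> s)"
    and \<eta>: "0 \<le> \<eta>" and D: "0 \<le> D" and E: "0 \<le> E" and C0: "0 \<le> C"
    and C: "\<And>z. V z \<le> R \<Longrightarrow> norm (f z) \<le> C" "\<And>z. V z \<le> R \<Longrightarrow> norm (h z) * CS \<le> C"
    and GC: "\<And>i. norm (G i) \<le> CS" and CS: "\<And>t. 0 \<le> t \<Longrightarrow> norm (\<Sigma> t) \<le> CS"
begin

text \<open>The multiplier of step \<open>i\<close>: killing up to \<open>i\<close>, but the weight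
  of \<open>Suc i\<close>. It is known at time \<open>i / m\<close>, hence independent of the
  increment that follows.\<close>

definition "Y i \<omega> = indicator A \<omega> * alive R m i \<omega> * weight K m (Suc i) \<omega>"

definition "drift_term i \<omega> = rate K (x (real i / m) \<omega>) * u (euler m G i \<omega>) + Du (euler m G i \<omega>) \<bullet> f (x (real i / m) \<omega>)
   + 1/2 * trace (transpose (h (x (real i / m) \<omega>) ** G i) ** Hu (euler m G i \<omega>) ** (h (x (real i / m) \<omega>) ** G i))"

definition "mean_value i = expectation (\<lambda>\<omega>. killed K R m A i \<omega> * u (euler m G i \<omega>))"

lemma A_M [measurable]: "A \<in> sets M"
  using A subalg[of 0] by (auto simp: subalgebra_def)

lemma u_pos: "0 < u z" using u_ge[of z] K by linarith

lemma Y_nonneg: "0 \<le> Y i \<omega>"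
  by (auto simp: Y_def weight_def intro!: mult_nonneg_nonneg alive_bounds)

lemma weight_le_bound:
  assumes "i \<le> T * m"
  shows "weight K m i \<omega> \<le> weight_bound T"
proof -
  have "real i \<le> real T * real m" using assms by (metis of_nat_le_iff of_nat_mult)
  then have "c * real i / m \<le> c * real T" using c_pos m by (simp add: pos_divide_le_eq)
  then show ?thesis using weight_le[OF K, of m i \<omega>] unfolding weight_bound_def by (meson exp_le_cancel_iff order_trans)
qed

lemma indicator_alive_weight_le:
  assumes "0 \<le> W" "W \<le> weight_bound T"
  shows "\<bar>indicator A \<omega> * alive R m i \<omega> * W\<bar> \<le> weight_bound T"
proof -
  have "indicator A \<omega> * alive R m i \<omega> \<le> 1" and nn: "0 \<le> indicator A \<omega> * alive R m i \<omega>"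
    using alive_bounds[of R m i \<omega>] by (auto simp: indicator_def)
  then have "indicator A \<omega> * alive R m i \<omega> * W \<le> 1 * weight_bound T" using assms by (intro mult_mono) auto
  then show ?thesis using nn assms(1) by simp
qed

lemma Y_le: "Suc i \<le> T * m \<Longrightarrow> Y i \<omega> \<le> weight_bound T"
  using indicator_alive_weight_le[of "weight K m (Suc i) \<omega>" \<omega> i, OF _ weight_le_bound]
  unfolding Y_def by (simp add: weight_def)

lemma Y_nonzeroD: "Y i \<omega> \<noteq> 0 \<Longrightarrow> V (x (real i / m) \<omega>) \<le> R"
  by (rule alive_nonzeroD) (auto simp: Y_def)

lemma Y_meas: "Y i \<in> borel_measurable (F (real i / m))"
proof -
  have [measurable]: "A \<in> sets (F (real i / m))" using A subalg_mono[of 0 "real i / m"] by (auto simp: subalgebra_def)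
  have [measurable]: "alive R m i \<in> borel_measurable (F (real i / m))" "weight K m (Suc i) \<in> borel_measurable (F (real i / m))"
    by (auto intro!: alive_meas weight_meas)
  show ?thesis unfolding Y_def[abs_def] by measurable
qed

lemma meas_M [measurable]: "Y i \<in> borel_measurable M" "alive R m i \<in> borel_measurable M" "weight K m i \<in> borel_measurable M"
    "euler m G i \<in> borel_measurable M" "x (real i / m) \<in> borel_measurable M"
  using measurable_from_subalg[OF subalg Y_meas, of i]
  by (auto intro: alive_meas_M weight_meas_M euler_meas_M x_meas_M)

lemma drift_term_meas [measurable]: "drift_term i \<in> borel_measurable M"
  unfolding drift_term_def[abs_def] by measurable

lemma mean_value_integrable:
  assumes "i \<le> T * m"
  shows "integrable M (\<lambda>\<omega>. killed K R m A i \<omega> * u (euler m G i \<omega>))"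
proof (rule integrable_const_bound[where B="weight_bound T * B"])
  have "\<bar>killed K R m A i \<omega> * u (euler m G i \<omega>)\<bar> \<le> weight_bound T * B" for \<omega>
    using indicator_alive_weight_le[OF _ weight_le_bound[OF assms], of \<omega> \<omega> i] B(1)
    unfolding abs_mult[of _ "u _"] by (intro mult_mono) (auto simp: weight_def weight_bound_def)
  then show "AE \<omega> in M. norm (killed K R m A i \<omega> * u (euler m G i \<omega>)) \<le> weight_bound T * B"
    by simp
qed measurable

lemma Yu_integrable:
  assumes i: "Suc i \<le> T * m" and [measurable]: "p \<in> borel_measurable M"
  shows "integrable M (\<lambda>\<omega>. Y i \<omega> * u (p \<omega>))"
proof (rule integrable_const_bound[where B="weight_bound T * B"])
  have "\<bar>Y i \<omega> * u (p \<omega>)\<bar> \<le> weight_bound T * B" for \<omega>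
    by (rule abs_mult_le_mult[OF Y_nonneg Y_le[OF i] B(1)])
  then show "AE \<omega> in M. norm (Y i \<omega> * u (p \<omega>)) \<le> weight_bound T * B" by simp
qed measurable

text \<open>Since \<open>exp (a) - 1 \<le> a * exp (a)\<close>, the weight increment is charged to the new weight,
  which is still known at time \<open>i / m\<close>.\<close>

lemma weight_Suc_diff: "weight K m (Suc i) \<omega> - weight K m i \<omega> \<le> weight K m (Suc i) \<omega> * (1 / m * rate K (x (real i / m) \<omega>))"
proof -
  define a where "a = rate K (x (real i / m) \<omega>) / m"
  have W: "weight K m (Suc i) \<omega> = weight K m i \<omega> * exp a"
    by (simp add: weight_def a_def exp_add)
  have "1 - exp (- a) \<le> a" using exp_ge_add_one_self[of "- a"] by simp
  then have "(weight K m i \<omega> * exp a) * (1 - exp (- a)) \<le> (weight K m i \<omega> * exp a) * a"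
    by (rule mult_left_mono) (simp add: weight_def)
  moreover have "(weight K m i \<omega> * exp a) * (1 - exp (- a)) = weight K m i \<omega> * exp a - weight K m i \<omega>"
    using exp_minus_inverse[of a] by (simp only: right_diff_distrib mult.assoc mult_1_right)
  ultimately show ?thesis unfolding W by (simp add: a_def)
qed

lemma Y_drift_integrable:
  assumes i: "Suc i \<le> T * m"
  shows "integrable M (\<lambda>\<omega>. Y i \<omega> * drift_term i \<omega>)"
proof -
  obtain Cr where Cr: "0 \<le> Cr" "\<And>z. V z \<le> R \<Longrightarrow> norm (rate K z) \<le> Cr"
    using bounded_image_sublevel[OF V_cont coercive rate_cont[OF K]] by metis
  have B0: "0 \<le> B" using B(1)[of 0] by linarith
  define L where "L = Cr * B + B * C + 1/2 * (real CARD('m) * (C * B * C))"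
  have L0: "0 \<le> L" unfolding L_def using Cr(1) B0 C0 by (intro add_nonneg_nonneg mult_nonneg_nonneg) auto
  have "\<bar>Y i \<omega> * drift_term i \<omega>\<bar> \<le> weight_bound T * L" for \<omega>
  proof (cases "Y i \<omega> = 0")
    case True
    then show ?thesis using L0 by (simp add: weight_bound_def)
  next
    case False
    let ?z = "x (real i / m) \<omega>" and ?y = "euler m G i \<omega>"
    note Vz = Y_nonzeroD[OF False]
    have "norm (h ?z ** G i) \<le> norm (h ?z) * norm (G i)" by (rule norm_matrix_mult_le)
    also have "\<dots> \<le> norm (h ?z) * CS" using GC by (intro mult_left_mono) auto
    finally have n: "norm (h ?z ** G i) \<le> C" using C(2)[OF Vz] by linarith
    have "\<bar>trace (transpose (h ?z ** G i) ** Hu ?y ** (h ?z ** G i))\<bar> \<le> real CARD('m) * (norm (h ?z ** G i) * norm (Hu ?y) * norm (h ?z ** G i))"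
      by (rule abs_trace_congruence_le)
    also have "\<dots> \<le> real CARD('m) * (C * B * C)"
      using n B(3)[of ?y] C0 B0 by (intro mult_left_mono mult_mono) auto
    finally have 3: "\<bar>trace (transpose (h ?z ** G i) ** Hu ?y ** (h ?z ** G i))\<bar> \<le> real CARD('m) * (C * B * C)" .
    have 1: "\<bar>rate K ?z * u ?y\<bar> \<le> Cr * B"
      using mult_mono[OF Cr(2)[OF Vz] B(1)[of ?y] Cr(1) abs_ge_zero] by (simp add: abs_mult)
    have 2: "\<bar>Du ?y \<bullet> f ?z\<bar> \<le> B * C"
      by (rule order_trans[OF Cauchy_Schwarz_ineq2 mult_mono[OF B(2) C(1)[OF Vz] B0 norm_ge_zero]])
    have "\<bar>drift_term i \<omega>\<bar> \<le> L" 
      unfolding drift_term_def L_def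
      by (intro order_trans[OF abs_triangle_ineq] add_mono 1 2) (use 3 in \<open>simp add: abs_mult\<close>)
    then show ?thesis by (rule abs_mult_le_mult[OF Y_nonneg Y_le[OF i]])
  qed
  then have "AE \<omega> in M. norm (Y i \<omega> * drift_term i \<omega>) \<le> weight_bound T * L" by simp
  then show ?thesis by (rule integrable_const_bound) measurable
qed

lemma mean_value_Suc_le:
  assumes i: "Suc i \<le> T * m"
  shows "mean_value (Suc i) \<le> mean_value i + 1 / m * expectation (\<lambda>\<omega>. Y i \<omega> * drift_term i \<omega>) + weight_bound T * (1 / m) * step_err B \<eta> E C m"
proof -
  let ?z = "\<lambda>\<omega>. x (real i / m) \<omega>" and ?y = "euler m G i"
  let ?s = "\<lambda>\<omega>. h (?z \<omega>) ** G i"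
  let ?dw = "\<lambda>\<omega>. w (real (Suc i) / m) \<omega> - w (real i / m) \<omega>"
  have Fz [measurable]: "?z \<in> borel_measurable (F (real i / m))" by (intro x_adapted) simp
  have ySuc: "euler m G (Suc i) \<omega> = ?y \<omega> + (1 / real m) *\<^sub>R f (?z \<omega>) + ?s \<omega> *v ?dw \<omega>" for \<omega>
    by (simp add: euler_def)
  have "mean_value (Suc i) \<le> expectation (\<lambda>\<omega>. Y i \<omega> * u (euler m G (Suc i) \<omega>))"
    unfolding mean_value_def
  proof (rule integral_mono[OF mean_value_integrable[OF i] Yu_integrable[OF i]])
    show "killed K R m A (Suc i) \<omega> * u (euler m G (Suc i) \<omega>)
      \<le> Y i \<omega> * u (euler m G (Suc i) \<omega>)" for \<omega>
      unfolding Y_def using alive_Suc_le[of R m i \<omega>] u_pos[of "euler m G (Suc i) \<omega>"]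
      by (intro mult_right_mono mult_left_mono) (auto simp: weight_def)
  qed measurable
  also have "\<dots> \<le> expectation (\<lambda>\<omega>. Y i \<omega> * (u (?y \<omega>) + 1 / m * (Du (?y \<omega>) \<bullet> f (?z \<omega>) +
         1/2 * trace (transpose (?s \<omega>) ** Hu (?y \<omega>) ** ?s \<omega>)))) + weight_bound T * (1 / m) * step_err B \<eta> E C m"
    unfolding ySuc step_err_def
  proof (rule euler_step_expectation_le[OF subalg _ _ increment(1)[OF m] increment(2)[OF m] Y_meas euler_meas[OF order_refl] _ _
        Y_nonneg Y_le[OF i] _ _ C0 u_borel B taylor \<eta> E])
    show "norm (f (?z \<omega>)) \<le> C" if "Y i \<omega> \<noteq> 0" for \<omega> using C(1)[OF Y_nonzeroD[OF that]] .
    show "norm (?s \<omega>) \<le> C" if "Y i \<omega> \<noteq> 0" for \<omega>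
      using norm_matrix_mult_le[of "h (?z \<omega>)" "G i"] mult_left_mono[OF GC[of i] norm_ge_zero[of "h (?z \<omega>)"]]
        C(2)[OF Y_nonzeroD[OF that]] by linarith
    show "(\<lambda>\<omega>. f (?z \<omega>)) \<in> borel_measurable (F (real i / m))" "?s \<in> borel_measurable (F (real i / m))"
      by measurable
  qed (use m in auto)
  also have "expectation (\<lambda>\<omega>. Y i \<omega> * (u (?y \<omega>) + 1 / m * (Du (?y \<omega>) \<bullet> f (?z \<omega>) +
         1/2 * trace (transpose (?s \<omega>) ** Hu (?y \<omega>) ** ?s \<omega>))))
    \<le> expectation (\<lambda>\<omega>. killed K R m A i \<omega> * u (?y \<omega>) + 1 / m * (Y i \<omega> * drift_term i \<omega>))"
  proof (rule integral_mono)
    have i': "i \<le> T * m" using i by simp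
    \<comment> \<open>The rate term is added and subtracted: added it completes the drift,
      subtracted it pays for lowering the index of the weight by one.\<close>
    have pw: "Y i \<omega> * (u (?y \<omega>) + 1 / m * (Du (?y \<omega>) \<bullet> f (?z \<omega>) + 1/2 * trace (transpose (?s \<omega>) ** Hu (?y \<omega>) ** ?s \<omega>)))
      = Y i \<omega> * u (?y \<omega>) - 1 / m * rate K (?z \<omega>) * Y i \<omega> * u (?y \<omega>) + 1 / m * (Y i \<omega> * drift_term i \<omega>)" for \<omega>
      by (simp add: drift_term_def algebra_simps)
    have intr: "integrable M (\<lambda>\<omega>. 1 / m * rate K (?z \<omega>) * Y i \<omega> * u (?y \<omega>))"
    proof -
      obtain Cr where Cr: "0 \<le> Cr" "\<And>z. V z \<le> R \<Longrightarrow> norm (rate K z) \<le> Cr"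
        using bounded_image_sublevel[OF V_cont coercive rate_cont[OF K]] by metis
      have "\<bar>rate K (?z \<omega>) * (Y i \<omega> * u (?y \<omega>))\<bar> \<le> Cr * (weight_bound T * B)" for \<omega>
      proof (cases "Y i \<omega> = 0")
        case True
        then show ?thesis using Cr B(1)[of 0] by (auto simp: weight_bound_def)
      next
        case False
        then show ?thesis
          unfolding abs_mult[of "rate _ _"]
          using Cr(2)[OF Y_nonzeroD[OF False]] abs_mult_le_mult[OF Y_nonneg Y_le[OF i] B(1)[of "?y \<omega>"]] Cr(1)
          by (intro mult_mono) auto
      qed
      then have "integrable M (\<lambda>\<omega>. rate K (?z \<omega>) * (Y i \<omega> * u (?y \<omega>)))"
        by (intro integrable_const_bound[where B="Cr * (weight_bound T * B)"]) auto
      from integrable_mult_right[OF this, of "1 / m"] show ?thesis by (simp add: mult.assoc)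
    qed
    show "integrable M (\<lambda>\<omega>. Y i \<omega> * (u (?y \<omega>) + 1 / m * (Du (?y \<omega>) \<bullet> f (?z \<omega>) + 1/2 * trace (transpose (?s \<omega>) ** Hu (?y \<omega>) ** ?s \<omega>))))"
      unfolding pw
      by (intro Bochner_Integration.integrable_add Bochner_Integration.integrable_diff integrable_mult_right
          Yu_integrable[OF i] Y_drift_integrable[OF i] intr) measurable
    show "integrable M (\<lambda>\<omega>. killed K R m A i \<omega> * u (?y \<omega>) + 1 / m * (Y i \<omega> * drift_term i \<omega>))"
      by (intro Bochner_Integration.integrable_add integrable_mult_right mean_value_integrable[OF i'] Y_drift_integrable[OF i])
    fix \<omega>
    have "(indicator A \<omega> * alive R m i \<omega> * u (?y \<omega>)) * (weight K m (Suc i) \<omega> - weight K m i \<omega>)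
      \<le> (indicator A \<omega> * alive R m i \<omega> * u (?y \<omega>)) * (weight K m (Suc i) \<omega> * (1 / m * rate K (?z \<omega>)))"
      by (rule mult_left_mono[OF weight_Suc_diff])
         (auto intro!: mult_nonneg_nonneg alive_bounds less_imp_le[OF u_pos])
    then show "Y i \<omega> * (u (?y \<omega>) + 1 / m * (Du (?y \<omega>) \<bullet> f (?z \<omega>) + 1/2 * trace (transpose (?s \<omega>) ** Hu (?y \<omega>) ** ?s \<omega>)))
      \<le> killed K R m A i \<omega> * u (?y \<omega>) + 1 / m * (Y i \<omega> * drift_term i \<omega>)"
      unfolding pw by (simp add: Y_def algebra_simps)
  qed
  also have "\<dots> = mean_value i + 1 / m * expectation (\<lambda>\<omega>. Y i \<omega> * drift_term i \<omega>)"
    unfolding mean_value_def using i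
    by (subst Bochner_Integration.integral_add) (auto intro!: mean_value_integrable Y_drift_integrable)
  finally show ?thesis by simp
qed

text \<open>The time \<open>s\<close> is free: it will range over the whole \<open>i\<close>-th cell
  when the sum over steps is turned into an integral.\<close>

lemma expectation_drift_le:
  assumes i: "Suc i \<le> T * m" and s: "0 \<le> s"
  shows "expectation (\<lambda>\<omega>. Y i \<omega> * drift_term i \<omega>) \<le> weight_bound T * (\<eta> + D * gap m G i + D * norm (G i - \<Sigma> s))"
proof -
  let ?q = "\<lambda>\<omega>. (min 1 (dist (euler m G i \<omega>) (x (real i / m) \<omega>)))\<^sup>2"
  have q: "integrable M ?q" by (intro integrable_const_bound[where B=1]) (auto intro!: power_le_one)
  have "expectation (\<lambda>\<omega>. Y i \<omega> * drift_term i \<omega>) \<le> expectation (\<lambda>\<omega>. weight_bound T * (\<eta> + D * ?q \<omega> + D * norm (G i - \<Sigma> s)))"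
  proof (rule integral_mono[OF Y_drift_integrable[OF i]])
    show "integrable M (\<lambda>\<omega>. weight_bound T * (\<eta> + D * ?q \<omega> + D * norm (G i - \<Sigma> s)))"
      by (intro integrable_mult_right Bochner_Integration.integrable_add q) auto
    fix \<omega>
    have nn: "0 \<le> \<eta> + D * ?q \<omega> + D * norm (G i - \<Sigma> s)" using \<eta> D by simp
    show "Y i \<omega> * drift_term i \<omega> \<le> weight_bound T * (\<eta> + D * ?q \<omega> + D * norm (G i - \<Sigma> s))"
    proof (cases "Y i \<omega> = 0")
      case True
      then show ?thesis using nn by (simp add: weight_bound_def)
    next
      case False
      have "drift_term i \<omega> \<le> \<eta> + D * ?q \<omega> + D * norm (G i - \<Sigma> s)"
        unfolding drift_term_def by (rule drift[OF Y_nonzeroD[OF False] GC s])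
      then have "Y i \<omega> * drift_term i \<omega> \<le> Y i \<omega> * (\<eta> + D * ?q \<omega> + D * norm (G i - \<Sigma> s))"
        by (rule mult_left_mono[OF _ Y_nonneg])
      also have "\<dots> \<le> weight_bound T * (\<eta> + D * ?q \<omega> + D * norm (G i - \<Sigma> s))"
        by (rule mult_right_mono[OF Y_le[OF i] nn])
      finally show ?thesis .
    qed
  qed
  also have "\<dots> = weight_bound T * (\<eta> + D * gap m G i + D * norm (G i - \<Sigma> s))"
    using q by (simp add: gap_def prob_space)
  finally show ?thesis .
qed

lemma mean_value_0_le: "mean_value 0 \<le> K + r"
proof -
  have "mean_value 0 \<le> expectation (\<lambda>_. K + r)"
    unfolding mean_value_def
  proof (rule integral_mono[OF mean_value_integrable])
    fix \<omega>
    show "killed K R m A 0 \<omega> * u (euler m G 0 \<omega>) \<le> K + r"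
    proof (cases "\<omega> \<in> A")
      case True
      then show ?thesis using Ar[OF True] r by (simp add: alive_def weight_def euler_def u_eq)
    next
      case False
      then show ?thesis using K r by simp
    qed
  qed auto
  then show ?thesis by (simp add: prob_space)
qed

lemma discretization_error_integrable:
  "integrable lborel (\<lambda>s. indicator {0..<real T} s * (disc_err T \<eta> D m G s))"
proof -
  define S' where "S' r = indicator {0..} r *\<^sub>R \<Sigma> r" for r
  have [measurable]: "S' \<in> borel_measurable borel"
    using \<Sigma>_meas unfolding S'_def[abs_def] by (subst (asm) borel_measurable_restrict_space_iff) auto
  have "integrable lborel (\<lambda>s. indicator {0..<real T} s *\<^sub>R (weight_bound T * (\<eta> + D * gap m G (cell m s) + D * norm (G (cell m s) - S' s))))"
  proof (rule integrableI_bounded_set_indicator[where B="weight_bound T * (\<eta> + D * 1 + D * (CS + CS))"])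
    show "AE s in lborel. s \<in> {0..<real T} \<longrightarrow>
       norm (weight_bound T * (\<eta> + D * gap m G (cell m s) + D * norm (G (cell m s) - S' s))) \<le> weight_bound T * (\<eta> + D * 1 + D * (CS + CS))"
    proof (intro AE_I2 impI)
      fix s assume s: "s \<in> {0..<real T}"
      have "norm (G (cell m s) - S' s) \<le> CS + CS"
        using s GC[of "cell m s"] CS[of s] by (intro order_trans[OF norm_triangle_ineq4] add_mono) (auto simp: S'_def)
      then have "\<eta> + D * gap m G (cell m s) + D * norm (G (cell m s) - S' s) \<le> \<eta> + D * 1 + D * (CS + CS)"
        using gap_bounds D by (intro add_mono mult_left_mono) auto
      moreover have "0 \<le> \<eta> + D * gap m G (cell m s) + D * norm (G (cell m s) - S' s)"
        using \<eta> D gap_bounds by simp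
      ultimately show "norm (weight_bound T * (\<eta> + D * gap m G (cell m s) + D * norm (G (cell m s) - S' s))) \<le> weight_bound T * (\<eta> + D * 1 + D * (CS + CS))"
        by (simp add: abs_mult weight_bound_def)
    qed
  qed auto
  moreover have "indicator {0..<real T} s *\<^sub>R (weight_bound T * (\<eta> + D * gap m G (cell m s) + D * norm (G (cell m s) - S' s)))
     = indicator {0..<real T} s * (disc_err T \<eta> D m G s)" for s
    by (auto simp: indicator_def S'_def)
  ultimately show ?thesis by (simp only:)
qed

text \<open>Summing the one-step bounds controls \<open>mean_value (T * m)\<close>; then
  \<open>K \<le> u\<close> removes \<open>u\<close> from the left side.\<close>

lemma weighted_total_le:
  "K * expectation (\<lambda>\<omega>. killed K R m A (T * m) \<omega>) \<le>
    K + r + (\<integral>s. indicator {0..<real T} s * (disc_err T \<eta> D m G s) \<partial>lborel)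
    + real T * weight_bound T * step_err B \<eta> E C m"
proof -
  \<comment> \<open>Zero past the last step, where no bound on the expectation is available; as
    \<open>disc_err\<close> is nonnegative, the cellwise comparison below needs no separate range
    check.\<close>
  define d where "d i = (if Suc i \<le> T * m then expectation (\<lambda>\<omega>. Y i \<omega> * drift_term i \<omega>) else 0)" for i
  have "i \<le> T * m \<Longrightarrow> mean_value i \<le> mean_value 0 + (\<Sum>j<i. d j / m) + real i * (weight_bound T * (1 / m) * step_err B \<eta> E C m)" for i
  proof (induction i)
    case (Suc i)
    then have "mean_value (Suc i) \<le> mean_value i + d i / m + weight_bound T * (1 / m) * step_err B \<eta> E C m"
      using mean_value_Suc_le[of i] by (simp add: d_def)
    moreover have "real (Suc i) * (weight_bound T * (1 / m) * step_err B \<eta> E C m) = real i * (weight_bound T * (1 / m) * step_err B \<eta> E C m) + weight_bound T * (1 / m) * step_err B \<eta> E C m"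
      by (simp only: of_nat_Suc distrib_right mult_1 add.commute)
    ultimately show ?case using Suc by simp
  qed simp
  from this[of "T * m"] have "mean_value (T * m) \<le> K + r + (\<Sum>j<T * m. d j / m) + real T * weight_bound T * step_err B \<eta> E C m"
    using mean_value_0_le m by simp
  moreover have "(\<Sum>j<T * m. d j / m) = (\<integral>s. indicator {0..<real T} s * d (cell m s) \<partial>lborel)"
    using integral_step_grid[OF m, of T d] by (simp add: has_bochner_integral_iff)
  moreover have "\<dots> \<le> (\<integral>s. indicator {0..<real T} s * (disc_err T \<eta> D m G s) \<partial>lborel)"
  proof (rule integral_mono)
    show "integrable lborel (\<lambda>s. indicator {0..<real T} s * d (cell m s))"
      using integral_step_grid[OF m, of T d] by (simp add: has_bochner_integral_iff)
    fix s
    show "indicator {0..<real T} s * d (cell m s)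
       \<le> indicator {0..<real T} s * (disc_err T \<eta> D m G s)"
    proof (cases "s \<in> {0..<real T}")
      case True
      have "0 \<le> disc_err T \<eta> D m G s"
        using \<eta> D gap_bounds by (simp add: weight_bound_def)
      then have "d (cell m s) \<le> disc_err T \<eta> D m G s"
        using expectation_drift_le[of "cell m s" s] True by (simp add: d_def)
      then show ?thesis using True by simp
    qed simp
  qed (rule discretization_error_integrable)
  moreover have "K * expectation (\<lambda>\<omega>. killed K R m A (T * m) \<omega>) \<le> mean_value (T * m)"
  proof -
    have int: "integrable M (\<lambda>\<omega>. killed K R m A (T * m) \<omega>)"
    proof (rule integrable_const_bound[where B="weight_bound T"])
      show "AE \<omega> in M. norm (killed K R m A (T * m) \<omega>) \<le> weight_bound T"
        using indicator_alive_weight_le[OF _ weight_le_bound[OF order_refl]] by (simp add: weight_def)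
    qed measurable
    have "K * expectation (\<lambda>\<omega>. killed K R m A (T * m) \<omega>)
      = expectation (\<lambda>\<omega>. killed K R m A (T * m) \<omega> * K)"
      by simp
    also have "\<dots> \<le> mean_value (T * m)"
      unfolding mean_value_def
      by (intro integral_mono[OF integrable_mult_left[OF int] mean_value_integrable[OF order_refl]] mult_left_mono u_ge)
         (auto simp: weight_def intro!: mult_nonneg_nonneg alive_bounds)
    finally show ?thesis .
  qed
  ultimately show ?thesis by linarith
qed

end

end

section \<open>The exponential moment of the integrated rate\<close>

context lyapunov_sde begin

text \<open>The bound \<open>(K + r) / K\<close> holds up to a discretization error, which the extra
  1 absorbs on fine meshes. \<eta> has to be fixed before \<open>E\<close> and \<open>D\<close>,
  which depend on it; these are harmless because they multiply quantities that vanish with the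
  mesh.\<close>

lemma killed_weight_le:
  assumes K: "0 < K" and A: "A \<in> sets (F 0)" and Ar: "\<And>\<omega>. \<omega> \<in> A \<Longrightarrow> V (x 0 \<omega>) \<le> r" and r: "0 \<le> r" "r \<le> R"
  shows "\<exists>m>N. expectation (\<lambda>\<omega>. killed K R m A (T * m) \<omega>) \<le> (K + r + 1) / K"
proof -
  obtain CS where CS: "\<And>t. 0 \<le> t \<Longrightarrow> norm (\<Sigma> t) \<le> CS"
    using \<Sigma>_bounded unfolding bounded_iff by auto
  have CS0: "0 \<le> CS" using CS[of 0] norm_ge_zero order_trans by blast
  obtain m :: "nat \<Rightarrow> nat" and G where m: "\<And>n. n < m n" and GC: "\<And>n i. norm (G n i) \<le> CS"
    and G: "AE s in lborel. s \<in> {0..real T} \<longrightarrow> (\<lambda>n. G n (cell (m n) s)) \<longlonglongrightarrow> \<Sigma> s"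
    by (rule AE_step_approximation[OF \<Sigma>_meas, where T="real T"], erule CS, rule that)
  have R: "0 \<le> R" using r by simp
  obtain u Du Hu B where C2u: "C2_with u Du Hu" and u_ge: "\<And>z. K \<le> u z"
    and u_eq: "\<And>z. V z \<le> R \<Longrightarrow> u z = K + V z \<and> Du z = DV z \<and> Hu z = HV z"
    and uc: "uniformly_continuous_on UNIV u" "uniformly_continuous_on UNIV Du" "uniformly_continuous_on UNIV Hu"
    and B: "\<And>z. \<bar>u z\<bar> \<le> B" "\<And>z. norm (Du z) \<le> B" "\<And>z. norm (Hu z) \<le> B"
    by (rule C2_with_truncate[OF C2 V_nonneg coercive R, of K]) (rule that)
  have u_borel: "u \<in> borel_measurable borel" "Du \<in> borel_measurable borel" "Hu \<in> borel_measurable borel"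
    using C2_with_continuous[OF C2u] by (auto intro: borel_measurable_continuous_onI)
  obtain Cf where Cf: "0 \<le> Cf" "\<And>z. V z \<le> R \<Longrightarrow> norm (f z) \<le> Cf"
    using bounded_image_sublevel[OF V_cont coercive f_cont] by metis
  obtain Ch where Ch: "0 \<le> Ch" "\<And>z. V z \<le> R \<Longrightarrow> norm (h z) \<le> Ch"
    using bounded_image_sublevel[OF V_cont coercive h_cont] by metis
  define C where "C = max Cf (Ch * CS)"
  have C0: "0 \<le> C" using Cf(1) by (simp add: C_def)
  have C: "\<And>z. V z \<le> R \<Longrightarrow> norm (f z) \<le> C" "\<And>z. V z \<le> R \<Longrightarrow> norm (h z) * CS \<le> C"
    using Cf(2) mult_right_mono[OF Ch(2) CS0] by (auto simp: C_def le_max_iff_disj)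
  define A1 where "A1 = 2 * C\<^sup>2 * (1 + real CARD('m))"
  \<comment> \<open>The total coefficient of \<eta> that survives as the mesh shrinks: over time
    \<open>T\<close>, with weights at most \<open>exp (c * T)\<close>, the drift comparison
    contributes 1 and the Taylor remainder \<open>A1\<close>.\<close>
  define W where "W = real T * exp (c * real T) * (1 + A1)"
  have W0: "0 \<le> W" by (simp add: W_def A1_def)
  define \<eta> where "\<eta> = 1 / (2 * (W + 1))"
  have \<eta>: "0 < \<eta>" "W * \<eta> < 1" using W0 by (auto simp: \<eta>_def field_simps)
  obtain E where E: "0 \<le> E"
    "\<And>z e. u (z + e) \<le> u z + Du z \<bullet> e + 1/2 * (e \<bullet> (Hu z *v e)) + \<eta> * (norm e)\<^sup>2 + E * (norm e)^4"
    using taylor_upper_bound[OF C2u uc(3) B(3) \<eta>(1)] by blast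
  obtain D where D: "0 \<le> D" "\<And>z y A s. V z \<le> R \<Longrightarrow> norm A \<le> CS \<Longrightarrow> 0 \<le> s \<Longrightarrow>
     rate K z * u y + Du y \<bullet> f z + 1/2 * trace (transpose (h z ** A) ** Hu y ** (h z ** A))
       \<le> \<eta> + D * (min 1 (dist y z))\<^sup>2 + D * norm (A - \<Sigma> s)"
    using drift_le[OF K u_eq uc B CS \<eta>(1)] by blast
  define err where "err n s = indicator {0..<real T} s * (disc_err T \<eta> D (m n) (G n) s)" for n s
  have m0: "0 < m n" for n using m[of n] by simp
  note hyps = K m0 A Ar r u_ge conjunct1[OF u_eq] u_borel B E(2) D(2) less_imp_le[OF \<eta>(1)] D(1) E(1) C0 C GC CS
  have total: "K * expectation (\<lambda>\<omega>. killed K R (m n) A (T * m n) \<omega>)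
     \<le> K + r + (\<integral>s. err n s \<partial>lborel) + real T * weight_bound T * step_err B \<eta> E C (m n)" for n
    unfolding err_def by (rule weighted_total_le[OF hyps])
  have err_int: "integrable lborel (err n)" for n
    unfolding err_def[abs_def] by (rule discretization_error_integrable[OF hyps])
  have gapb: "0 \<le> gap (m n) (G n) i" "gap (m n) (G n) i \<le> 1" for n i
    by (rule gap_bounds)+
  have "(\<lambda>n. \<integral>s. err n s \<partial>lborel) \<longlonglongrightarrow> (\<integral>s. indicator {0..<real T} s * (weight_bound T * \<eta>) \<partial>lborel)"
  proof (rule integral_dominated_convergence[where w="\<lambda>s. indicator {0..<real T} s * (weight_bound T * (\<eta> + D * 1 + D * (CS + CS)))"])
    show "integrable lborel (\<lambda>s. indicator {0..<real T} s * (weight_bound T * (\<eta> + D * 1 + D * (CS + CS))))"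
      by (intro integrable_mult_left integrable_real_indicator) auto
    show "err n \<in> borel_measurable lborel" for n using err_int by (rule borel_measurable_integrable)
    show "AE s in lborel. norm (err n s) \<le> indicator {0..<real T} s * (weight_bound T * (\<eta> + D * 1 + D * (CS + CS)))" for n
    proof (rule AE_I2)
      fix s
      show "norm (err n s) \<le> indicator {0..<real T} s * (weight_bound T * (\<eta> + D * 1 + D * (CS + CS)))"
      proof (cases "s \<in> {0..<real T}")
        case True
        have "norm (G n (cell (m n) s) - \<Sigma> s) \<le> CS + CS"
          using True by (intro order_trans[OF norm_triangle_ineq4] add_mono GC CS) auto
        then have "\<eta> + D * gap (m n) (G n) (cell (m n) s) + D * norm (G n (cell (m n) s) - \<Sigma> s)
            \<le> \<eta> + D * 1 + D * (CS + CS)"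
          using gapb D(1) by (intro add_mono mult_left_mono) auto
        moreover have "0 \<le> \<eta> + D * gap (m n) (G n) (cell (m n) s) + D * norm (G n (cell (m n) s) - \<Sigma> s)"
          using \<eta> D(1) gapb by simp
        ultimately show ?thesis using True by (simp add: err_def abs_mult weight_bound_def)
      qed (simp add: err_def)
    qed
    \<comment> \<open>\<open>euler_tendsto\<close> needs irrational times, which loses only a null
      set and also excludes \<open>s = 0\<close>.\<close>
    have "AE s in lborel. s \<notin> (\<rat> :: real set)"
      by (intro AE_not_in countable_imp_null_set_lborel countable_rat)
    then show "AE s in lborel. (\<lambda>n. err n s) \<longlonglongrightarrow> indicator {0..<real T} s * (weight_bound T * \<eta>)"
      using G
    proof eventually_elim
      case (elim s)
      show ?case
      proof (cases "s \<in> {0..<real T}")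
        case True
        have "s \<noteq> 0" using elim(1) by auto
        then have s: "0 < s" "s \<le> real T" using True by auto
        have "(\<lambda>n. G n (cell (m n) s)) \<longlonglongrightarrow> \<Sigma> s" using elim(2) True by simp
        then have g1: "(\<lambda>n. norm (G n (cell (m n) s) - \<Sigma> s)) \<longlonglongrightarrow> 0"
          by (simp add: LIM_zero tendsto_norm_zero)
        have g2: "(\<lambda>n. gap (m n) (G n) (cell (m n) s)) \<longlonglongrightarrow> 0"
        proof (rule Lim_null_comparison[OF _ euler_tendsto[OF m GC CS G s elim(1)]], intro always_eventually allI)
          fix n
          let ?d = "\<lambda>\<omega>. dist (euler (m n) (G n) (cell (m n) s) \<omega>) (x (real (cell (m n) s) / m n) \<omega>)"
          have [measurable]: "euler (m n) (G n) (cell (m n) s) \<in> borel_measurable M"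
            "x (real (cell (m n) s) / m n) \<in> borel_measurable M"
            by (auto intro: euler_meas_M x_meas_M)
          \<comment> \<open>The square of a number in \<open>[0, 1]\<close> is at most the number,
            so the capped distance controls \<open>gap\<close>.\<close>
          have "gap (m n) (G n) (cell (m n) s) \<le> expectation (\<lambda>\<omega>. min 1 (?d \<omega>))"
            unfolding gap_def
          proof (rule integral_mono)
            show "integrable M (\<lambda>\<omega>. (min 1 (?d \<omega>))\<^sup>2)"
              by (rule integrable_const_bound[where B=1]) (auto intro!: power_le_one)
            show "integrable M (\<lambda>\<omega>. min 1 (?d \<omega>))"
              by (rule integrable_const_bound[where B=1]) auto
            show "(min 1 (?d \<omega>))\<^sup>2 \<le> min 1 (?d \<omega>)" for \<omega>
              unfolding power2_eq_square by (intro mult_left_le) auto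
          qed
          then show "norm (gap (m n) (G n) (cell (m n) s)) \<le> expectation (\<lambda>\<omega>. min 1 (?d \<omega>))"
            using gapb by simp
        qed
        have "(\<lambda>n. err n s) \<longlonglongrightarrow> indicator {0..<real T} s * (weight_bound T * (\<eta> + D * 0 + D * 0))"
          unfolding err_def by (intro tendsto_intros g1 g2)
        then show ?thesis by simp
      qed (simp add: err_def)
    qed
  qed simp
  moreover have "(\<integral>s. indicator {0..<real T} s * (weight_bound T * \<eta>) \<partial>lborel) = real T * (weight_bound T * \<eta>)"
    by simp
  ultimately have err_lim: "(\<lambda>n. \<integral>s. err n s \<partial>lborel) \<longlonglongrightarrow> real T * (weight_bound T * \<eta>)" by simp
  have inv: "(\<lambda>n. 1 / real (m n)) \<longlonglongrightarrow> 0"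
  proof (rule Lim_null_comparison)
    show "\<forall>\<^sub>F n in sequentially. norm (1 / real (m n)) \<le> 1 / real (Suc n)"
    proof (intro always_eventually allI)
      fix n
      have "1 / real (m n) \<le> 1 / real (Suc n)" using m[of n] by (intro divide_left_mono) auto
      then show "norm (1 / real (m n)) \<le> 1 / real (Suc n)" by simp
    qed
    show "(\<lambda>n. 1 / real (Suc n)) \<longlonglongrightarrow> 0"
      using LIMSEQ_inverse_real_of_nat by (simp add: inverse_eq_divide)
  qed
  have "(\<lambda>n. K + r + (\<integral>s. err n s \<partial>lborel) + real T * weight_bound T * step_err B \<eta> E C (m n))
    \<longlonglongrightarrow> K + r + real T * (weight_bound T * \<eta>) + real T * weight_bound T * (\<eta> * A1 + 0 * (B * C\<^sup>2 + 8 * E * C ^ 4 * (1 + 3 * (real CARD('m))\<^sup>2)))"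
    unfolding step_err_def A1_def[symmetric] by (intro tendsto_intros err_lim inv)
  moreover have "K + r + real T * (weight_bound T * \<eta>) + real T * weight_bound T * (\<eta> * A1 + 0 * (B * C\<^sup>2 + 8 * E * C ^ 4 * (1 + 3 * (real CARD('m))\<^sup>2)))
      = K + r + W * \<eta>"
    by (simp add: W_def weight_bound_def algebra_simps)
  ultimately have "\<forall>\<^sub>F n in sequentially. K + r + (\<integral>s. err n s \<partial>lborel) + real T * weight_bound T * step_err B \<eta> E C (m n) < K + r + 1"
    using \<eta>(2) by (intro order_tendstoD(2)) auto
  then obtain n0 where n0: "\<And>n. n \<ge> n0 \<Longrightarrow> K + r + (\<integral>s. err n s \<partial>lborel) + real T * weight_bound T * step_err B \<eta> E C (m n) < K + r + 1"
    unfolding eventually_sequentially by blast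
  define n where "n = max n0 N"
  have "K * expectation (\<lambda>\<omega>. killed K R (m n) A (T * m n) \<omega>) \<le> K + r + 1"
    using total[of n] n0[of n] by (simp add: n_def)
  then have "expectation (\<lambda>\<omega>. killed K R (m n) A (T * m n) \<omega>) \<le> (K + r + 1) / K"
    using K by (simp add: pos_le_divide_eq mult.commute)
  moreover have "N < m n" using m[of n] by (simp add: n_def)
  ultimately show ?thesis by blast
qed

lemma rate_path: "0 < K \<Longrightarrow> \<omega> \<in> space M \<Longrightarrow> continuous_on {0..} (\<lambda>s. rate K (x s \<omega>))"
  by (rule continuous_on_compose2[OF rate_cont x_path]) auto

abbreviation rate_int :: "real \<Rightarrow> nat \<Rightarrow> 'a \<Rightarrow> real" where
  "rate_int K T \<omega> \<equiv> integral {0..real T} (\<lambda>s. rate K (x s \<omega>))"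

text \<open>The bound is free of \<open>T\<close>, which makes the moments summable once they are
  discounted exponentially. The event \<open>A\<close> confines the estimate to initial states with
  bounded \<open>V\<close>.\<close>

lemma nn_integral_exp_rate_le:
  assumes K: "0 < K" and A: "A \<in> sets (F 0)" and Ar: "\<And>\<omega>. \<omega> \<in> A \<Longrightarrow> V (x 0 \<omega>) \<le> r" and r: "0 \<le> r"
  shows "(\<integral>\<^sup>+ \<omega>. ennreal (indicator A \<omega> * exp (rate_int K T \<omega>)) \<partial>M) \<le> ennreal ((K + r + 1) / K)"
proof -
  \<comment> \<open>One index \<open>k\<close> drives both limits: the level
    \<open>r + real k\<close> tends to infinity, and \<open>k < m k\<close> forces the mesh to
    0.\<close>
  have "\<exists>m>k. expectation (\<lambda>\<omega>. killed K (r + real k) m A (T * m) \<omega>) \<le> (K + r + 1) / K" for k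
    using r by (intro killed_weight_le K A Ar) auto
  then obtain m where m: "\<And>k. k < m k"
    and le: "\<And>k. expectation (\<lambda>\<omega>. killed K (r + real k) (m k) A (T * m k) \<omega>) \<le> (K + r + 1) / K"
    by metis
  have m0: "0 < m k" for k using m[of k] by simp
  have [measurable]: "A \<in> sets M" using A subalg[of 0] by (auto simp: subalgebra_def)
  have [measurable]: "alive R k i \<in> borel_measurable M" "weight K k i \<in> borel_measurable M" for R k i
    by (auto intro: alive_meas_M weight_meas_M)
  define Z where "Z k \<omega> = killed K (r + real k) (m k) A (T * m k) \<omega>" for k \<omega>
  have [measurable]: "Z k \<in> borel_measurable M" for k unfolding Z_def[abs_def] by measurable
  have Z0: "0 \<le> Z k \<omega>" for k \<omega> by (auto simp: Z_def weight_def intro!: mult_nonneg_nonneg alive_bounds)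
  have Zint: "integrable M (Z k)" for k
  proof (rule integrable_const_bound[where B="exp (c * real (T * m k) / m k)"])
    have "\<bar>Z k \<omega>\<bar> \<le> exp (c * real (T * m k) / m k)" for \<omega>
    proof -
      have "indicator A \<omega> * alive (r + real k) (m k) (T * m k) \<omega> \<le> 1" "0 \<le> indicator A \<omega> * alive (r + real k) (m k) (T * m k) \<omega>"
        using alive_bounds[of "r + real k" "m k" "T * m k" \<omega>] by (auto simp: indicator_def)
      then have "Z k \<omega> \<le> 1 * exp (c * real (T * m k) / m k)"
        unfolding Z_def by (intro mult_mono weight_le K) (auto simp: weight_def)
      then show ?thesis using Z0 by simp
    qed
    then show "AE \<omega> in M. norm (Z k \<omega>) \<le> exp (c * real (T * m k) / m k)" by simp
  qed measurable
  have nn: "(\<integral>\<^sup>+ \<omega>. ennreal (Z k \<omega>) \<partial>M) \<le> ennreal ((K + r + 1) / K)" for k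
    using le[of k] by (subst nn_integral_eq_integral[OF Zint]) (auto simp: Z0 Z_def[symmetric] ennreal_leI)
  have lim: "(\<lambda>k. Z k \<omega>) \<longlonglongrightarrow> indicator A \<omega> * exp (rate_int K T \<omega>)" if \<omega>: "\<omega> \<in> space M" for \<omega>
  proof -
    have Vx: "continuous_on {0..} (\<lambda>s. V (x s \<omega>))" by (rule continuous_on_compose2[OF V_cont x_path[OF \<omega>]]) auto
    have "bounded ((\<lambda>s. V (x s \<omega>)) ` {0..real T})"
      by (intro compact_imp_bounded compact_continuous_image continuous_on_subset[OF Vx]) auto
    then obtain b where b: "\<And>s. s \<in> {0..real T} \<Longrightarrow> \<bar>V (x s \<omega>)\<bar> \<le> b"
      unfolding bounded_iff by (metis image_eqI real_norm_def)
    \<comment> \<open>On a fixed path \<open>V\<close> is bounded by some \<open>b\<close> up to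
      time \<open>T\<close>, so the path is never killed once \<open>k\<close> exceeds
      \<open>b\<close>.\<close>
    have al: "alive (r + real k) (m k) (T * m k) \<omega> = 1" if "b \<le> real k" for k
    proof (rule alive_eq_1)
      fix j assume "j \<le> T * m k"
      then have "real j \<le> real T * real (m k)" by (metis of_nat_le_iff of_nat_mult)
      then have "real j / m k \<in> {0..real T}" using m0[of k] by (simp add: pos_divide_le_eq)
      from b[OF this] show "V (x (real j / m k) \<omega>) \<le> r + real k" using that r by linarith
    qed
    obtain k0 :: nat where "b \<le> real k0" using real_arch_simple by blast
    then have "\<forall>\<^sub>F k in sequentially. indicator A \<omega> * 1 * weight K (m k) (T * m k) \<omega> = Z k \<omega>"
      unfolding Z_def eventually_sequentially by (intro exI[of _ k0]) (auto simp: al)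
    moreover have "(\<lambda>k. indicator A \<omega> * 1 * weight K (m k) (T * m k) \<omega>) \<longlonglongrightarrow> indicator A \<omega> * 1 * exp (rate_int K T \<omega>)"
    proof (intro tendsto_intros)
      have "(\<lambda>k. exp (left_riemann (\<lambda>s. rate K (x s \<omega>)) (m k) (real T))) \<longlonglongrightarrow> exp (rate_int K T \<omega>)"
        by (intro tendsto_intros left_riemann_tendsto m continuous_on_subset[OF rate_path[OF K \<omega>]]) auto
      moreover have "exp (left_riemann (\<lambda>s. rate K (x s \<omega>)) (m k) (real T)) = weight K (m k) (T * m k) \<omega>" for k
      proof -
        \<comment> \<open>\<open>T\<close> is an integer and hence a grid point: the partial cell of
          the left Riemann sum is empty, and what remains is the exponent of
          \<open>weight\<close>.\<close>
        have "cell (m k) (real T) = T * m k" by (metis floor_of_nat nat_int of_nat_mult)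
        then show ?thesis using m0[of k] by (simp add: left_riemann_def weight_def)
      qed
      ultimately show "(\<lambda>k. weight K (m k) (T * m k) \<omega>) \<longlonglongrightarrow> exp (rate_int K T \<omega>)" by simp
    qed
    ultimately show ?thesis using Lim_transform_eventually by force
  qed
  have "(\<integral>\<^sup>+ \<omega>. ennreal (indicator A \<omega> * exp (rate_int K T \<omega>)) \<partial>M)
     = (\<integral>\<^sup>+ \<omega>. liminf (\<lambda>k. ennreal (Z k \<omega>)) \<partial>M)"
    using lim by (intro nn_integral_cong lim_imp_Liminf[symmetric] tendsto_ennrealI) auto
  also have "\<dots> \<le> liminf (\<lambda>k. \<integral>\<^sup>+ \<omega>. ennreal (Z k \<omega>) \<partial>M)"
    by (intro nn_integral_liminf) measurable
  also have "\<dots> \<le> ennreal ((K + r + 1) / K)"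
    by (intro Liminf_le) (auto simp: nn)
  finally show ?thesis .
qed

lemma integral_rate_meas:
  assumes K: "0 < K"
  shows "rate_int K T \<in> borel_measurable M"
proof (rule borel_measurable_LIMSEQ_metric)
  have [measurable]: "(\<lambda>\<omega>. rate K (x (real j / Suc k) \<omega>)) \<in> borel_measurable M" for j k
    by (rule measurable_compose[OF x_meas_M rate_borel]) simp
  show "(\<lambda>\<omega>. left_riemann (\<lambda>s. rate K (x s \<omega>)) (Suc k) (real T)) \<in> borel_measurable M" for k
    unfolding left_riemann_def by measurable
  show "(\<lambda>k. left_riemann (\<lambda>s. rate K (x s \<omega>)) (Suc k) (real T)) \<longlonglongrightarrow> rate_int K T \<omega>"
    if "\<omega> \<in> space M" for \<omega>
    by (intro left_riemann_tendsto continuous_on_subset[OF rate_path[OF K that]]) auto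
qed

text \<open>A Borel--Cantelli argument: the expected value of \<open>\<Sum>T. exp (\<integral>rate - \<delta> T)\<close> is finite on \<open>V (x 0) \<le> r\<close>.\<close>

lemma AE_integral_rate_le:
  assumes K: "0 < K" and \<delta>: "0 < \<delta>"
  shows "AE \<omega> in M. \<exists>b. \<forall>T :: nat. rate_int K T \<omega> \<le> \<delta> * real T + b"
proof -
  define J where "J T \<omega> = rate_int K T \<omega>" for T :: nat and \<omega>
  have [measurable]: "J T \<in> borel_measurable M" for T unfolding J_def[abs_def] by (rule integral_rate_meas[OF K])
  \<comment> \<open>These events exhaust the space as \<open>r\<close> runs through the naturals, so
    countably many null sets cover all initial states.\<close>
  define A where "A r = {\<omega>\<in>space M. V (x 0 \<omega>) \<le> real r}" for r :: nat
  have AF: "A r \<in> sets (F 0)" for r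
  proof -
    have [measurable]: "x 0 \<in> borel_measurable (F 0)" by (rule x_adapted) simp
    have sp: "space (F 0) = space M" using subalg[of 0] by (simp add: subalgebra_def)
    show ?thesis unfolding A_def sp[symmetric] by measurable
  qed
  have [measurable]: "A r \<in> sets M" for r using AF subalg[of 0] by (auto simp: subalgebra_def)
  define S where "S r \<omega> = (\<Sum>T. ennreal (indicator (A r) \<omega> * exp (J T \<omega>)) * ennreal (exp (- \<delta>) ^ T))" for r \<omega>
  have "AE \<omega> in M. S r \<omega> \<noteq> \<infinity>" for r
  proof (rule nn_integral_PInf_AE)
    show "S r \<in> borel_measurable M" unfolding S_def[abs_def] by measurable
    have "(\<integral>\<^sup>+ \<omega>. S r \<omega> \<partial>M) = (\<Sum>T. \<integral>\<^sup>+ \<omega>. ennreal (indicator (A r) \<omega> * exp (J T \<omega>)) * ennreal (exp (- \<delta>) ^ T) \<partial>M)"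
      unfolding S_def by (intro nn_integral_suminf) measurable
    also have "\<dots> \<le> (\<Sum>T. ennreal ((K + real r + 1) / K) * ennreal (exp (- \<delta>) ^ T))"
    proof (intro suminf_le summableI)
      fix T
      have "(\<integral>\<^sup>+ \<omega>. ennreal (indicator (A r) \<omega> * exp (J T \<omega>)) * ennreal (exp (- \<delta>) ^ T) \<partial>M)
         = (\<integral>\<^sup>+ \<omega>. ennreal (indicator (A r) \<omega> * exp (J T \<omega>)) \<partial>M) * ennreal (exp (- \<delta>) ^ T)"
        by (rule nn_integral_multc) measurable
      also have "\<dots> \<le> ennreal ((K + real r + 1) / K) * ennreal (exp (- \<delta>) ^ T)"
        unfolding J_def by (intro mult_right_mono nn_integral_exp_rate_le K AF) (auto simp: A_def)
      finally show "(\<integral>\<^sup>+ \<omega>. ennreal (indicator (A r) \<omega> * exp (J T \<omega>)) * ennreal (exp (- \<delta>) ^ T) \<partial>M)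
        \<le> ennreal ((K + real r + 1) / K) * ennreal (exp (- \<delta>) ^ T)" .
    qed
    also have "\<dots> = ennreal ((K + real r + 1) / K) * (\<Sum>T. ennreal (exp (- \<delta>) ^ T))"
      by (rule ennreal_suminf_cmult)
    also have "(\<Sum>T. ennreal (exp (- \<delta>) ^ T)) = ennreal (\<Sum>T. exp (- \<delta>) ^ T)"
      using \<delta> by (intro suminf_ennreal2 summable_geometric) auto
    finally show "(\<integral>\<^sup>+ \<omega>. S r \<omega> \<partial>M) \<noteq> \<infinity>"
      by (auto simp: ennreal_mult_eq_top_iff top_unique)
  qed
  then have "AE \<omega> in M. \<forall>r. S r \<omega> \<noteq> \<infinity>" by (simp add: AE_all_countable)
  with AE_space show ?thesis
  proof eventually_elim
    case (elim \<omega>)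
    obtain r :: nat where "V (x 0 \<omega>) \<le> real r" using real_arch_simple by blast
    then have r: "\<omega> \<in> A r" using elim by (simp add: A_def)
    obtain s where s: "0 \<le> s" "S r \<omega> = ennreal s" using elim by (cases "S r \<omega>") auto
    have "J T \<omega> \<le> \<delta> * real T + s" for T
    proof -
      have "ennreal (exp (J T \<omega> - \<delta> * real T)) = ennreal (indicator (A r) \<omega> * exp (J T \<omega>)) * ennreal (exp (- \<delta>) ^ T)"
        using r by (simp add: ennreal_mult[symmetric] exp_of_nat_mult[symmetric] exp_add[symmetric] mult.commute)
      also have "\<dots> \<le> S r \<omega>"
        unfolding S_def
        using sum_le_suminf[of "\<lambda>T. ennreal (indicator (A r) \<omega> * exp (J T \<omega>)) * ennreal (exp (- \<delta>) ^ T)" "{T}"] by simp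
      \<comment> \<open>Each term of a series with finite sum \<open>s\<close> is at most
        \<open>s\<close>; \<open>1 + y \<le> exp y\<close> turns this into a linear bound with
        \<open>b = s\<close>.\<close>
      finally have "exp (J T \<omega> - \<delta> * real T) \<le> s" using s by (simp add: ennreal_le_iff)
      then show ?thesis using exp_ge_add_one_self[of "J T \<omega> - \<delta> * real T"] by linarith
    qed
    then show ?case unfolding J_def by blast
  qed
qed

text \<open>The strict inequality for \<open>q\<close> leaves room to fix one finite
  \<open>K\<close>, so no limit in \<open>K\<close> has to be taken along paths.\<close>

lemma occupation_liminf:
  assumes V1: "g < V1" and q: "0 \<le> q" "q < 1 - g / V1"
  shows "AE \<omega> in M. Liminf at_top (\<lambda>T. ereal ((1 / T) * (LBINT s:{0..T}. indicator {s. V (x s \<omega>) < V1} s))) \<ge> ereal q"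
proof -
  have V1_pos: "0 < V1" using V1 g_nonneg by linarith
  \<comment> \<open>\<open>g * (K + V1) / (V1 * (K + g))\<close> is the quotient of the constants
    \<alpha> and \<beta> below; since it tends to \<open>g / V1\<close>, a large \<open>K\<close>
    brings it below \<open>1 - q\<close>.\<close>
  have "((\<lambda>K. (K + V1) / (K + g)) \<longlongrightarrow> 1) at_top" by real_asymp
  from tendsto_mult[OF tendsto_const[of "g / V1"] this]
  have "((\<lambda>K. g * (K + V1) / (V1 * (K + g))) \<longlongrightarrow> g / V1) at_top" by simp
  moreover have "g / V1 < 1 - q" using q by simp
  ultimately have "\<forall>\<^sub>F K in at_top. g * (K + V1) / (V1 * (K + g)) < 1 - q" by (rule order_tendstoD(2))
  then obtain K where K: "0 < K" "g * (K + V1) / (V1 * (K + g)) < 1 - q"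
    using eventually_gt_at_top[of "0::real"] by (metis (mono_tags, lifting) eventually_conj eventually_at_top_linorder order_refl)
  \<comment> \<open>The rate increases with \<open>V\<close>: it is at least
    \<open>- \<alpha>\<close> everywhere, its value at \<open>V = 0\<close>, and at least
    \<open>\<beta> - \<alpha>\<close> where \<open>V1 \<le> V\<close>. Both cases are contained in
    the lower bound \<open>(\<beta> - \<alpha>) - \<beta> * a s\<close>, with \<open>a\<close> the
    indicator of \<open>V < V1\<close>.\<close>
  define \<alpha> where "\<alpha> = c * g / K"
  define \<beta> where "\<beta> = \<alpha> + c * (V1 - g) / (K + V1)"
  have \<alpha>0: "0 \<le> \<alpha>" using c_pos g_nonneg K by (simp add: \<alpha>_def)
  have "0 < c * (V1 - g) / (K + V1)" using c_pos V1 V1_pos K by simp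
  then have \<beta>: "\<alpha> < \<beta>" "0 < \<beta>" using \<alpha>0 by (auto simp: \<beta>_def)
  have "\<alpha> < (1 - q) * \<beta>"
  proof -
    have \<beta>': "\<beta> = c * (V1 * (K + g)) / (K * (K + V1))"
      using K V1_pos by (simp add: \<beta>_def \<alpha>_def field_simps)
    have \<alpha>': "\<alpha> = g * (K + V1) / (V1 * (K + g)) * \<beta>"
      unfolding \<beta>' \<alpha>_def using K V1_pos g_nonneg by (simp add: divide_simps)
    show ?thesis using K(2) \<beta>(2) by (subst \<alpha>') (rule mult_strict_right_mono)
  qed
  \<comment> \<open>The growth that can be conceded to the integrated rate:
    \<open>\<beta> - \<alpha> - \<delta> = q * \<beta>\<close>, so division by \<beta> yields
    exactly the fraction \<open>q\<close> in \<open>occ_nat\<close>.\<close>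
  define \<delta> where "\<delta> = (1 - q) * \<beta> - \<alpha>"
  have \<delta>: "0 < \<delta>" using \<open>\<alpha> < (1 - q) * \<beta>\<close> by (simp add: \<delta>_def)
  show ?thesis
    using AE_space AE_integral_rate_le[OF K(1) \<delta>]
  proof eventually_elim
    case (elim \<omega>)
    then obtain b where b: "\<And>T :: nat. rate_int K T \<omega> \<le> \<delta> * real T + b" by blast
    have Vx: "continuous_on {0..} (\<lambda>s. V (x s \<omega>))" by (rule continuous_on_compose2[OF V_cont x_path[OF elim(1)]]) auto
    have "continuous_on UNIV (\<lambda>s. V (x (max 0 s) \<omega>))"
      by (rule continuous_on_compose2[OF Vx]) (auto intro!: continuous_intros)
    then have [measurable]: "(\<lambda>s. V (x (max 0 s) \<omega>)) \<in> borel_measurable borel" by (rule borel_measurable_continuous_onI)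
    \<comment> \<open>Paths are continuous on nonnegative times only; \<open>max 0\<close> gives an
      indicator that is Borel on the line and unchanged on \<open>{0..t}\<close>.\<close>
    define a where "a s = (indicator {s. V (x (max 0 s) \<omega>) < V1} s :: real)" for s
    have [measurable]: "a \<in> borel_measurable borel" unfolding a_def[abs_def] by measurable
    define occ where "occ t = (\<integral>s. indicator {0..t} s * a s \<partial>lborel)" for t
    have occ_eq: "(LBINT s:{0..t}. indicator {s. V (x s \<omega>) < V1} s) = occ t" for t
      unfolding occ_def set_lebesgue_integral_def
      by (intro Bochner_Integration.integral_cong) (auto simp: indicator_def a_def max_def)
    have int: "integrable lborel (\<lambda>s. indicator {0..t} s * a s)" for t
    proof -
      have "integrable lborel (\<lambda>s. indicator {0..t} s *\<^sub>R a s)"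
        by (rule integrableI_bounded_set_indicator[where B=1]) (auto simp: a_def indicator_def emeasure_lborel_Icc_eq)
      then show ?thesis by simp
    qed
    have occ_mono: "occ t \<le> occ t'" if "t \<le> t'" for t t'
      unfolding occ_def using that by (intro integral_mono int) (auto simp: indicator_def a_def)
    have occ_nat: "q * real T - b / \<beta> \<le> occ (real T)" for T :: nat
    proof -
      have ri: "set_integrable lborel {0..real T} (\<lambda>s. rate K (x s \<omega>))"
        by (intro borel_integrable_atLeastAtMost' continuous_on_subset[OF rate_path[OF K(1) elim(1)]]) auto
      have "(\<integral>s. indicator {0..real T} s * (\<beta> - \<alpha>) - \<beta> * (indicator {0..real T} s * a s) \<partial>lborel)
        \<le> (\<integral>s. indicator {0..real T} s *\<^sub>R rate K (x s \<omega>) \<partial>lborel)"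
      proof (rule integral_mono)
        show "integrable lborel (\<lambda>s. indicator {0..real T} s * (\<beta> - \<alpha>) - \<beta> * (indicator {0..real T} s * a s))"
          by (intro Bochner_Integration.integrable_diff integrable_mult_right integrable_mult_left int integrable_real_indicator) auto
        show "integrable lborel (\<lambda>s. indicator {0..real T} s *\<^sub>R rate K (x s \<omega>))"
          using ri by (simp add: set_integrable_def)
        fix s
        show "indicator {0..real T} s * (\<beta> - \<alpha>) - \<beta> * (indicator {0..real T} s * a s) \<le> indicator {0..real T} s *\<^sub>R rate K (x s \<omega>)"
        proof (cases "s \<in> {0..real T}")
          case True
          define v where "v = V (x s \<omega>)"
          have v0: "0 \<le> v" using V_nonneg by (simp add: v_def)
          have "(\<beta> - \<alpha>) - \<beta> * a s \<le> c * (v - g) / (K + v)"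
          proof (cases "v < V1")
            case True
            have "0 \<le> c * v * (K + g)" using c_pos v0 K g_nonneg by simp
            then have "- \<alpha> \<le> c * (v - g) / (K + v)"
              using K v0 by (simp add: \<alpha>_def field_simps)
            moreover have "a s = 1" using True \<open>s \<in> {0..real T}\<close> by (simp add: a_def v_def max_def)
            ultimately show ?thesis by simp
          next
            case False
            have "0 \<le> c * ((v - V1) * (K + g))" using False c_pos K g_nonneg by simp
            then have "c * (V1 - g) / (K + V1) \<le> c * (v - g) / (K + v)"
              using K v0 V1_pos by (simp add: field_simps)
            moreover have "a s = 0" using False \<open>s \<in> {0..real T}\<close> by (simp add: a_def v_def max_def)
            ultimately show ?thesis by (simp add: \<beta>_def)
          qed
          then show ?thesis using True by (simp add: rate_def v_def)
        qed simp
      qed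
      also have "\<dots> = rate_int K T \<omega>"
        using set_borel_integral_eq_integral(2)[OF ri] by (simp add: set_lebesgue_integral_def)
      also have "\<dots> \<le> \<delta> * real T + b" by (rule b)
      also have "(\<integral>s. indicator {0..real T} s * (\<beta> - \<alpha>) - \<beta> * (indicator {0..real T} s * a s) \<partial>lborel)
        = real T * (\<beta> - \<alpha>) - \<beta> * occ (real T)"
        using int by (subst Bochner_Integration.integral_diff) (auto simp: occ_def)
      finally have "\<beta> * (q * real T) - b \<le> \<beta> * occ (real T)" by (simp add: \<delta>_def algebra_simps)
      then have "(\<beta> * (q * real T) - b) / \<beta> \<le> occ (real T)" using \<beta>(2) by (simp add: pos_divide_le_eq mult.commute)
      then show ?thesis using \<beta>(2) by (simp add: diff_divide_distrib)
    qed
    \<comment> \<open>From integer to real horizons: the occupation time is monotone, and rounding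
      down loses at most one unit of time, hence at most \<open>q\<close> in the bound.\<close>
    have low: "q - (q + b / \<beta>) / t \<le> 1 / t * occ t" if t: "0 < t" for t
    proof -
      have fl: "real (nat \<lfloor>t\<rfloor>) = of_int \<lfloor>t\<rfloor>" using t by simp
      have "t - 1 \<le> real (nat \<lfloor>t\<rfloor>)" unfolding fl by linarith
      then have "q * (t - 1) \<le> q * real (nat \<lfloor>t\<rfloor>)" using q(1) by (rule mult_left_mono)
      also have "\<dots> \<le> occ t + b / \<beta>"
        using occ_nat[of "nat \<lfloor>t\<rfloor>"] occ_mono[of "real (nat \<lfloor>t\<rfloor>)" t] fl by linarith
      finally have "q * t - (q + b / \<beta>) \<le> occ t" by (simp add: algebra_simps)
      then have "(q * t - (q + b / \<beta>)) / t \<le> occ t / t" using t by (intro divide_right_mono) auto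
      then show ?thesis using t by (simp add: diff_divide_distrib)
    qed
    have "((\<lambda>t. q - (q + b / \<beta>) / t) \<longlongrightarrow> q - 0) at_top"
      by (intro tendsto_intros tendsto_divide_0[OF tendsto_const] filterlim_at_top_imp_at_infinity filterlim_ident)
    then have "((\<lambda>t. ereal (q - (q + b / \<beta>) / t)) \<longlongrightarrow> ereal q) at_top" by simp
    then have "ereal q = Liminf at_top (\<lambda>t. ereal (q - (q + b / \<beta>) / t))"
      by (intro lim_imp_Liminf[symmetric]) auto
    also have "\<dots> \<le> Liminf at_top (\<lambda>t. ereal (1 / t * occ t))"
    proof (rule Liminf_mono)
      show "\<forall>\<^sub>F t in at_top. ereal (q - (q + b / \<beta>) / t) \<le> ereal (1 / t * occ t)"
        using eventually_gt_at_top[of "0::real"] by eventually_elim (simp only: ereal_less_eq low)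
    qed
    finally show ?case by (simp add: occ_eq)
  qed
qed

end

section \<open>Comparison with the crossing times\<close>

lemma frob_norm_eq_norm: "frob_norm A = norm A"
  by (simp add: frob_norm_def norm_vec_def L2_set_def real_sqrt_pow2 sum_nonneg)

text \<open>Boundedness of \<Sigma> makes the supremum a genuine upper bound, since
  \<open>SUP\<close> over an unbounded set of reals is unspecified; \<gamma> is monotone on
  nonnegative arguments.\<close>

lemma gamma_max_bounds:
  assumes \<gamma>: "class_K_inf \<gamma>" and bd: "bounded (\<Sigma> ` {0..})"
  shows "0 \<le> gamma_max \<gamma> \<Sigma>"
    and "0 \<le> t \<Longrightarrow> \<gamma> (frob_norm (\<Sigma> t ** transpose (\<Sigma> t))) \<le> gamma_max \<gamma> \<Sigma>"
proof -
  define q where "q s = frob_norm (\<Sigma> s ** transpose (\<Sigma> s))" for s :: real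
  obtain C where C: "\<And>s. 0 \<le> s \<Longrightarrow> norm (\<Sigma> s) \<le> C" using bd unfolding bounded_iff by auto
  have q0: "0 \<le> q s" for s by (simp add: q_def frob_norm_eq_norm)
  have "q s \<le> C * C" if "0 \<le> s" for s
    unfolding q_def frob_norm_eq_norm
    using norm_matrix_mult_le[of "\<Sigma> s" "transpose (\<Sigma> s)"] mult_mono[OF C[OF that] C[OF that]] C[OF that]
    by (simp add: norm_transpose)
  then have bdd: "bdd_above (q ` {0..})" by (intro bdd_aboveI2[where M="C * C"]) auto
  have up: "q s \<le> (SUP s\<in>{0..}. q s)" if "0 \<le> s" for s using bdd that by (intro cSUP_upper) auto
  have mono: "\<gamma> a \<le> \<gamma> b" if "0 \<le> a" "a \<le> b" for a b
    using \<gamma> that unfolding class_K_inf_def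
    by (cases "a = b") (auto dest!: strict_mono_onD[where r=a and s=b])
  have gm: "gamma_max \<gamma> \<Sigma> = \<gamma> (SUP s\<in>{0..}. q s)" by (simp add: gamma_max_def q_def)
  show "0 \<le> t \<Longrightarrow> \<gamma> (frob_norm (\<Sigma> t ** transpose (\<Sigma> t))) \<le> gamma_max \<gamma> \<Sigma>"
    unfolding gm q_def[symmetric] using up q0 by (intro mono) auto
  have "\<gamma> 0 \<le> gamma_max \<gamma> \<Sigma>"
    unfolding gm using up[of 0] q0[of 0] by (intro mono) auto
  then show "0 \<le> gamma_max \<gamma> \<Sigma>" using \<gamma> by (simp add: class_K_inf_def)
qed

lemma class_K_inf_nonneg:
  assumes "class_K_inf \<alpha>" "0 \<le> t"
  shows "0 \<le> \<alpha> t"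
  using assms unfolding class_K_inf_def
  by (cases "t = 0") (auto dest!: strict_mono_onD[where r=0 and s=t])

lemma class_K_inf_bounded_sublevel:
  fixes V :: "'a::real_normed_vector \<Rightarrow> real"
  assumes \<alpha>: "class_K_inf \<alpha>" and V: "\<And>z. \<alpha> (norm z) \<le> V z"
  shows "bounded {z. V z \<le> r}"
proof -
  have "\<forall>\<^sub>F t in at_top. r + 1 \<le> \<alpha> t"
    using \<alpha> unfolding class_K_inf_def filterlim_at_top by blast
  then obtain b where b: "\<And>t. b \<le> t \<Longrightarrow> r + 1 \<le> \<alpha> t" unfolding eventually_at_top_linorder by blast
  have "norm z \<le> b" if "V z \<le> r" for z
    using b[of "norm z"] V[of z] that by linarith
  then show ?thesis unfolding bounded_iff by blast
qed

text \<open>Markov's inequality gives the fraction \<open>1 - g / V1\<close>, which beats the crossing-time ratio because \<open>ln a \<le> a - 1\<close>.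
  For \<open>g = 0\<close> the ratio degenerates to \<open>0\<close>, since \<open>V1 / 0 = 0\<close> and \<open>ln 0 = 0\<close>.\<close>

lemma crossing_time_ratio:
  fixes g V0 V1 c :: real
  assumes c: "0 < c" and g: "0 \<le> g" and V: "g < V0" "V0 < V1"
  defines "t_uc \<equiv> (1 / c) * ((V1 - V0) / (V1 - g)) * ln (V1 / g)"
    and "t_dc \<equiv> (1 / c) * (1 + ln ((V1 - g) / (V0 - g)))"
  shows "0 \<le> t_uc / (t_dc + t_uc)" "t_uc / (t_dc + t_uc) < 1 - g / V1"
proof -
  \<comment> \<open>With the common factor \<open>1 / c\<close> cancelled, the claim
    \<open>P / (Q + P) < 1 - g / V1\<close> becomes \<open>P * g < (V1 - g) * Q\<close>.\<close>
  define P where "P = (V1 - V0) / (V1 - g) * ln (V1 / g)"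
  define Q where "Q = 1 + ln ((V1 - g) / (V0 - g))"
  have ratio: "t_uc / (t_dc + t_uc) = P / (Q + P)"
  proof -
    have uc: "t_uc = (1 / c) * P" by (simp only: t_uc_def P_def mult.assoc)
    have "t_dc + t_uc = (1 / c) * (Q + P)" unfolding uc by (simp only: t_dc_def Q_def[symmetric] distrib_left)
    then show ?thesis using c uc by simp
  qed
  have Q: "1 < Q" using V by (simp add: Q_def ln_gt_zero)
  have P0: "0 \<le> P" and Pg: "P * g \<le> V1 - V0"
  proof -
    show "0 \<le> P"
    proof (cases "g = 0")
      case False
      then have "0 \<le> ln (V1 / g)" using g V by (intro ln_ge_zero) simp
      then show ?thesis using V by (simp add: P_def)
    qed (simp add: P_def)
    show "P * g \<le> V1 - V0"
    proof (cases "g = 0")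
      case False
      then have g': "0 < g" using g by simp
      have "ln (V1 / g) \<le> V1 / g - 1" using g' V by (intro ln_le_minus_one) simp
      then have "ln (V1 / g) * g \<le> (V1 / g - 1) * g" using g' by (intro mult_right_mono) auto
      then have "ln (V1 / g) * g \<le> V1 - g" using g' by (simp add: left_diff_distrib)
      then have "(V1 - V0) / (V1 - g) * (ln (V1 / g) * g) \<le> (V1 - V0) / (V1 - g) * (V1 - g)"
        using V by (intro mult_left_mono) auto
      then show ?thesis using V by (simp add: P_def)
    qed (use V in simp)
  qed
  show "0 \<le> t_uc / (t_dc + t_uc)" unfolding ratio using P0 Q by simp
  \<comment> \<open>Both crossing levels enter here: \<open>g < V0\<close> gives
    \<open>V1 - V0 < V1 - g\<close>, and \<open>V0 < V1\<close> gives \<open>1 < Q\<close>.\<close>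
  have "P * g < (V1 - g) * Q"
  proof -
    have "P * g < V1 - g" using Pg V by linarith
    also have "V1 - g \<le> (V1 - g) * Q" using Q V by simp
    finally show ?thesis .
  qed
  then have "P * V1 < (V1 - g) * (Q + P)" by (simp add: algebra_simps)
  then have "P / (Q + P) < (V1 - g) / V1" using P0 Q V g by (simp add: divide_simps mult.commute)
  then show "t_uc / (t_dc + t_uc) < 1 - g / V1" unfolding ratio using V g by (simp add: diff_divide_distrib)
qed

theorem theorem4p7:
  fixes M :: "'a measure" and F :: "real \<Rightarrow> 'a measure"
    and w :: "real \<Rightarrow> 'a \<Rightarrow> real^'m"
    and f :: "real^'n \<Rightarrow> real^'n" and h :: "real^'n \<Rightarrow> real^'m^'n"
    and \<Sigma> :: "real \<Rightarrow> real^'m^'m"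
    and x :: "real \<Rightarrow> 'a \<Rightarrow> real^'n"
    and V :: "real^'n \<Rightarrow> real" and DV :: "real^'n \<Rightarrow> real^'n" and HV :: "real^'n \<Rightarrow> real^'n^'n"
    and \<alpha>1 \<alpha>2 \<alpha>3 \<gamma> :: "real \<Rightarrow> real" and c V0 V1 :: real
  assumes "prob_space M"
    and "filtration_of M F"
    and "wiener_process M F w"
    and "locally_lipschitz f" and "locally_lipschitz h"
    and "\<forall>t\<ge>0. \<forall>v. v \<noteq> 0 \<longrightarrow> v \<bullet> (\<Sigma> t *v v) > 0"
    and "bounded (\<Sigma> ` {0..})"
    and "\<Sigma> \<in> borel_measurable (restrict_space borel {0..})"
    and "sde_solution M F w f h \<Sigma> x"
    and "exp_NSS f h \<Sigma> V DV HV \<alpha>1 \<alpha>2 \<alpha>3 \<gamma> c"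
    and "gamma_max \<gamma> \<Sigma> / c < V0" and "V0 < V1"
  shows "let g = gamma_max \<gamma> \<Sigma> / c;
             t_uc = (1 / c) * ((V1 - V0) / (V1 - g)) * ln (V1 / g);
             t_dc = (1 / c) * (1 + ln ((V1 - g) / (V0 - g)))
         in AE \<omega> in M.
              Liminf at_top (\<lambda>T. ereal ((1 / T) * (LBINT s:{0..T}. indicator {s. V (x s \<omega>) < V1} s)))
                \<ge> ereal (t_uc / (t_dc + t_uc))"
proof -
  have nss: "C2_with V DV HV" "class_K_inf \<alpha>1" "class_K_inf \<gamma>" "0 < c"
    "\<And>z. \<alpha>1 (norm z) \<le> V z" "\<And>z. c * V z \<le> \<alpha>3 (norm z)"
    "\<And>z t. 0 \<le> t \<Longrightarrow> gen_L f h \<Sigma> DV HV z t \<le> - \<alpha>3 (norm z) + \<gamma> (frob_norm (\<Sigma> t ** transpose (\<Sigma> t)))"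
    using assms(10) by (auto simp: exp_NSS_def)
  define g where "g = gamma_max \<gamma> \<Sigma> / c"
  have g0: "0 \<le> g" using gamma_max_bounds(1)[OF nss(3) assms(7)] nss(4) by (simp add: g_def)
  have gV: "g < V0" using assms(11) by (simp add: g_def)
  \<comment> \<open>Since \<open>c * g = gamma_max \<gamma> \<Sigma>\<close>, the decay \<alpha>3
    bounded below by \<open>c * V\<close> and the noise gain bounded by its supremum merge into the
    single generator inequality.\<close>
  have "lyapunov_sde M F w f h \<Sigma> x V DV HV c g"
  proof (intro lyapunov_sde.intro lyapunov_sde_axioms.intro assms(1-3,7-9) nss(1,4) g0
      continuous_on_UNIV_if_locally_lipschitz assms(4,5))
    show "0 \<le> V z" for z
      using class_K_inf_nonneg[OF nss(2), of "norm z"] nss(5)[of z] by simp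
    show "bounded {z. V z \<le> r}" for r by (rule class_K_inf_bounded_sublevel[OF nss(2,5)])
    show "gen_L f h \<Sigma> DV HV z t \<le> - c * (V z - g)" if "0 \<le> t" for z t
      using nss(7)[OF that, of z] nss(6)[of z] gamma_max_bounds(2)[OF nss(3) assms(7) that] nss(4)
      by (simp add: g_def algebra_simps)
  qed
  then interpret lyapunov_sde M F w f h \<Sigma> x V DV HV c g .
  show ?thesis
    unfolding Let_def g_def[symmetric]
    using gV assms(12) by (intro occupation_liminf crossing_time_ratio[OF nss(4) g0 gV assms(12)]) simp
qed

end
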